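(* Let $(\mathcal{C},\mathcal{N})$ be a homological category and consider a commutative diagram in $\mathcal{C}$ with rows $A\xrightarrow{f}B\xrightarrow{g}C$ and $A'\xrightarrow{f'}B'\xrightarrow{g'}C'$ and vertical morphisms $a:A\to A'$, $b:B\to B'$, $c:C\to C'$ (so $bf=f'a$, $cg=g'b$), where $gf$ and $g'f'$ are null and the morphisms $b$, $f$ and $g'$ are exact. Let $S$ be the left-hand and $T$ the right-hand square, let $h:H\to H'$ be the induced morphism of the homologies of the rows, and consider Nomura's null sequence (with all morphisms as described in the context) $$\operatorname{Ker}S\xrightarrow{p_1}H(\operatorname{Ker}a\to\operatorname{Ker}b\to\operatorname{Ker}c)\xrightarrow{\varkappa}\operatorname{Ker}h\xrightarrow{\beta}\operatorname{Im}S\xrightarrow{\Lambda}\operatorname{Ker}T\xrightarrow{\beta'}\operatorname{Coker}h\xrightarrow{\varkappa'}H(\operatorname{Coker}a\to\operatorname{Coker}b\to\operatorname{Coker}c)\xrightarrow{p_1'}\operatorname{Im}T .$$ Then: (i) $p_1=\ker\varkappa$ and $p_1'=\operatorname{coker}\varkappa'$. Moreover, if $(\operatorname{coker}f)\ker b$ is exact, then the sequence is exact at $\operatorname{Ker}h$ and $\varkappa$ is an exact morphism; if $(\operatorname{coker}b)\ker g'$ is exact, then the sequence is exact at $\operatorname{Coker}h$ and $\varkappa'$ is an exact morphism. (ii) If $g$ and $\eta$ are exact, then the sequence is exact at $\operatorname{Im}S$ and $\Lambda$ is an exact morphism. If $f'$ and $\eta'$ are exact, then the sequence is exact at $\operatorname{Ker}T$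 and $\Lambda$ is an exact morphism.
   Context: **Homological categories.** An ideal in a category $\mathcal{C}$ is a class $\mathcal{N}$ of morphisms such that every legitimate composite $hfg$ with $f\in\mathcal{N}$ lies in $\mathcal{N}$; morphisms in $\mathcal{N}$ are called null, and an object $A$ is null if $\mathrm{id}_A\in\mathcal{N}$. The ideal is closed if every null morphism factors through a null object. A kernel of $f:A\to B$ is a morphism $\ker f:\operatorname{Ker}f\to A$ with $f\ker f\in\mathcal{N}$ such that every $x$ with $fx\in\mathcal{N}$ factors uniquely as $x=(\ker f)x'$; the cokernel $\operatorname{coker}f:B\to\operatorname{Coker}f$ is defined dually. (Equalities between kernels, or between cokernels, are up to canonical isomorphism.) $(\mathcal{C},\mathcal{N})$ is semiexact if $\mathcal{N}$ is a closed ideal and every morphism has a kernel and a cokernel. It is homological (in the sense of Grandis) if moreover kernels and cokernels are each closed under composition, and for every kernel $i:A\to B$ and cokernel $q:B\to C$ with $(\operatorname{coker}i)(\ker q)\in\mathcal{N}$ there exist a cokernel $\pi:A\to H$ and a kernel $\iota:H\to C$ with $qi=\iota\pi$. Put $\operatorname{im}f=\ker(\operatorname{coker}f):\operatorname{Im}f\to B$ and $\operatorname{coim}f=\operatorname{coker}(\ker f):A\to\operatorname{Coim}f$. Every $f$ factors uniquely as $f=(\operatorname{im}f)\,\overline f\,\operatorname{coim}f$; the morphism $f$ is exact if $\overline f$ is an isomorphism (then $\operatorname{Coim}f$ is identified with $\operatorname{Im}f$). A sequence $X\xrightarrow{f}Y\xrightarrow{g}Z$ is exact at $Y$ if $\operatorname{im}f=\ker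 g$. **Homology.** For a null sequence $X\xrightarrow{f}Y\xrightarrow{g}Z$ ($gf$ null), its homology $H(f,g)$, also written $H(X\to Y\to Z)$, is $\operatorname{Coker}(X\to\operatorname{Ker}g)$, canonically isomorphic (in a homological category) to $\operatorname{Ker}(\operatorname{Coker}f\to Z)$, where $X\to\operatorname{Ker}g$ and $\operatorname{Coker}f\to Z$ are induced by $f$ and $g$; the canonical isomorphism $m$ is the one with $\ker(\operatorname{Coker}f\to Z)\,m\,\operatorname{coker}(X\to\operatorname{Ker}g)=(\operatorname{coker}f)\ker g$. **Lambek invariants.** For a commutative square $S$ with top $f:A\to B$, left $a:A\to C$, right $b:B\to D$, bottom $g:C\to D$: let $M$ be the pullback of $\operatorname{im}b$ and $\operatorname{im}g$, with projection $l_S:M\to\operatorname{Im}b$, and $\lambda_S:A\to M$ the morphism induced by $\overline b(\operatorname{coim}b)f:A\to\operatorname{Im}b$ and $\overline g(\operatorname{coim}g)a:A\to\operatorname{Im}g$; put $\operatorname{Im}S=\operatorname{Coker}\lambda_S$. Let $N$ be the pushout of $\operatorname{coim}a$ and $\operatorname{coim}f$, with coprojection $r_S:\operatorname{Coim}a\to N$, and $\rho_S:N\to D$ the morphism induced by $g(\operatorname{im}a)\overline a:\operatorname{Coim}a\to D$ and $b(\operatorname{im}f)\overline f:\operatorname{Coim}f\to D$; put $\operatorname{Ker}S=\operatorname{Ker}\rho_S$. These objects do not change if the square is transposed. If $S,T$ are consecutive squares (as in the claim) with null rows and with exact common vertical morphism $b$, the Lambek morphism $\Lambda_{S,T}:\operatorname{Im}S\to\operatorname{Ker}T$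 is the unique morphism with $r_T\,l_S=(\ker\rho_T)\,\Lambda_{S,T}\operatorname{coker}\lambda_S$ (with $\operatorname{Coim}b=\operatorname{Im}b$ via $\overline b$). It is known to be an isomorphism if in addition both rows are exact at the middle. The same applies to two squares stacked vertically, with columns in place of rows and the common horizontal morphism exact. Put $\Lambda=\Lambda_{S,T}$. **The diagram.** Let $g^\flat:\operatorname{Coker}f\to C$ satisfy $g^\flat\operatorname{coker}f=g$, and let $f^\sharp:A\to\operatorname{Ker}g$, $f'^\sharp:A'\to\operatorname{Ker}g'$ satisfy $(\ker g)f^\sharp=f$, $(\ker g')f'^\sharp=f'$. Let $\widehat b:\operatorname{Ker}g\to\operatorname{Ker}g'$ and $\check b:\operatorname{Coker}f\to\operatorname{Coker}f'$ be induced by $b$. The morphism $h:H=\operatorname{Coker}f^\sharp\to H'=\operatorname{Coker}f'^\sharp$ is induced by $\widehat b$ (equivalently, it is induced by $\check b$ on right homologies). Let $\xi:\operatorname{Ker}b\to\operatorname{Ker}\check b$ and $\eta:\operatorname{Ker}\check b\to\operatorname{Ker}c$ be given by $(\ker\check b)\xi=(\operatorname{coker}f)\ker b$ and $(\ker c)\eta=g^\flat\ker\check b$. The composite $\eta\xi$ is the morphism $\widehat g:\operatorname{Ker}b\to\operatorname{Ker}c$ induced by $g$, and $\operatorname{Ker}h=\operatorname{Ker}\eta$ canonically (as subobjects of $\operatorname{Coker}f$, via $H=\operatorname{Ker}g^\flat$). Dually, $\eta':\operatorname{Coker}a\to\operatorname{Coker}\widehat b$ and $\xi':\operatorname{Coker}\widehat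 b\to\operatorname{Coker}b$ are given by $\eta'\operatorname{coker}a=(\operatorname{coker}\widehat b)f'^\sharp$ and $\xi'\operatorname{coker}\widehat b=(\operatorname{coker}b)\ker g'$; the composite $\xi'\eta'$ is the morphism $\check f':\operatorname{Coker}a\to\operatorname{Coker}b$ induced by $f'$, and $\operatorname{Coker}h=\operatorname{Coker}\eta'$ canonically. Let $\widehat f:\operatorname{Ker}a\to\operatorname{Ker}b$ be induced by $f$ and $\check g':\operatorname{Coker}b\to\operatorname{Coker}c$ by $g'$. The homologies of $\operatorname{Ker}a\xrightarrow{\widehat f}\operatorname{Ker}b\xrightarrow{\widehat g}\operatorname{Ker}c$ and $\operatorname{Coker}a\xrightarrow{\check f'}\operatorname{Coker}b\xrightarrow{\check g'}\operatorname{Coker}c$ are the ones in the sequence. **$\beta,\beta'$.** Let $S_1$ be the square with top $\operatorname{coker}f$, left $b$, right $\check b$, bottom $\operatorname{coker}f'$, and $S_2$ the square with top $\xi$, left $\ker b$, right $\ker\check b$, bottom $\operatorname{coker}f$; one has $\operatorname{Im}S_2=\operatorname{Coker}\xi$. By Lambek's theorem, $\Lambda_{S,S_1}:\operatorname{Im}S\to\operatorname{Ker}S_1$ and (vertically) $\Lambda_{S_2,S_1}:\operatorname{Im}S_2\to\operatorname{Ker}S_1$ are isomorphisms. Then $\beta=\Lambda_{S,S_1}^{-1}\Lambda_{S_2,S_1}(\operatorname{coker}\xi)\ker\eta$. Let $T_1$ be the square with top $\ker g$, left $\widehat b$, right $b$, bottom $\ker g'$, and $T_2$ the square with top $\ker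 g'$, left $\operatorname{coker}\widehat b$, right $\operatorname{coker}b$, bottom $\xi'$; one has $\operatorname{Ker}T_2=\operatorname{Ker}\xi'$. The morphisms $\Lambda_{T_1,T}:\operatorname{Im}T_1\to\operatorname{Ker}T$ and (vertically) $\Lambda_{T_1,T_2}:\operatorname{Im}T_1\to\operatorname{Ker}T_2$ are isomorphisms, and $\beta'=(\operatorname{coker}\eta')(\ker\xi')\Lambda_{T_1,T_2}\Lambda_{T_1,T}^{-1}$. **$\varkappa,p_1$.** Let $S_0$ be the square with top $\widehat f$, left $\ker a$, right $\ker b$, bottom $f$. Let $\lambda:\operatorname{Ker}a\to\operatorname{Ker}\xi$ and $\mu:\operatorname{Ker}\xi\to\operatorname{Ker}(\eta\xi)$ satisfy $(\ker\xi)\lambda=\widehat f$ and $\ker(\eta\xi)\mu=\ker\xi$. Then $\operatorname{Im}S_0=\operatorname{Coker}\lambda$ and $H(\operatorname{Ker}a\to\operatorname{Ker}b\to\operatorname{Ker}c)=\operatorname{Coker}(\mu\lambda)$. Let $p:\operatorname{Coker}\lambda\to\operatorname{Coker}(\mu\lambda)$ be given by $p\operatorname{coker}\lambda=\operatorname{coker}(\mu\lambda)\,\mu$. With $v:\operatorname{Ker}(\eta\xi)\to\operatorname{Ker}\eta$ given by $(\ker\eta)v=\xi\ker(\eta\xi)$, the morphism $\varkappa$ is the unique one with $\varkappa\operatorname{coker}(\mu\lambda)=v$. Since $f$ is exact, (vertically) $\Lambda_{S_0,S}:\operatorname{Im}S_0\to\operatorname{Ker}S$ is an isomorphism, and $p_1=p\,\Lambda_{S_0,S}^{-1}$.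 **$\varkappa',p_1'$.** Dually, let $T_0$ be the square with top $g'$, left $\operatorname{coker}b$, right $\operatorname{coker}c$, bottom $\check g'$. Let $\mu':\operatorname{Coker}(\xi'\eta')\to\operatorname{Coker}\xi'$ and $\lambda':\operatorname{Coker}\xi'\to\operatorname{Coker}c$ satisfy $\mu'\operatorname{coker}(\xi'\eta')=\operatorname{coker}\xi'$ and $\lambda'\operatorname{coker}\xi'=\check g'$. Then $\operatorname{Ker}T_0=\operatorname{Ker}\lambda'$ and $H(\operatorname{Coker}a\to\operatorname{Coker}b\to\operatorname{Coker}c)=\operatorname{Ker}(\lambda'\mu')$. With $u:\operatorname{Coker}\eta'\to\operatorname{Coker}(\xi'\eta')$ given by $u\operatorname{coker}\eta'=\operatorname{coker}(\xi'\eta')\,\xi'$, the morphism $\varkappa'$ is the unique one with $\ker(\lambda'\mu')\,\varkappa'=u$; let $p':\operatorname{Ker}(\lambda'\mu')\to\operatorname{Ker}\lambda'$ be given by $(\ker\lambda')p'=\mu'\ker(\lambda'\mu')$. Since $g'$ is exact, (vertically) $\Lambda_{T,T_0}:\operatorname{Im}T\to\operatorname{Ker}T_0$ is an isomorphism, and $p_1'=\Lambda_{T,T_0}^{-1}p'$. *)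

theory Defs
  imports Main
begin

text \<open>
  A category is a record of objects, morphisms and structure maps. Composition is total on the
  type of morphisms and only meaningful on composable pairs; \<open>g \<cdot> f\<close> means first \<open>f\<close>, then \<open>g\<close>.
\<close>

record ('o, 'm) cat =
  Ob :: "'o set"
  Mor :: "'m set"
  Dom :: "'m \<Rightarrow> 'o"
  Cod :: "'m \<Rightarrow> 'o"
  Ident :: "'o \<Rightarrow> 'm"
  Comp :: "'m \<Rightarrow> 'm \<Rightarrow> 'm" (infixr "\<cdot>\<index>" 70)

text \<open>A square with \<open>top : A \<rightarrow> B\<close>, \<open>left : A \<rightarrow> C\<close>, \<open>right : B \<rightarrow> D\<close>, \<open>bottom : C \<rightarrow> D\<close>.\<close>

datatype 'm square = Square (top_of: 'm) (left_of: 'm) (right_of: 'm) (bottom_of: 'm)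

text \<open>\<open>Ladder f g f' g' a b c\<close> has rows \<open>A \<rightarrow> B \<rightarrow> C\<close> and \<open>A' \<rightarrow> B' \<rightarrow> C'\<close>, and verticals \<open>a, b, c\<close>.\<close>

datatype 'm ladder = Ladder
  (lad_f: 'm) (lad_g: 'm) (lad_f': 'm) (lad_g': 'm) (lad_a: 'm) (lad_b: 'm) (lad_c: 'm)

context
  fixes C :: "('o, 'm) cat" (structure)
begin

definition category :: bool where
  "category \<longleftrightarrow>
     (\<forall>A\<in>Ob C. Ident C A \<in> Mor C \<and> Dom C (Ident C A) = A \<and> Cod C (Ident C A) = A) \<and>
     (\<forall>f\<in>Mor C. Dom C f \<in> Ob C \<and> Cod C f \<in> Ob C) \<and>
     (\<forall>f\<in>Mor C. \<forall>g\<in>Mor C. Cod C f = Dom C g \<longrightarrow>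
        g \<cdot> f \<in> Mor C \<and> Dom C (g \<cdot> f) = Dom C f \<and> Cod C (g \<cdot> f) = Cod C g) \<and>
     (\<forall>f\<in>Mor C. f \<cdot> Ident C (Dom C f) = f \<and> Ident C (Cod C f) \<cdot> f = f) \<and>
     (\<forall>f\<in>Mor C. \<forall>g\<in>Mor C. \<forall>h\<in>Mor C. Cod C f = Dom C g \<and> Cod C g = Dom C h \<longrightarrow>
        (h \<cdot> g) \<cdot> f = h \<cdot> (g \<cdot> f))"

definition hom :: "'o \<Rightarrow> 'o \<Rightarrow> 'm set" where
  "hom A B = {f \<in> Mor C. Dom C f = A \<and> Cod C f = B}"

definition inverses :: "'m \<Rightarrow> 'm \<Rightarrow> bool" where
  "inverses f g \<longleftrightarrow> f \<in> Mor C \<and> g \<in> hom (Cod C f) (Dom C f) \<and>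
     g \<cdot> f = Ident C (Dom C f) \<and> f \<cdot> g = Ident C (Cod C f)"

definition iso :: "'m \<Rightarrow> bool" where
  "iso f \<longleftrightarrow> (\<exists>g. inverses f g)"

definition inverse_mor :: "'m \<Rightarrow> 'm" where
  "inverse_mor f = (THE g. inverses f g)"

text \<open>
  Equality of kernels (as morphisms into one object) and of cokernels (as morphisms out of one
  object) up to isomorphism; since kernels are monic and cokernels epic, the isomorphism is unique.
\<close>

definition same_sub :: "'m \<Rightarrow> 'm \<Rightarrow> bool" where
  "same_sub i j \<longleftrightarrow> i \<in> Mor C \<and> j \<in> Mor C \<and> (\<exists>t \<in> hom (Dom C i) (Dom C j). iso t \<and> i = j \<cdot> t)"

definition same_quot :: "'m \<Rightarrow> 'm \<Rightarrow> bool" where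
  "same_quot p q \<longleftrightarrow> p \<in> Mor C \<and> q \<in> Mor C \<and> (\<exists>t \<in> hom (Cod C q) (Cod C p). iso t \<and> p = t \<cdot> q)"

text \<open>
  The morphism \<open>x'\<close> with \<open>k \<cdot> x' = x\<close>, and the morphism \<open>y'\<close> with \<open>y' \<cdot> q = y\<close>. They are used
  only for monic \<open>k\<close> and epic \<open>q\<close> through which \<open>x\<close>, respectively \<open>y\<close>, factors.
\<close>

definition lift :: "'m \<Rightarrow> 'm \<Rightarrow> 'm" where
  "lift k x = (THE x'. x' \<in> hom (Dom C x) (Dom C k) \<and> k \<cdot> x' = x)"

definition colift :: "'m \<Rightarrow> 'm \<Rightarrow> 'm" where
  "colift q y = (THE y'. y' \<in> hom (Cod C q) (Cod C y) \<and> y' \<cdot> q = y)"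

definition is_pullback :: "'m \<Rightarrow> 'm \<Rightarrow> 'm \<Rightarrow> 'm \<Rightarrow> bool" where
  "is_pullback i j p q \<longleftrightarrow>
     i \<in> Mor C \<and> j \<in> Mor C \<and> p \<in> Mor C \<and> q \<in> Mor C \<and> Cod C i = Cod C j \<and>
     Cod C p = Dom C i \<and> Cod C q = Dom C j \<and> Dom C p = Dom C q \<and> i \<cdot> p = j \<cdot> q \<and>
     (\<forall>x\<in>Mor C. \<forall>y\<in>Mor C. Dom C x = Dom C y \<and> Cod C x = Dom C i \<and> Cod C y = Dom C j \<and>
        i \<cdot> x = j \<cdot> y \<longrightarrow> (\<exists>!z. z \<in> hom (Dom C x) (Dom C p) \<and> p \<cdot> z = x \<and> q \<cdot> z = y))"

definition is_pushout :: "'m \<Rightarrow> 'm \<Rightarrow> 'm \<Rightarrow> 'm \<Rightarrow> bool" where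
  "is_pushout i j p q \<longleftrightarrow>
     i \<in> Mor C \<and> j \<in> Mor C \<and> p \<in> Mor C \<and> q \<in> Mor C \<and> Dom C i = Dom C j \<and>
     Dom C p = Cod C i \<and> Dom C q = Cod C j \<and> Cod C p = Cod C q \<and> p \<cdot> i = q \<cdot> j \<and>
     (\<forall>x\<in>Mor C. \<forall>y\<in>Mor C. Cod C x = Cod C y \<and> Dom C x = Cod C i \<and> Dom C y = Cod C j \<and>
        x \<cdot> i = y \<cdot> j \<longrightarrow> (\<exists>!z. z \<in> hom (Cod C p) (Cod C x) \<and> z \<cdot> p = x \<and> z \<cdot> q = y))"

context
  fixes N :: "'m set"
begin

definition is_ideal :: bool where
  "is_ideal \<longleftrightarrow> N \<subseteq> Mor C \<and>
     (\<forall>f\<in>N. \<forall>g\<in>Mor C. \<forall>h\<in>Mor C. Cod C g = Dom C f \<and> Cod C f = Dom C h \<longrightarrow> h \<cdot> f \<cdot> g \<in> N)"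

definition null_object :: "'o \<Rightarrow> bool" where
  "null_object A \<longleftrightarrow> A \<in> Ob C \<and> Ident C A \<in> N"

definition closed_ideal :: bool where
  "closed_ideal \<longleftrightarrow> is_ideal \<and>
     (\<forall>f\<in>N. \<exists>A g h. null_object A \<and> g \<in> hom (Dom C f) A \<and> h \<in> hom A (Cod C f) \<and> f = h \<cdot> g)"

definition is_kernel :: "'m \<Rightarrow> 'm \<Rightarrow> bool" where
  "is_kernel f k \<longleftrightarrow> f \<in> Mor C \<and> k \<in> Mor C \<and> Cod C k = Dom C f \<and> f \<cdot> k \<in> N \<and>
     (\<forall>x\<in>Mor C. Cod C x = Dom C f \<and> f \<cdot> x \<in> N \<longrightarrow>
        (\<exists>!x'. x' \<in> hom (Dom C x) (Dom C k) \<and> x = k \<cdot> x'))"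

definition is_cokernel :: "'m \<Rightarrow> 'm \<Rightarrow> bool" where
  "is_cokernel f q \<longleftrightarrow> f \<in> Mor C \<and> q \<in> Mor C \<and> Dom C q = Cod C f \<and> q \<cdot> f \<in> N \<and>
     (\<forall>y\<in>Mor C. Dom C y = Cod C f \<and> y \<cdot> f \<in> N \<longrightarrow>
        (\<exists>!y'. y' \<in> hom (Cod C q) (Cod C y) \<and> y = y' \<cdot> q))"

definition ker :: "'m \<Rightarrow> 'm" where
  "ker f = (SOME k. is_kernel f k)"

definition coker :: "'m \<Rightarrow> 'm" where
  "coker f = (SOME q. is_cokernel f q)"

definition kernel_mor :: "'m \<Rightarrow> bool" where
  "kernel_mor i \<longleftrightarrow> (\<exists>f. is_kernel f i)"

definition cokernel_mor :: "'m \<Rightarrow> bool" where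
  "cokernel_mor q \<longleftrightarrow> (\<exists>f. is_cokernel f q)"

definition semiexact :: bool where
  "semiexact \<longleftrightarrow> category \<and> closed_ideal \<and>
     (\<forall>f\<in>Mor C. (\<exists>k. is_kernel f k) \<and> (\<exists>q. is_cokernel f q))"

definition homological :: bool where
  "homological \<longleftrightarrow> semiexact \<and>
     (\<forall>i j. kernel_mor i \<and> kernel_mor j \<and> Cod C i = Dom C j \<longrightarrow> kernel_mor (j \<cdot> i)) \<and>
     (\<forall>p q. cokernel_mor p \<and> cokernel_mor q \<and> Cod C p = Dom C q \<longrightarrow> cokernel_mor (q \<cdot> p)) \<and>
     (\<forall>i q. kernel_mor i \<and> cokernel_mor q \<and> Cod C i = Dom C q \<and> coker i \<cdot> ker q \<in> N \<longrightarrow>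
        (\<exists>\<pi> \<iota>. cokernel_mor \<pi> \<and> kernel_mor \<iota> \<and> Dom C \<pi> = Dom C i \<and> Cod C \<iota> = Cod C q \<and>
           Cod C \<pi> = Dom C \<iota> \<and> q \<cdot> i = \<iota> \<cdot> \<pi>))"

definition im :: "'m \<Rightarrow> 'm" where
  "im f = ker (coker f)"

definition coim :: "'m \<Rightarrow> 'm" where
  "coim f = coker (ker f)"

definition bar :: "'m \<Rightarrow> 'm" where
  "bar f = (THE m. m \<in> hom (Cod C (coim f)) (Dom C (im f)) \<and> f = im f \<cdot> m \<cdot> coim f)"

definition exact_mor :: "'m \<Rightarrow> bool" where
  "exact_mor f \<longleftrightarrow> f \<in> Mor C \<and> iso (bar f)"

definition exact_at :: "'m \<Rightarrow> 'm \<Rightarrow> bool" where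
  "exact_at f g \<longleftrightarrow> f \<in> Mor C \<and> g \<in> Mor C \<and> Cod C f = Dom C g \<and> same_sub (im f) (ker g)"

text \<open>
  For a null sequence \<open>X \<rightarrow> Y \<rightarrow> Z\<close>: the morphisms \<open>X \<rightarrow> Ker g\<close> and \<open>Coker f \<rightarrow> Z\<close>, the projection of
  \<open>Ker g\<close> onto the homology \<open>H(f,g)\<close>, and the canonical isomorphism from \<open>H(f,g)\<close> to
  \<open>Ker (Coker f \<rightarrow> Z)\<close>.
\<close>

definition sharp :: "'m \<Rightarrow> 'm \<Rightarrow> 'm" where
  "sharp f g = lift (ker g) f"

definition flat :: "'m \<Rightarrow> 'm \<Rightarrow> 'm" where
  "flat f g = colift (coker f) g"

definition homology_proj :: "'m \<Rightarrow> 'm \<Rightarrow> 'm" where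
  "homology_proj f g = coker (sharp f g)"

definition homology :: "'m \<Rightarrow> 'm \<Rightarrow> 'o" where
  "homology f g = Cod C (homology_proj f g)"

definition homology_iso :: "'m \<Rightarrow> 'm \<Rightarrow> 'm" where
  "homology_iso f g = (THE m. m \<in> hom (homology f g) (Dom C (ker (flat f g))) \<and>
     ker (flat f g) \<cdot> m \<cdot> homology_proj f g = coker f \<cdot> ker g)"

text \<open>
  The pullback \<open>M\<close> carries the projections \<open>sq_l : M \<rightarrow> Im right\<close> and \<open>sq_lv : M \<rightarrow> Im bottom\<close>,
  the pushout \<open>N\<close> the coprojections \<open>sq_r : Coim left \<rightarrow> N\<close> and \<open>sq_rv : Coim top \<rightarrow> N\<close>. Transposing
  the square exchanges the two members of each pair and keeps \<open>sq_lam\<close> and \<open>sq_rho\<close>.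
\<close>

definition sq_pb :: "'m square \<Rightarrow> 'm \<times> 'm" where
  "sq_pb S = (SOME (p, q). is_pullback (im (right_of S)) (im (bottom_of S)) p q)"

definition sq_po :: "'m square \<Rightarrow> 'm \<times> 'm" where
  "sq_po S = (SOME (p, q). is_pushout (coim (left_of S)) (coim (top_of S)) p q)"

definition sq_l :: "'m square \<Rightarrow> 'm" where "sq_l S = fst (sq_pb S)"
definition sq_lv :: "'m square \<Rightarrow> 'm" where "sq_lv S = snd (sq_pb S)"
definition sq_r :: "'m square \<Rightarrow> 'm" where "sq_r S = fst (sq_po S)"
definition sq_rv :: "'m square \<Rightarrow> 'm" where "sq_rv S = snd (sq_po S)"

definition sq_lam :: "'m square \<Rightarrow> 'm" where
  "sq_lam S = (THE l. l \<in> hom (Dom C (top_of S)) (Dom C (sq_l S)) \<and>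
     sq_l S \<cdot> l = bar (right_of S) \<cdot> coim (right_of S) \<cdot> top_of S \<and>
     sq_lv S \<cdot> l = bar (bottom_of S) \<cdot> coim (bottom_of S) \<cdot> left_of S)"

definition sq_rho :: "'m square \<Rightarrow> 'm" where
  "sq_rho S = (THE r. r \<in> hom (Cod C (sq_r S)) (Cod C (bottom_of S)) \<and>
     r \<cdot> sq_r S = bottom_of S \<cdot> im (left_of S) \<cdot> bar (left_of S) \<and>
     r \<cdot> sq_rv S = right_of S \<cdot> im (top_of S) \<cdot> bar (top_of S))"

definition Im_sq :: "'m square \<Rightarrow> 'o" where
  "Im_sq S = Cod C (coker (sq_lam S))"

definition Ker_sq :: "'m square \<Rightarrow> 'o" where
  "Ker_sq S = Dom C (ker (sq_rho S))"

text \<open>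
  Lambek morphisms for \<open>T\<close> to the right of \<open>S\<close> and for \<open>T\<close> below \<open>S\<close>; the inverse of \<open>bar\<close> of the
  common exact morphism is the identification of its image with its coimage.
\<close>

definition Lambek :: "'m square \<Rightarrow> 'm square \<Rightarrow> 'm" where
  "Lambek S T = (THE L. L \<in> hom (Im_sq S) (Ker_sq T) \<and>
     sq_r T \<cdot> inverse_mor (bar (right_of S)) \<cdot> sq_l S = ker (sq_rho T) \<cdot> L \<cdot> coker (sq_lam S))"

definition Lambek_vert :: "'m square \<Rightarrow> 'm square \<Rightarrow> 'm" where
  "Lambek_vert S T = (THE L. L \<in> hom (Im_sq S) (Ker_sq T) \<and>
     sq_rv T \<cdot> inverse_mor (bar (bottom_of S)) \<cdot> sq_lv S = ker (sq_rho T) \<cdot> L \<cdot> coker (sq_lam S))"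

context
  fixes D :: "'m ladder"
begin

private abbreviation (input) f where "f \<equiv> lad_f D"
private abbreviation (input) g where "g \<equiv> lad_g D"
private abbreviation (input) f' where "f' \<equiv> lad_f' D"
private abbreviation (input) g' where "g' \<equiv> lad_g' D"
private abbreviation (input) a where "a \<equiv> lad_a D"
private abbreviation (input) b where "b \<equiv> lad_b D"
private abbreviation (input) c where "c \<equiv> lad_c D"

definition ladder_diagram :: bool where
  "ladder_diagram \<longleftrightarrow>
     f \<in> Mor C \<and> g \<in> Mor C \<and> f' \<in> Mor C \<and> g' \<in> Mor C \<and> a \<in> Mor C \<and> b \<in> Mor C \<and> c \<in> Mor C \<and>
     Dom C g = Cod C f \<and> Dom C g' = Cod C f' \<and>
     Dom C a = Dom C f \<and> Cod C a = Dom C f' \<and>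
     Dom C b = Cod C f \<and> Cod C b = Cod C f' \<and>
     Dom C c = Cod C g \<and> Cod C c = Cod C g' \<and>
     b \<cdot> f = f' \<cdot> a \<and> c \<cdot> g = g' \<cdot> b \<and> g \<cdot> f \<in> N \<and> g' \<cdot> f' \<in> N"

definition sq_S :: "'m square" where "sq_S = Square f a b f'"
definition sq_T :: "'m square" where "sq_T = Square g b c g'"

definition hat_b :: 'm where "hat_b = lift (ker g') (b \<cdot> ker g)"
definition check_b :: 'm where "check_b = colift (coker f) (coker f' \<cdot> b)"

definition hom_map :: 'm where
  "hom_map = colift (homology_proj f g) (homology_proj f' g' \<cdot> hat_b)"

definition xi :: 'm where "xi = lift (ker check_b) (coker f \<cdot> ker b)"
definition eta :: 'm where "eta = lift (ker c) (flat f g \<cdot> ker check_b)"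
definition eta' :: 'm where "eta' = colift (coker a) (coker hat_b \<cdot> sharp f' g')"
definition xi' :: 'm where "xi' = colift (coker hat_b) (coker b \<cdot> ker g')"

definition hat_f :: 'm where "hat_f = lift (ker b) (f \<cdot> ker a)"
definition hat_g :: 'm where "hat_g = lift (ker c) (g \<cdot> ker b)"
definition check_f' :: 'm where "check_f' = colift (coker a) (coker b \<cdot> f')"
definition check_g' :: 'm where "check_g' = colift (coker b) (coker c \<cdot> g')"

text \<open>
  With \<open>h = hom_map\<close>: the identification \<open>Ker h \<rightarrow> Ker eta\<close> of subobjects of \<open>Coker f\<close>, and
  the identification \<open>Coker eta' \<rightarrow> Coker h\<close> of quotients of \<open>Ker g'\<close>.
\<close>

definition ker_h_iso :: 'm where
  "ker_h_iso = lift (ker check_b \<cdot> ker eta) (ker (flat f g) \<cdot> homology_iso f g \<cdot> ker hom_map)"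

definition coker_h_iso :: 'm where
  "coker_h_iso = colift (coker eta' \<cdot> coker hat_b) (coker hom_map \<cdot> homology_proj f' g')"

definition sq_S0 :: "'m square" where "sq_S0 = Square hat_f (ker a) (ker b) f"
definition sq_S1 :: "'m square" where "sq_S1 = Square (coker f) b check_b (coker f')"
definition sq_S2 :: "'m square" where "sq_S2 = Square xi (ker b) (ker check_b) (coker f)"
definition sq_T0 :: "'m square" where "sq_T0 = Square g' (coker b) (coker c) check_g'"
definition sq_T1 :: "'m square" where "sq_T1 = Square (ker g) hat_b b (ker g')"
definition sq_T2 :: "'m square" where "sq_T2 = Square (ker g') (coker hat_b) (coker b) xi'"

text \<open>
  The identification \<open>Im sq_S2 \<rightarrow> Coker xi\<close>: the pullback belonging to \<open>sq_S2\<close> is \<open>Ker check_b\<close>, as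
  subobjects of \<open>Coker f\<close>, and then \<open>sq_lam sq_S2\<close> is \<open>xi\<close>.
\<close>

definition S2_iso :: 'm where
  "S2_iso = colift (coker (sq_lam sq_S2))
     (coker xi \<cdot> lift (ker check_b) (im (ker check_b) \<cdot> sq_l sq_S2))"

definition beta :: 'm where
  "beta = inverse_mor (Lambek sq_S sq_S1) \<cdot> Lambek_vert sq_S2 sq_S1 \<cdot>
     inverse_mor S2_iso \<cdot> coker xi \<cdot> ker eta"

text \<open>
  The identification \<open>Ker xi' \<rightarrow> Ker sq_T2\<close>: the pushout belonging to \<open>sq_T2\<close> is \<open>Coker hat_b\<close>, as
  quotients of \<open>Ker g'\<close>, and then \<open>sq_rho sq_T2\<close> is \<open>xi'\<close>.
\<close>

definition T2_iso :: 'm where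
  "T2_iso = lift (ker (sq_rho sq_T2))
     (colift (coker hat_b) (sq_r sq_T2 \<cdot> coim (coker hat_b)) \<cdot> ker xi')"

definition beta' :: 'm where
  "beta' = coker eta' \<cdot> ker xi' \<cdot> inverse_mor T2_iso \<cdot>
     Lambek_vert sq_T1 sq_T2 \<cdot> inverse_mor (Lambek sq_T1 sq_T)"

definition lam :: 'm where "lam = lift (ker xi) hat_f"
definition mu :: 'm where "mu = lift (ker (eta \<cdot> xi)) (ker xi)"

text \<open>
  Since \<open>eta \<cdot> xi = hat_g\<close> and \<open>mu \<cdot> lam = sharp hat_f hat_g\<close>, the codomain of \<open>coker (mu \<cdot> lam)\<close> is
  \<open>homology hat_f hat_g\<close>.
\<close>

definition p_mor :: 'm where "p_mor = colift (coker lam) (coker (mu \<cdot> lam) \<cdot> mu)"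
definition v_mor :: 'm where "v_mor = lift (ker eta) (xi \<cdot> ker (eta \<cdot> xi))"
definition kappa :: 'm where "kappa = colift (coker (mu \<cdot> lam)) v_mor"

text \<open>
  The identification \<open>Im sq_S0 \<rightarrow> Coker lam\<close>: the pullback belonging to \<open>sq_S0\<close> is \<open>Ker xi\<close>,
  as subobjects of the domain of \<open>b\<close>, and then \<open>sq_lam sq_S0\<close> is \<open>lam\<close>.
\<close>

definition S0_iso :: 'm where
  "S0_iso = colift (coker (sq_lam sq_S0))
     (coker lam \<cdot> lift (ker b \<cdot> ker xi) (im (ker b) \<cdot> sq_l sq_S0))"

definition p1 :: 'm where
  "p1 = p_mor \<cdot> S0_iso \<cdot> inverse_mor (Lambek_vert sq_S0 sq_S)"

definition mu' :: 'm where "mu' = colift (coker (xi' \<cdot> eta')) (coker xi')"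
definition lam' :: 'm where "lam' = colift (coker xi') check_g'"
definition u_mor :: 'm where "u_mor = colift (coker eta') (coker (xi' \<cdot> eta') \<cdot> xi')"
definition kappa' :: 'm where "kappa' = lift (ker (lam' \<cdot> mu')) u_mor"
definition p_mor' :: 'm where "p_mor' = lift (ker lam') (mu' \<cdot> ker (lam' \<cdot> mu'))"

text \<open>
  The identification \<open>Ker lam' \<rightarrow> Ker sq_T0\<close>: the pushout belonging to \<open>sq_T0\<close> is \<open>Coker xi'\<close>,
  as quotients of the codomain of \<open>b\<close>, and then \<open>sq_rho sq_T0\<close> is \<open>lam'\<close>.
\<close>

definition T0_iso :: 'm where
  "T0_iso = lift (ker (sq_rho sq_T0))
     (colift (coker xi' \<cdot> coker b) (sq_r sq_T0 \<cdot> coim (coker b)) \<cdot> ker lam')"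

definition p1' :: 'm where
  "p1' = inverse_mor (Lambek_vert sq_T sq_T0) \<cdot> T0_iso \<cdot> p_mor'"

text \<open>
  The morphisms of the sequence itself, running through the objects \<open>Ker h\<close>, \<open>Coker h\<close> and
  \<open>homology check_f' check_g'\<close>. As \<open>xi' \<cdot> eta' = check_f'\<close> and \<open>lam' \<cdot> mu' = flat check_f' check_g'\<close>,
  \<open>Ker (lam' \<cdot> mu')\<close> is the right-hand form of that homology.
\<close>

definition nomura_kappa :: 'm where "nomura_kappa = inverse_mor ker_h_iso \<cdot> kappa"
definition nomura_beta :: 'm where "nomura_beta = beta \<cdot> ker_h_iso"
definition nomura_Lambda :: 'm where "nomura_Lambda = Lambek sq_S sq_T"
definition nomura_beta' :: 'm where "nomura_beta' = coker_h_iso \<cdot> beta'"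
definition nomura_kappa' :: 'm where
  "nomura_kappa' = inverse_mor (homology_iso check_f' check_g') \<cdot> kappa' \<cdot> inverse_mor coker_h_iso"
definition nomura_p1 :: 'm where "nomura_p1 = p1"
definition nomura_p1' :: 'm where "nomura_p1' = p1' \<cdot> homology_iso check_f' check_g'"

end

end

end

end

theory Submission
  imports Defs
begin

text \<open>
  The subquotient axiom is used in one form only: if
  \<open>l\<close> is a kernel and \<open>r\<close> is the cokernel of \<open>l \<cdot> d\<close>, then \<open>r \<cdot> l = i \<cdot> p\<close> with \<open>i\<close> a kernel and \<open>p\<close> a cokernel
  of \<open>d\<close>, and dually. Applied to the middle object of the exact vertical \<open>b\<close> it gives Lambek's theorem, and
  applied to \<open>coker (mu \<cdot> lam)\<close> it gives \<open>p = ker kappa\<close>. Up to an isomorphism \<open>t\<close> the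
  morphism \<open>beta\<close> is \<open>coker xi \<cdot> ker eta\<close>, and if \<open>g\<close> and \<open>eta\<close> are exact then the composite of \<open>Lambda \<cdot> t\<close> with
  \<open>coker xi\<close> is \<open>Ker check_b \<rightarrow> Im eta \<rightarrow> Im eta / g(Ker b)\<close> followed by a kernel. The other
  half of the statement is the same in the opposite category, where the rows trade places.
\<close>

subsection \<open>The opposite category\<close>

text \<open>Kernels, cokernels, pullbacks and pushouts are chosen by \<open>SOME\<close>, so a
  composite that ought to be a kernel is almost never the chosen one. The arguments therefore run on
  the relations \<open>is_kernel\<close> and \<open>is_cokernel\<close>, and chosen representatives
  meet only through the unique isomorphism between two kernels of one morphism. The same choices
  make duality cheap: \<open>op\<close> turns the predicate that selects a kernel into the one that
  selects a cokernel, so most dual constants are equal and not merely isomorphic. What needs an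
  argument are definitions that fix a bracketing or prefer one side: \<open>bar\<close>, the Lambek
  morphisms, and the map on homology.

  There are no elements and no sums to chase with. An inclusion of images has to be produced as a
  factorization, and an equation is tested by cancelling a monomorphism on the left and an
  epimorphism on the right. Lambek morphisms are described by passing through the image of
  \<open>b\<close>, while \<open>Ker check_b\<close> lives in a quotient of the domain of
  \<open>b\<close>; this is why a comparison between the two goes through a subobject of that
  domain.\<close>

definition op :: "('o, 'm) cat \<Rightarrow> ('o, 'm) cat" where
  "op C = C\<lparr>Dom := Cod C, Cod := Dom C, Comp := \<lambda>g f. f \<cdot>\<^bsub>C\<^esub> g\<rparr>"

lemma op_sel [simp]:
  "Ob (op C) = Ob C" "Mor (op C) = Mor C" "Dom (op C) = Cod C" "Cod (op C) = Dom C"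
  "Ident (op C) = Ident C" "Comp (op C) g f = f \<cdot>\<^bsub>C\<^esub> g"
  by (simp_all add: op_def)

lemma op_op [simp]: "op (op C) = C"
  by (simp add: op_def)

lemma op_hom [simp]: "hom (op C) A B = hom C B A"
  by (auto simp: hom_def)

lemma op_inverses [simp]: "inverses (op C) f g = inverses C f g"
  by (auto simp: inverses_def)

lemma op_iso [simp]: "iso (op C) f = iso C f"
  by (simp add: iso_def)

lemma op_inverse_mor [simp]: "inverse_mor (op C) f = inverse_mor C f"
  by (simp add: inverse_mor_def)

lemma op_lift [simp]: "lift (op C) = colift C" "colift (op C) = lift C"
  by (simp_all add: fun_eq_iff lift_def colift_def)

lemma op_is_pullback [simp]:
  "is_pullback (op C) = is_pushout C" "is_pushout (op C) = is_pullback C"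
  by (simp_all add: fun_eq_iff is_pullback_def is_pushout_def)

lemma op_is_kernel [simp]:
  "is_kernel (op C) N = is_cokernel C N" "is_cokernel (op C) N = is_kernel C N"
  by (simp_all add: fun_eq_iff is_kernel_def is_cokernel_def)

lemma op_ker [simp]: "ker (op C) N = coker C N" "coker (op C) N = ker C N"
  by (simp_all add: fun_eq_iff ker_def coker_def)

lemma op_kernel_mor [simp]:
  "kernel_mor (op C) N = cokernel_mor C N" "cokernel_mor (op C) N = kernel_mor C N"
  by (simp_all add: fun_eq_iff kernel_mor_def cokernel_mor_def)

lemma op_im [simp]: "im (op C) N = coim C N" "coim (op C) N = im C N"
  by (simp_all add: fun_eq_iff im_def coim_def)

definition monic :: "('o, 'm) cat \<Rightarrow> 'm \<Rightarrow> bool" where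
  "monic C k \<longleftrightarrow> k \<in> Mor C \<and> (\<forall>x\<in>Mor C. \<forall>y\<in>Mor C. Cod C x = Dom C k \<and> Cod C y = Dom C k \<and>
     Dom C x = Dom C y \<and> k \<cdot>\<^bsub>C\<^esub> x = k \<cdot>\<^bsub>C\<^esub> y \<longrightarrow> x = y)"

definition epic :: "('o, 'm) cat \<Rightarrow> 'm \<Rightarrow> bool" where
  "epic C q \<longleftrightarrow> q \<in> Mor C \<and> (\<forall>x\<in>Mor C. \<forall>y\<in>Mor C. Dom C x = Cod C q \<and> Dom C y = Cod C q \<and>
     Cod C x = Cod C y \<and> x \<cdot>\<^bsub>C\<^esub> q = y \<cdot>\<^bsub>C\<^esub> q \<longrightarrow> x = y)"

lemma op_monic [simp]: "monic (op C) = epic C" "epic (op C) = monic C"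
  by (simp_all add: fun_eq_iff monic_def epic_def)

lemma op_category: "category C \<Longrightarrow> category (op C)"
  unfolding category_def by (simp; metis)

lemma op_closed_ideal:
  assumes "category C" "closed_ideal C N" shows "closed_ideal (op C) N"
proof -
  have "is_ideal (op C) N"
    using assms unfolding closed_ideal_def is_ideal_def category_def
    by (auto; metis subset_iff)
  then show ?thesis
    using assms(2) unfolding closed_ideal_def by (simp add: null_object_def; metis)
qed

text \<open>The conditions are exchanged in pairs. The subquotient axiom is its own dual once the
  kernel and the cokernel, and likewise \<open>\<pi>\<close> and \<open>\<iota>\<close>, trade
  roles.\<close>

lemma op_homological:
  assumes "homological C N" shows "homological (op C) N"
proof -
  have "semiexact (op C) N"
    using assms op_category op_closed_ideal unfolding homological_def semiexact_def by auto
  moreover have "\<exists>\<pi> \<iota>. kernel_mor C N \<pi> \<and> cokernel_mor C N \<iota> \<and> Cod C \<pi> = Cod C i \<and> Dom C \<iota> = Dom C q \<and>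
           Dom C \<pi> = Cod C \<iota> \<and> i \<cdot>\<^bsub>C\<^esub> q = \<pi> \<cdot>\<^bsub>C\<^esub> \<iota>"
    if "cokernel_mor C N i" "kernel_mor C N q" "Dom C i = Cod C q" "coker C N q \<cdot>\<^bsub>C\<^esub> ker C N i \<in> N" for i q
    using assms that unfolding homological_def by metis
  ultimately show ?thesis
    using assms unfolding homological_def by (simp; metis)
qed

section \<open>Calculus of composites and of the null ideal\<close>

locale homological_category =
  fixes C :: "('o, 'm) cat" (structure) and N :: "'m set"
  assumes homological: "homological C N"
begin

lemma op: "homological_category (op C) N"
  by (simp add: homological_category_def op_homological homological)

lemma semiexact: "semiexact C N" and category: "category C"
  and ideal: "closed_ideal C N" "is_ideal C N"
  using homological by (auto simp: homological_def semiexact_def closed_ideal_def)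

lemma comp [simp]:
  "\<lbrakk>f \<in> Mor C; g \<in> Mor C; Cod C f = Dom C g\<rbrakk> \<Longrightarrow> g \<cdot> f \<in> Mor C"
  "\<lbrakk>f \<in> Mor C; g \<in> Mor C; Cod C f = Dom C g\<rbrakk> \<Longrightarrow> Dom C (g \<cdot> f) = Dom C f"
  "\<lbrakk>f \<in> Mor C; g \<in> Mor C; Cod C f = Dom C g\<rbrakk> \<Longrightarrow> Cod C (g \<cdot> f) = Cod C g"
  using category by (auto simp: category_def)

lemma Dom_Cod_Ob [simp]: "f \<in> Mor C \<Longrightarrow> Dom C f \<in> Ob C" "f \<in> Mor C \<Longrightarrow> Cod C f \<in> Ob C"
  using category by (auto simp: category_def)

lemma Ident [simp]:
  "A \<in> Ob C \<Longrightarrow> Ident C A \<in> Mor C" "A \<in> Ob C \<Longrightarrow> Dom C (Ident C A) = A"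
  "A \<in> Ob C \<Longrightarrow> Cod C (Ident C A) = A"
  using category by (auto simp: category_def)

lemma comp_Ident [simp]:
  "\<lbrakk>f \<in> Mor C; A = Dom C f\<rbrakk> \<Longrightarrow> f \<cdot> Ident C A = f"
  "\<lbrakk>f \<in> Mor C; A = Cod C f\<rbrakk> \<Longrightarrow> Ident C A \<cdot> f = f"
  using category by (auto simp: category_def)

lemma assoc [simp]:
  "\<lbrakk>f \<in> Mor C; g \<in> Mor C; h \<in> Mor C; Cod C f = Dom C g; Cod C g = Dom C h\<rbrakk>
    \<Longrightarrow> (h \<cdot> g) \<cdot> f = h \<cdot> g \<cdot> f"
  using category by (auto simp: category_def)

text \<open>Composites are normalized to the right, so an equation for \<open>g \<cdot> f\<close> no
  longer matches inside a longer composite; this form applies it there.\<close>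

lemma reassoc:
  "\<lbrakk>g \<cdot> f = h; f \<in> Mor C; g \<in> Mor C; Cod C f = Dom C g; w \<in> Mor C; Cod C w = Dom C f\<rbrakk>
    \<Longrightarrow> g \<cdot> f \<cdot> w = h \<cdot> w"
  using assoc by metis

lemma null_Mor [simp]: "f \<in> N \<Longrightarrow> f \<in> Mor C"
  using ideal by (auto simp: is_ideal_def)

text \<open>The ideal axiom multiplies on both sides at once; an identity on the other side yields
  each one-sided rule.\<close>

lemma null_comp [simp]:
  "\<lbrakk>f \<in> N; g \<in> Mor C; Cod C f = Dom C g\<rbrakk> \<Longrightarrow> g \<cdot> f \<in> N"
  "\<lbrakk>g \<in> N; f \<in> Mor C; Cod C f = Dom C g\<rbrakk> \<Longrightarrow> g \<cdot> f \<in> N"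
proof -
  have *: "h \<cdot> x \<cdot> y \<in> N" if "x \<in> N" "y \<in> Mor C" "h \<in> Mor C" "Cod C y = Dom C x" "Cod C x = Dom C h" for x y h
    using ideal that unfolding is_ideal_def by blast
  show "\<lbrakk>f \<in> N; g \<in> Mor C; Cod C f = Dom C g\<rbrakk> \<Longrightarrow> g \<cdot> f \<in> N"
    using *[of f "Ident C (Dom C f)" g] by simp
  show "\<lbrakk>g \<in> N; f \<in> Mor C; Cod C f = Dom C g\<rbrakk> \<Longrightarrow> g \<cdot> f \<in> N"
    using *[of g f "Ident C (Cod C g)"] by simp
qed

lemma null_reassoc [simp]:
  assumes "g \<cdot> f \<in> N" "f \<in> Mor C" "g \<in> Mor C" "w \<in> Mor C" "Cod C f = Dom C g" "Cod C w = Dom C f"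
  shows "g \<cdot> f \<cdot> w \<in> N"
  using null_comp(2)[OF assms(1), of w] assms(2-) by simp

end

subsection \<open>Monomorphisms, kernels and null morphisms\<close>

context homological_category
begin

lemma iso_Mor [simp]: "iso C f \<Longrightarrow> f \<in> Mor C"
  by (auto simp: iso_def inverses_def)

lemma inverses_unique: "inverses C f g \<Longrightarrow> inverses C f h \<Longrightarrow> g = h"
  using assoc[of h f g] unfolding inverses_def hom_def by simp

lemma inverse_mor_eq: "inverses C f g \<Longrightarrow> inverse_mor C f = g"
  unfolding inverse_mor_def using inverses_unique by blast

lemma inverse_mor [simp]:
  assumes "iso C f"
  shows "inverse_mor C f \<in> Mor C" "Dom C (inverse_mor C f) = Cod C f"
    "Cod C (inverse_mor C f) = Dom C f" "f \<cdot> inverse_mor C f = Ident C (Cod C f)"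
    "inverse_mor C f \<cdot> f = Ident C (Dom C f)"
  using assms inverse_mor_eq unfolding iso_def by (auto simp: inverses_def hom_def)

lemma inverse_cancel [simp]:
  assumes "iso C f" "w \<in> Mor C"
  shows "Cod C w = Cod C f \<Longrightarrow> f \<cdot> inverse_mor C f \<cdot> w = w"
    "Cod C w = Dom C f \<Longrightarrow> inverse_mor C f \<cdot> f \<cdot> w = w"
  using assms reassoc[of f "inverse_mor C f" _ w] reassoc[of "inverse_mor C f" f _ w] by simp_all

lemma isoI:
  assumes "f \<in> Mor C" "g \<in> Mor C" "Dom C g = Cod C f" "Cod C g = Dom C f"
    "g \<cdot> f = Ident C (Dom C f)" "f \<cdot> g = Ident C (Cod C f)"
  shows "iso C f" "inverse_mor C f = g"
proof -
  have "inverses C f g" using assms by (simp add: inverses_def hom_def)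
  then show "iso C f" "inverse_mor C f = g" using inverse_mor_eq by (auto simp: iso_def)
qed

lemma iso_inverse [simp]: "iso C f \<Longrightarrow> iso C (inverse_mor C f)"
  by (rule isoI[of _ f]) simp_all

lemma inverse_inverse [simp]: "iso C f \<Longrightarrow> inverse_mor C (inverse_mor C f) = f"
  by (rule isoI) simp_all

lemma iso_comp [simp]: "\<lbrakk>iso C f; iso C g; Cod C f = Dom C g\<rbrakk> \<Longrightarrow> iso C (g \<cdot> f)"
  by (rule isoI[of _ "inverse_mor C f \<cdot> inverse_mor C g"]) simp_all

lemma iso_Ident [simp]: "A \<in> Ob C \<Longrightarrow> iso C (Ident C A)"
  by (rule isoI[of _ "Ident C A"]) simp_all

lemma inverse_Ident [simp]: "A \<in> Ob C \<Longrightarrow> inverse_mor C (Ident C A) = Ident C A"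
  by (rule isoI) simp_all

lemma monic_Mor [simp]: "monic C k \<Longrightarrow> k \<in> Mor C" and epic_Mor [simp]: "epic C k \<Longrightarrow> k \<in> Mor C"
  by (auto simp: monic_def epic_def)

lemma monicD:
  assumes "monic C k" "k \<cdot> x = k \<cdot> y" "x \<in> Mor C" "y \<in> Mor C"
    "Cod C x = Dom C k" "Cod C y = Dom C k" "Dom C x = Dom C y"
  shows "x = y"
  using assms unfolding monic_def by blast

lemma epicD:
  assumes "epic C k" "x \<cdot> k = y \<cdot> k" "x \<in> Mor C" "y \<in> Mor C"
    "Dom C x = Cod C k" "Dom C y = Cod C k" "Cod C x = Cod C y"
  shows "x = y"
  using assms unfolding epic_def by blast

lemma monicI:
  assumes "k \<in> Mor C" "\<And>x y. \<lbrakk>x \<in> Mor C; y \<in> Mor C; Cod C x = Dom C k; Cod C y = Dom C k;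
    Dom C x = Dom C y; k \<cdot> x = k \<cdot> y\<rbrakk> \<Longrightarrow> x = y"
  shows "monic C k"
  using assms unfolding monic_def by blast

lemma monic_comp [simp]:
  assumes "monic C j" "monic C k" "Cod C j = Dom C k" shows "monic C (k \<cdot> j)"
proof (rule monicI)
  fix x y assume "x \<in> Mor C" "y \<in> Mor C" "Cod C x = Dom C (k \<cdot> j)" "Cod C y = Dom C (k \<cdot> j)"
    "Dom C x = Dom C y" "(k \<cdot> j) \<cdot> x = (k \<cdot> j) \<cdot> y"
  then show "x = y"
    using monicD[OF assms(1), of x y] monicD[OF assms(2), of "j \<cdot> x" "j \<cdot> y"] assms by simp
qed (use assms in simp)

lemma epic_comp [simp]:
  assumes "epic C j" "epic C k" "Dom C j = Cod C k" shows "epic C (j \<cdot> k)"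
  using homological_category.monic_comp[OF op, of j k] assms by simp

lemma iso_monic [simp]: "iso C f \<Longrightarrow> monic C f"
  by (rule monicI) (simp, metis inverse_cancel(2))

lemma iso_epic [simp]: "iso C f \<Longrightarrow> epic C f"
  using homological_category.iso_monic[OF op] by simp

lemma lift_eq:
  assumes "monic C k" "k \<cdot> z = x" "z \<in> Mor C" "Cod C z = Dom C k"
  shows "lift C k x = z"
  unfolding lift_def
proof (rule the_equality)
  show "z \<in> hom C (Dom C x) (Dom C k) \<and> k \<cdot> z = x" using assms by (auto simp: hom_def)
  show "y \<in> hom C (Dom C x) (Dom C k) \<and> k \<cdot> y = x \<Longrightarrow> y = z" for y
    using assms monicD[OF assms(1), of y z] comp(2)[of z k] by (simp add: hom_def)
qed

lemma colift_eq:
  assumes "epic C k" "z \<cdot> k = x" "z \<in> Mor C" "Dom C z = Cod C k"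
  shows "colift C k x = z"
  using homological_category.lift_eq[OF op, of k z x] assms by simp

text \<open>Two monomorphisms that factor through each other are the same subobject: cancelling
  \<open>i\<close> and \<open>j\<close> makes the two factors mutually inverse.\<close>

lemma iso_lift:
  assumes "monic C i" "monic C j" "j \<cdot> s = i" "i \<cdot> t = j"
    "s \<in> Mor C" "Cod C s = Dom C j" "t \<in> Mor C" "Cod C t = Dom C i"
  shows "iso C (lift C j i)" "lift C j i = s" "iso C s"
proof -
  show *: "lift C j i = s" using assms by (intro lift_eq) auto
  have d: "Dom C s = Dom C i" "Dom C t = Dom C j" using assms by (metis comp(2) monic_Mor)+
  have "t \<cdot> s = Ident C (Dom C s)"
    by (rule monicD[OF assms(1)]) (use assms d reassoc[OF assms(4), of s] in auto)
  moreover have "s \<cdot> t = Ident C (Cod C s)"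
    by (rule monicD[OF assms(2)]) (use assms d reassoc[OF assms(3), of t] in auto)
  ultimately show "iso C s" using isoI[of s t] assms d by simp
  then show "iso C (lift C j i)" using * by simp
qed

lemma is_kernelD:
  assumes "is_kernel C N f k"
  shows "f \<in> Mor C" "k \<in> Mor C" "Cod C k = Dom C f" "f \<cdot> k \<in> N"
  using assms by (auto simp: is_kernel_def)

lemma is_kernel_ex1:
  "\<lbrakk>is_kernel C N f k; x \<in> Mor C; Cod C x = Dom C f; f \<cdot> x \<in> N\<rbrakk> \<Longrightarrow>
    \<exists>!x'. x' \<in> hom C (Dom C x) (Dom C k) \<and> x = k \<cdot> x'"
  unfolding is_kernel_def by blast

lemma kernel_factor:
  assumes "is_kernel C N f k" "x \<in> Mor C" "Cod C x = Dom C f" "f \<cdot> x \<in> N"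
  shows "\<exists>z\<in>Mor C. Dom C z = Dom C x \<and> Cod C z = Dom C k \<and> k \<cdot> z = x"
  using is_kernel_ex1[OF assms] by (auto simp: hom_def)

lemma is_kernel_monic:
  assumes "is_kernel C N f k" shows "monic C k"
proof -
  note [simp] = is_kernelD[OF assms]
  have *: "x = y" if *: "x \<in> Mor C" "y \<in> Mor C" "Cod C x = Dom C k" "Cod C y = Dom C k"
    "Dom C x = Dom C y" "k \<cdot> x = k \<cdot> y" for x y
  proof -
    have "f \<cdot> (k \<cdot> x) \<in> N" using * null_comp(2)[of x "f \<cdot> k"] by simp
    then have "\<exists>!x'. x' \<in> hom C (Dom C (k \<cdot> x)) (Dom C k) \<and> (k \<cdot> x) = k \<cdot> x'"
      using is_kernel_ex1[OF assms, of "k \<cdot> x"] * by simp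
    moreover have "x \<in> hom C (Dom C (k \<cdot> x)) (Dom C k)" "y \<in> hom C (Dom C (k \<cdot> x)) (Dom C k)"
      using * by (simp_all add: hom_def)
    ultimately show ?thesis using *(6) by blast
  qed
  show ?thesis by (rule monicI) (use * in auto)
qed

text \<open>Uniqueness of the factor comes from \<open>k\<close> being monic, and its domain is
  forced by \<open>k \<cdot> z = x\<close>, so existence is all that has to be supplied.\<close>

lemma is_kernelI:
  assumes "f \<in> Mor C" "monic C k" "Cod C k = Dom C f" "f \<cdot> k \<in> N"
    "\<And>x. \<lbrakk>x \<in> Mor C; Cod C x = Dom C f; f \<cdot> x \<in> N\<rbrakk> \<Longrightarrow> \<exists>z\<in>Mor C. Cod C z = Dom C k \<and> k \<cdot> z = x"
  shows "is_kernel C N f k"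
  unfolding is_kernel_def
proof (intro conjI ballI impI ex_ex1I)
  fix x assume x: "x \<in> Mor C" "Cod C x = Dom C f \<and> f \<cdot> x \<in> N"
  with assms obtain z where "z\<in>Mor C" "Cod C z = Dom C k" "k \<cdot> z = x" by metis
  with assms show "\<exists>z. z \<in> hom C (Dom C x) (Dom C k) \<and> x = k \<cdot> z"
    by (intro exI[of _ z]) (auto simp: hom_def)
  show "y = z" if "y \<in> hom C (Dom C x) (Dom C k) \<and> x = k \<cdot> y" "z \<in> hom C (Dom C x) (Dom C k) \<and> x = k \<cdot> z" for y z
    using that monicD[OF assms(2), of y z] by (auto simp: hom_def)
qed (use assms in auto)

lemma is_cokernelD:
  assumes "is_cokernel C N f k"
  shows "f \<in> Mor C" "k \<in> Mor C" "Dom C k = Cod C f" "k \<cdot> f \<in> N"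
  using assms by (auto simp: is_cokernel_def)

lemma cokernel_factor:
  assumes "is_cokernel C N f k" "x \<in> Mor C" "Dom C x = Cod C f" "x \<cdot> f \<in> N"
  shows "\<exists>z\<in>Mor C. Cod C z = Cod C x \<and> Dom C z = Cod C k \<and> z \<cdot> k = x"
  using homological_category.kernel_factor[OF op, of f k x] assms by auto

lemma is_cokernel_epic: "is_cokernel C N f k \<Longrightarrow> epic C k"
  using homological_category.is_kernel_monic[OF op, of f k] by simp

lemma is_cokernelI:
  assumes "f \<in> Mor C" "epic C k" "Dom C k = Cod C f" "k \<cdot> f \<in> N"
    "\<And>x. \<lbrakk>x \<in> Mor C; Dom C x = Cod C f; x \<cdot> f \<in> N\<rbrakk> \<Longrightarrow> \<exists>z\<in>Mor C. Dom C z = Cod C k \<and> z \<cdot> k = x"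
  shows "is_cokernel C N f k"
  using homological_category.is_kernelI[OF op, of f k] assms by simp

text \<open>Kernels reflect null morphisms, and this is where closedness of the ideal enters. Factor
  \<open>k \<cdot> z\<close> as \<open>h \<cdot> g\<close> through a null object. Every morphism out
  of a null object is null, so \<open>f \<cdot> h\<close> is null and \<open>h\<close> lifts along
  \<open>k\<close> to some \<open>h'\<close>. Cancelling \<open>k\<close> gives
  \<open>z = h' \<cdot> g\<close>, which again passes through the null object.\<close>

lemma is_kernel_reflect:
  assumes "is_kernel C N f k" "k \<cdot> z \<in> N" "z \<in> Mor C" "Cod C z = Dom C k"
  shows "z \<in> N"
proof -
  note [simp] = is_kernelD[OF assms(1)] assms(3,4)
  have "\<exists>A g h. null_object C N A \<and> g \<in> hom C (Dom C (k \<cdot> z)) A \<and> h \<in> hom C A (Cod C (k \<cdot> z)) \<and> k \<cdot> z = h \<cdot> g"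
    using ideal(1)[unfolded closed_ideal_def, THEN conjunct2, THEN bspec, OF assms(2)] .
  then obtain A g h where A: "null_object C N A"
    and gh: "g \<in> hom C (Dom C (k \<cdot> z)) A" "h \<in> hom C A (Cod C (k \<cdot> z))" and e: "k \<cdot> z = h \<cdot> g"
    by blast
  have [simp]: "g \<in> Mor C" "h \<in> Mor C" "Dom C g = Dom C z" "Cod C g = A" "Dom C h = A" "Cod C h = Cod C k"
    using gh by (simp_all add: hom_def)
  have I: "Ident C A \<in> N" "A \<in> Ob C" using A by (auto simp: null_object_def)
  have [simp]: "x \<in> N" if "x \<in> Mor C" "Dom C x = A" for x
    using null_comp(1)[of "Ident C A" x] that I by simp
  have "f \<cdot> h \<in> N" by simp
  then obtain h' where h' [simp]: "h' \<in> Mor C" "Dom C h' = Dom C h" "Cod C h' = Dom C k" and h'': "k \<cdot> h' = h"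
    using kernel_factor[OF assms(1), of h] by auto
  have "k \<cdot> z = k \<cdot> h' \<cdot> g"
    unfolding e by (simp add: reassoc[OF h''])
  then have "z = h' \<cdot> g"
    by (rule monicD[OF is_kernel_monic[OF assms(1)]]) simp_all
  moreover have "h' \<cdot> g \<in> N" by simp
  ultimately show ?thesis by (simp only:)
qed

lemma is_kernel_ker: "f \<in> Mor C \<Longrightarrow> is_kernel C N f (ker C N f)"
  and is_cokernel_coker: "f \<in> Mor C \<Longrightarrow> is_cokernel C N f (coker C N f)"
  using semiexact unfolding semiexact_def ker_def coker_def by (metis someI_ex)+

lemma ker [simp]:
  assumes "f \<in> Mor C"
  shows "ker C N f \<in> Mor C" "Cod C (ker C N f) = Dom C f" "f \<cdot> ker C N f \<in> N" "monic C (ker C N f)"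
    "kernel_mor C N (ker C N f)"
  using is_kernelD[OF is_kernel_ker] is_kernel_monic[OF is_kernel_ker] is_kernel_ker[OF assms] assms
  by (auto simp: kernel_mor_def)

lemma coker [simp]:
  assumes "f \<in> Mor C"
  shows "coker C N f \<in> Mor C" "Dom C (coker C N f) = Cod C f" "coker C N f \<cdot> f \<in> N" "epic C (coker C N f)"
    "cokernel_mor C N (coker C N f)"
  using homological_category.ker[OF op, of f] assms by auto

lemma kernel_mor_monic [simp]: "kernel_mor C N k \<Longrightarrow> monic C k"
  and cokernel_mor_epic [simp]: "cokernel_mor C N q \<Longrightarrow> epic C q"
  by (auto simp: kernel_mor_def cokernel_mor_def is_kernel_monic is_cokernel_epic)

lemma kernel_mor_Mor [simp]: "kernel_mor C N k \<Longrightarrow> k \<in> Mor C"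
  and cokernel_mor_Mor [simp]: "cokernel_mor C N k \<Longrightarrow> k \<in> Mor C"
  using monic_Mor epic_Mor by auto

lemma kernel_mor_null [simp]:
  assumes "kernel_mor C N k" "z \<in> Mor C" "Cod C z = Dom C k"
  shows "k \<cdot> z \<in> N \<longleftrightarrow> z \<in> N"
proof -
  obtain f where f: "is_kernel C N f k" using assms by (auto simp: kernel_mor_def)
  show ?thesis
  proof
    show "k \<cdot> z \<in> N \<Longrightarrow> z \<in> N" by (rule is_kernel_reflect[OF f]) (use assms in simp_all)
    show "z \<in> N \<Longrightarrow> k \<cdot> z \<in> N" by (rule null_comp) (use assms in simp_all)
  qed
qed

lemma cokernel_mor_null [simp]:
  assumes "cokernel_mor C N k" "z \<in> Mor C" "Dom C z = Cod C k"
  shows "z \<cdot> k \<in> N \<longleftrightarrow> z \<in> N"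
  using homological_category.kernel_mor_null[OF op, of k z] assms by simp

lemma kernel_mor_comp [simp]:
  "\<lbrakk>kernel_mor C N i; kernel_mor C N j; Cod C i = Dom C j\<rbrakk> \<Longrightarrow> kernel_mor C N (j \<cdot> i)"
  and cokernel_mor_comp [simp]:
  "\<lbrakk>cokernel_mor C N i; cokernel_mor C N j; Cod C i = Dom C j\<rbrakk> \<Longrightarrow> cokernel_mor C N (j \<cdot> i)"
  using homological unfolding homological_def by auto

text \<open>A kernel \<open>k\<close> of \<open>f\<close> is killed by \<open>f\<close>, so
  \<open>f\<close> factors through \<open>coker k\<close>. Whatever \<open>coker k\<close> kills is
  then killed by \<open>f\<close> and lifts along \<open>k\<close>.\<close>

lemma is_kernel_coker:
  assumes "kernel_mor C N k" shows "is_kernel C N (coker C N k) k"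
proof -
  obtain f where f: "is_kernel C N f k" using assms by (auto simp: kernel_mor_def)
  note [simp] = is_kernelD[OF f] assms
  show ?thesis
  proof (rule is_kernelI)
    fix x assume x [simp]: "x \<in> Mor C" "Cod C x = Dom C (coker C N k)" and n: "coker C N k \<cdot> x \<in> N"
    obtain f' where f' [simp]: "f' \<in> Mor C" "Dom C f' = Cod C (coker C N k)" and e: "f' \<cdot> coker C N k = f"
      using cokernel_factor[OF is_cokernel_coker, of k f] by auto
    have "f \<cdot> x \<in> N" using null_comp(1)[of "coker C N k \<cdot> x" f'] n reassoc[OF e, of x] by simp
    then show "\<exists>z\<in>Mor C. Cod C z = Dom C k \<and> k \<cdot> z = x"
      using kernel_factor[OF f, of x] by auto
  qed simp_all
qed

lemma is_cokernel_ker: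
  assumes "cokernel_mor C N k" shows "is_cokernel C N (ker C N k) k"
  using homological_category.is_kernel_coker[OF op, of k] assms by simp

text \<open>As global simplification rules these make the side conditions of composites explode.\<close>

declare iso_Mor [simp del] monic_Mor [simp del] epic_Mor [simp del] kernel_mor_Mor [simp del]
  cokernel_mor_Mor [simp del] null_Mor [simp del]

end

subsection \<open>Exact morphisms and subquotients\<close>

context homological_category
begin

text \<open>The universal property of a kernel sees nothing of \<open>f\<close> except which
  composites \<open>f \<cdot> x\<close> are null.\<close>

lemma is_kernel_cong:
  assumes "is_kernel C N f k" "f' \<in> Mor C" "Dom C f' = Dom C f"
    "\<And>x. \<lbrakk>x \<in> Mor C; Cod C x = Dom C f\<rbrakk> \<Longrightarrow> f \<cdot> x \<in> N \<longleftrightarrow> f' \<cdot> x \<in> N"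
  shows "is_kernel C N f' k"
proof (rule is_kernelI)
  note [simp] = is_kernelD[OF assms(1)] assms(2,3)
  show "f' \<in> Mor C" "monic C k" "Cod C k = Dom C f'" "f' \<cdot> k \<in> N"
    using assms(4)[of k] is_kernel_monic[OF assms(1)] by simp_all
  fix x assume "x \<in> Mor C" "Cod C x = Dom C f'" "f' \<cdot> x \<in> N"
  with assms(4)[of x] show "\<exists>z\<in>Mor C. Cod C z = Dom C k \<and> k \<cdot> z = x"
    using kernel_factor[OF assms(1), of x] by auto
qed

lemma is_cokernel_cong:
  assumes "is_cokernel C N f k" "f' \<in> Mor C" "Cod C f' = Cod C f"
    "\<And>x. \<lbrakk>x \<in> Mor C; Dom C x = Cod C f\<rbrakk> \<Longrightarrow> x \<cdot> f \<in> N \<longleftrightarrow> x \<cdot> f' \<in> N"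
  shows "is_cokernel C N f' k"
  using homological_category.is_kernel_cong[OF op, of f k f'] assms by simp

lemma is_kernel_unique:
  assumes "is_kernel C N f k" "is_kernel C N f l"
  obtains t where "t \<in> Mor C" "iso C t" "Dom C t = Dom C k" "Cod C t = Dom C l" "l \<cdot> t = k"
proof -
  note [simp] = is_kernelD[OF assms(1)] is_kernelD[OF assms(2)]
  obtain t where t: "t \<in> Mor C" "Dom C t = Dom C k" "Cod C t = Dom C l" "l \<cdot> t = k"
    using kernel_factor[OF assms(2), of k] by auto
  obtain s where s: "s \<in> Mor C" "Dom C s = Dom C l" "Cod C s = Dom C k" "k \<cdot> s = l"
    using kernel_factor[OF assms(1), of l] by auto
  have "iso C t"
    by (rule iso_lift[of k l t s]) (use s t assms is_kernel_monic in auto)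
  with t that show thesis by blast
qed

lemma is_cokernel_unique:
  assumes "is_cokernel C N f k" "is_cokernel C N f l"
  obtains t where "t \<in> Mor C" "iso C t" "Cod C t = Cod C k" "Dom C t = Cod C l" "t \<cdot> l = k"
  using homological_category.is_kernel_unique[OF op, of f k l] assms by auto

lemma is_kernel_comp_iso:
  assumes "is_kernel C N f k" "iso C t" "Cod C t = Dom C k"
  shows "is_kernel C N f (k \<cdot> t)"
proof (rule is_kernelI)
  note [simp] = is_kernelD[OF assms(1)] assms(2,3) iso_Mor[OF assms(2)]
  show "f \<in> Mor C" "monic C (k \<cdot> t)" "Cod C (k \<cdot> t) = Dom C f"
    using is_kernel_monic[OF assms(1)] by simp_all
  show "f \<cdot> (k \<cdot> t) \<in> N" using null_reassoc[of f k t] by simp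
  fix x assume "x \<in> Mor C" "Cod C x = Dom C f" "f \<cdot> x \<in> N"
  then obtain z where "z \<in> Mor C" "Dom C z = Dom C x" "Cod C z = Dom C k" "k \<cdot> z = x"
    using kernel_factor[OF assms(1), of x] by auto
  then show "\<exists>z\<in>Mor C. Cod C z = Dom C (k \<cdot> t) \<and> (k \<cdot> t) \<cdot> z = x"
    by (intro bexI[of _ "inverse_mor C t \<cdot> z"]) simp_all
qed

lemma iso_kernel_mor [simp]:
  assumes "iso C t" shows "kernel_mor C N t"
proof -
  have "is_kernel C N (coker C N t) t"
  proof (rule is_kernelI)
    fix x assume "x \<in> Mor C" "Cod C x = Dom C (coker C N t)"
    with assms show "\<exists>z\<in>Mor C. Cod C z = Dom C t \<and> t \<cdot> z = x"
      by (intro bexI[of _ "inverse_mor C t \<cdot> x"]) (simp_all add: iso_Mor)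
  qed (use assms in \<open>simp_all add: iso_Mor\<close>)
  then show ?thesis by (auto simp: kernel_mor_def)
qed

lemma iso_cokernel_mor [simp]: "iso C t \<Longrightarrow> cokernel_mor C N t"
  using homological_category.iso_kernel_mor[OF op, of t] by simp

text \<open>A kernel \<open>i\<close> put after \<open>f\<close> changes no nullity, because kernels
  reflect null morphisms.\<close>

lemma is_kernel_comp:
  assumes "is_kernel C N f k" "kernel_mor C N i" "Dom C i = Cod C f"
  shows "is_kernel C N (i \<cdot> f) k"
  by (rule is_kernel_cong[OF assms(1)])
    (use is_kernelD[OF assms(1)] assms(2,3) kernel_mor_Mor[OF assms(2)] in simp_all)

lemma is_cokernel_comp:
  assumes "is_cokernel C N f k" "cokernel_mor C N q" "Cod C q = Dom C f"
  shows "is_cokernel C N (f \<cdot> q) k"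
  using homological_category.is_kernel_comp[OF op, of f k q] assms by simp

text \<open>The subobject \<open>j\<close> is the inverse image along \<open>k\<close> of the normal
  subobject \<open>k \<cdot> j\<close>, hence the kernel of
  \<open>coker (k \<cdot> j) \<cdot> k\<close>.\<close>

lemma kernel_mor_cancel:
  assumes "kernel_mor C N (k \<cdot> j)" "monic C k" "j \<in> Mor C" "Cod C j = Dom C k"
  shows "kernel_mor C N j"
proof -
  note [simp] = assms monic_Mor[OF assms(2)]
  have "is_kernel C N (coker C N (k \<cdot> j) \<cdot> k) j"
  proof (rule is_kernelI)
    show "monic C j"
    proof (rule monicI)
      fix x y assume "x \<in> Mor C" "y \<in> Mor C" "Cod C x = Dom C j" "Cod C y = Dom C j" "Dom C x = Dom C y" "j \<cdot> x = j \<cdot> y"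
      then show "x = y"
        using monicD[OF kernel_mor_monic[OF assms(1)], of x y] by simp
    qed simp
    fix x assume x [simp]: "x \<in> Mor C" "Cod C x = Dom C (coker C N (k \<cdot> j) \<cdot> k)" and n: "(coker C N (k \<cdot> j) \<cdot> k) \<cdot> x \<in> N"
    obtain z where z [simp]: "z \<in> Mor C" "Dom C z = Dom C x" "Cod C z = Dom C j" and e: "(k \<cdot> j) \<cdot> z = k \<cdot> x"
      using kernel_factor[OF is_kernel_coker[OF assms(1)], of "k \<cdot> x"] n by auto
    have "j \<cdot> z = x"
      using monicD[OF assms(2), of "j \<cdot> z" x] e by simp
    then show "\<exists>z\<in>Mor C. Cod C z = Dom C j \<and> j \<cdot> z = x"
      using z by blast
  next
    show "(coker C N (k \<cdot> j) \<cdot> k) \<cdot> j \<in> N"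
      using coker(3)[of "k \<cdot> j"] by simp
  qed simp_all
  then show ?thesis by (auto simp: kernel_mor_def)
qed

lemma cokernel_mor_cancel:
  assumes "cokernel_mor C N (j \<cdot> k)" "epic C k" "j \<in> Mor C" "Dom C j = Cod C k"
  shows "cokernel_mor C N j"
  using homological_category.kernel_mor_cancel[OF op, of k j] assms by simp

lemma im [simp]:
  assumes "f \<in> Mor C"
  shows "im C N f \<in> Mor C" "Cod C (im C N f) = Cod C f" "kernel_mor C N (im C N f)"
    "monic C (im C N f)"
  using assms by (auto simp: im_def)

lemma coim [simp]:
  assumes "f \<in> Mor C"
  shows "coim C N f \<in> Mor C" "Dom C (coim C N f) = Dom C f" "cokernel_mor C N (coim C N f)"
    "epic C (coim C N f)"
  using assms by (auto simp: coim_def)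

lemma is_kernel_im: "f \<in> Mor C \<Longrightarrow> is_kernel C N (coker C N f) (im C N f)"
  and is_cokernel_coim: "f \<in> Mor C \<Longrightarrow> is_cokernel C N (ker C N f) (coim C N f)"
  by (simp_all add: im_def coim_def is_kernel_ker is_cokernel_coker)

lemma bar_eq:
  assumes "f \<in> Mor C" "m \<in> Mor C" "Dom C m = Cod C (coim C N f)" "Cod C m = Dom C (im C N f)"
    "im C N f \<cdot> m \<cdot> coim C N f = f"
  shows "bar C N f = m"
  unfolding bar_def
proof (rule the_equality)
  show "m \<in> hom C (Cod C (coim C N f)) (Dom C (im C N f)) \<and> f = im C N f \<cdot> m \<cdot> coim C N f"
    using assms by (simp add: hom_def)
  fix m' assume "m' \<in> hom C (Cod C (coim C N f)) (Dom C (im C N f)) \<and> f = im C N f \<cdot> m' \<cdot> coim C N f"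
  then have m': "m' \<in> Mor C" "Dom C m' = Cod C (coim C N f)" "Cod C m' = Dom C (im C N f)"
    and e: "im C N f \<cdot> m' \<cdot> coim C N f = f" by (simp_all add: hom_def)
  have "m' \<cdot> coim C N f = m \<cdot> coim C N f"
    by (rule monicD[of "im C N f"]) (use assms m' e in simp_all)
  then show "m' = m"
    by (rule epicD[rotated]) (use assms m' in simp_all)
qed

text \<open>The factor of \<open>f\<close> through \<open>im f\<close> still kills
  \<open>ker f\<close>, since \<open>im f\<close> reflects null morphisms, and so it descends to the
  coimage.\<close>

lemma bar [simp]:
  assumes [simp]: "f \<in> Mor C"
  shows "bar C N f \<in> Mor C" "Dom C (bar C N f) = Cod C (coim C N f)"
    "Cod C (bar C N f) = Dom C (im C N f)" "im C N f \<cdot> bar C N f \<cdot> coim C N f = f"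
proof -
  obtain z where z [simp]: "z \<in> Mor C" "Dom C z = Dom C f" "Cod C z = Dom C (im C N f)" and e: "im C N f \<cdot> z = f"
    using kernel_factor[OF is_kernel_im, of f f] by auto
  have "im C N f \<cdot> z \<cdot> ker C N f \<in> N"
    by (simp add: reassoc[OF e])
  then have "z \<cdot> ker C N f \<in> N"
    by simp
  then obtain m where m: "m \<in> Mor C" "Cod C m = Cod C z" "Dom C m = Cod C (coim C N f)" "m \<cdot> coim C N f = z"
    using cokernel_factor[OF is_cokernel_coim, of f z] by auto
  then have "bar C N f = m"
    by (intro bar_eq) (simp_all add: e)
  with m e show "bar C N f \<in> Mor C" "Dom C (bar C N f) = Cod C (coim C N f)"
    "Cod C (bar C N f) = Dom C (im C N f)" "im C N f \<cdot> bar C N f \<cdot> coim C N f = f" by simp_all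
qed

lemma is_kernel_coker_cong:
  assumes "is_cokernel C N f q" "is_kernel C N q k"
  shows "is_kernel C N (coker C N f) k"
proof -
  note [simp] = is_cokernelD[OF assms(1)]
  obtain t where "t \<in> Mor C" "iso C t" "Cod C t = Cod C (coker C N f)" "Dom C t = Cod C q" "t \<cdot> q = coker C N f"
    using is_cokernel_unique[OF is_cokernel_coker assms(1)] by auto
  then show ?thesis using is_kernel_comp[OF assms(2), of t] by simp
qed

lemma is_cokernel_ker_cong:
  assumes "is_kernel C N f q" "is_cokernel C N q k"
  shows "is_cokernel C N (ker C N f) k"
  using homological_category.is_kernel_coker_cong[OF op, of f q k] assms by simp

text \<open>A cokernel put before a kernel does not change its cokernel, and dually, so
  \<open>i\<close> and \<open>q\<close> are the image and the coimage of \<open>i \<cdot> q\<close>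
  up to isomorphisms. Together with \<open>exact_morE\<close> this replaces \<open>bar\<close> by a
  factorization in the exactness arguments below.\<close>

lemma exact_morI:
  assumes "kernel_mor C N i" "cokernel_mor C N q" "Dom C i = Cod C q"
  shows "exact_mor C N (i \<cdot> q)"
proof -
  note [simp] = assms kernel_mor_Mor[OF assms(1)] cokernel_mor_Mor[OF assms(2)]
  have i: "is_kernel C N (coker C N (i \<cdot> q)) i"
    by (rule is_kernel_coker_cong[OF _ is_kernel_coker]) (simp_all add: is_cokernel_comp is_cokernel_coker)
  have q: "is_cokernel C N (ker C N (i \<cdot> q)) q"
    by (rule is_cokernel_ker_cong[OF _ is_cokernel_ker]) (simp_all add: is_kernel_comp is_kernel_ker)
  obtain t where t [simp]: "t \<in> Mor C" "iso C t" "Dom C t = Dom C i" "Cod C t = Dom C (im C N (i \<cdot> q))" and et: "im C N (i \<cdot> q) \<cdot> t = i"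
    using is_kernel_unique[OF i is_kernel_im] by auto
  obtain s where s [simp]: "s \<in> Mor C" "iso C s" "Cod C s = Cod C q" "Dom C s = Cod C (coim C N (i \<cdot> q))" and es: "s \<cdot> coim C N (i \<cdot> q) = q"
    using is_cokernel_unique[OF q is_cokernel_coim] by auto
  have "bar C N (i \<cdot> q) = t \<cdot> s"
    by (rule bar_eq) (simp_all add: reassoc[OF et] es)
  then show ?thesis by (simp add: exact_mor_def)
qed

lemma exact_morE:
  assumes "exact_mor C N f"
  obtains i q where "kernel_mor C N i" "cokernel_mor C N q" "Dom C i = Cod C q" "f = i \<cdot> q"
proof -
  have [simp]: "f \<in> Mor C" "iso C (bar C N f)" using assms by (auto simp: exact_mor_def)
  show thesis
    by (rule that[of "im C N f" "bar C N f \<cdot> coim C N f"]) simp_all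
qed

section \<open>Subquotients\<close>

lemma subquotient:
  "\<lbrakk>kernel_mor C N i; cokernel_mor C N q; Cod C i = Dom C q; coker C N i \<cdot> ker C N q \<in> N\<rbrakk> \<Longrightarrow>
    \<exists>\<pi> \<iota>. cokernel_mor C N \<pi> \<and> kernel_mor C N \<iota> \<and> Dom C \<pi> = Dom C i \<and> Cod C \<iota> = Cod C q \<and>
      Cod C \<pi> = Dom C \<iota> \<and> q \<cdot> i = \<iota> \<cdot> \<pi>"
  using homological unfolding homological_def by blast

text \<open>The axiom applies because \<open>coker l\<close> kills \<open>l \<cdot> d\<close>, hence
  factors through \<open>r\<close>, hence kills \<open>ker r\<close>. It returns some cokernel
  \<open>p\<close>. That \<open>p\<close> is a cokernel of \<open>d\<close> itself rests on showing
  that \<open>ker p\<close> factors through the image of \<open>d\<close>.\<close>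

lemma subquotient_left:
  assumes "kernel_mor C N l" "is_cokernel C N (l \<cdot> d) r" "d \<in> Mor C" "Cod C d = Dom C l"
  obtains p i where "r \<cdot> l = i \<cdot> p" "is_cokernel C N d p" "kernel_mor C N i" "Dom C i = Cod C p"
    "Cod C i = Cod C r"
proof -
  note [simp] = is_cokernelD(2-)[OF assms(2)] assms(1,3,4) kernel_mor_Mor[OF assms(1)]
  have r [simp]: "cokernel_mor C N r" using assms(2) by (auto simp: cokernel_mor_def)
  have "coker C N l \<cdot> l \<cdot> d \<in> N"
    by simp
  then obtain y where y [simp]: "y \<in> Mor C" "Dom C y = Cod C r" "y \<cdot> r = coker C N l"
    using cokernel_factor[OF assms(2), of "coker C N l"] by auto
  have "coker C N l \<cdot> ker C N r \<in> N"
    by (subst reassoc[OF y(3), symmetric]) simp_all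
  then obtain p i where pi [simp]: "cokernel_mor C N p" "kernel_mor C N i" "Dom C p = Dom C l"
    "Cod C i = Cod C r" "Cod C p = Dom C i" and e: "r \<cdot> l = i \<cdot> p"
    using subquotient[of l r] by auto
  note [simp] = kernel_mor_Mor[OF pi(2)] cokernel_mor_Mor[OF pi(1)]
  have "is_cokernel C N d p"
  proof (rule is_cokernelI)
    have "i \<cdot> p \<cdot> d \<in> N"
      using reassoc[OF e, of d] is_cokernelD(4)[OF assms(2)] by simp
    then show "p \<cdot> d \<in> N" by simp
    fix x assume x [simp]: "x \<in> Mor C" "Dom C x = Cod C d" and n: "x \<cdot> d \<in> N"
    \<comment> \<open>Since kernels compose, \<open>l \<cdot> n\<close> is again a kernel. Its
      cokernel kills \<open>l \<cdot> d\<close>, so it factors through \<open>r\<close>, and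
      \<open>r \<cdot> l\<close> kills \<open>ker p\<close>; hence \<open>l \<cdot> ker p\<close>
      lifts along \<open>l \<cdot> n\<close>.\<close>
    define n where "n = im C N d"
    have n' [simp]: "n \<in> Mor C" "kernel_mor C N n" "Cod C n = Dom C l" by (simp_all add: n_def)
    obtain m where [simp]: "m \<in> Mor C" "Dom C m = Dom C d" "Cod C m = Dom C n" and nm: "n \<cdot> m = d"
      using kernel_factor[OF is_kernel_im, of d d] unfolding n_def by auto
    have "(coker C N (l \<cdot> n) \<cdot> (l \<cdot> n)) \<cdot> m \<in> N"
      by (rule null_comp(2)) simp_all
    then have "coker C N (l \<cdot> n) \<cdot> (l \<cdot> d) \<in> N"
      by (simp add: nm)
    then obtain w where w [simp]: "w \<in> Mor C" "Dom C w = Cod C r" and we: "w \<cdot> r = coker C N (l \<cdot> n)"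
      using cokernel_factor[OF assms(2), of "coker C N (l \<cdot> n)"] by auto
    have "w \<cdot> (i \<cdot> p) \<cdot> ker C N p \<in> N"
      by simp
    then have "coker C N (l \<cdot> n) \<cdot> (l \<cdot> ker C N p) \<in> N"
      unfolding e[symmetric] using reassoc[OF we] by simp
    then obtain z where z [simp]: "z \<in> Mor C" "Dom C z = Dom C (ker C N p)" "Cod C z = Dom C n" and "(l \<cdot> n) \<cdot> z = l \<cdot> ker C N p"
      using kernel_factor[OF is_kernel_coker, of "l \<cdot> n" "l \<cdot> ker C N p"] by auto
    then have "n \<cdot> z = ker C N p"
      using monicD[of l "n \<cdot> z" "ker C N p"] by simp
    moreover obtain x' where [simp]: "x' \<in> Mor C" "Dom C x' = Cod C (coker C N d)" and x': "x' \<cdot> coker C N d = x"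
      using cokernel_factor[OF is_cokernel_coker, of d x] n by auto
    moreover have [simp]: "coker C N d \<cdot> n \<in> N" unfolding n_def im_def by simp
    moreover have "x \<cdot> n \<in> N" by (subst reassoc[OF x', symmetric]) simp_all
    ultimately have "x \<cdot> ker C N p \<in> N" using null_reassoc[of x n z] by simp
    then show "\<exists>z\<in>Mor C. Dom C z = Cod C p \<and> z \<cdot> p = x"
      using cokernel_factor[OF is_cokernel_ker, of p x] by auto
  qed simp_all
  with e that show thesis by simp
qed

lemma subquotient_right:
  assumes "cokernel_mor C N r" "is_kernel C N (d \<cdot> r) l" "d \<in> Mor C" "Dom C d = Cod C r"
  obtains p i where "r \<cdot> l = i \<cdot> p" "is_kernel C N d i" "cokernel_mor C N p" "Dom C i = Cod C p"
    "Dom C p = Dom C l"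
  using homological_category.subquotient_left[OF op, of r d l thesis] assms by auto

text \<open>The two one-sided lemmas factor the same \<open>r \<cdot> l\<close>. Both
  \<open>i\<close> and \<open>j\<close> are kernels of its cokernel, so they differ by an
  isomorphism, and \<open>i\<close> inherits from \<open>j\<close> that it is a kernel of
  \<open>w\<close>. For \<open>l = ker g\<close> and \<open>r = coker f\<close> this is the
  agreement of left and right homology.\<close>

lemma subquotient_both:
  assumes l: "kernel_mor C N l" and r: "cokernel_mor C N r"
    and d: "is_cokernel C N (l \<cdot> d) r" "d \<in> Mor C" "Cod C d = Dom C l"
    and w: "is_kernel C N (w \<cdot> r) l" "w \<in> Mor C" "Dom C w = Cod C r"
  obtains p i where "r \<cdot> l = i \<cdot> p" "is_cokernel C N d p" "is_kernel C N w i" "Dom C i = Cod C p"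
proof -
  obtain p i where 1: "r \<cdot> l = i \<cdot> p" "is_cokernel C N d p" "kernel_mor C N i" "Dom C i = Cod C p"
    by (rule subquotient_left[OF l d(1)]) (simp add: d, simp add: d, blast)
  obtain q j where 2: "r \<cdot> l = j \<cdot> q" "is_kernel C N w j" "cokernel_mor C N q" "Dom C j = Cod C q"
    by (rule subquotient_right[OF r w(1)]) (simp add: w, simp add: w, blast)
  have p: "cokernel_mor C N p" and j: "kernel_mor C N j"
    using 1(2) 2(2) by (auto simp: kernel_mor_def cokernel_mor_def)
  have "is_kernel C N (coker C N (r \<cdot> l)) i"
    unfolding 1(1) by (rule is_kernel_coker_cong[OF _ is_kernel_coker[OF 1(3)]])
      (simp add: is_cokernel_comp is_cokernel_coker kernel_mor_Mor[OF 1(3)] p 1(4))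
  moreover have "is_kernel C N (coker C N (r \<cdot> l)) j"
    unfolding 2(1) by (rule is_kernel_coker_cong[OF _ is_kernel_coker[OF j]])
      (simp add: is_cokernel_comp is_cokernel_coker kernel_mor_Mor[OF j] 2(3,4))
  ultimately obtain t where "iso C t" "Cod C t = Dom C j" "j \<cdot> t = i"
    using is_kernel_unique by metis
  then have "is_kernel C N w i"
    using is_kernel_comp_iso[OF 2(2), of t] by simp
  with 1 that show thesis by blast
qed

text \<open>Converse to \<open>is_kernel_cong\<close>: a common kernel forces equal nullity.
  Exactness of a row is used in this form, to replace \<open>coker f'\<close> by
  \<open>g'\<close>.\<close>

lemma is_kernel_null_iff:
  assumes "is_kernel C N h k" "is_kernel C N h' k" "x \<in> Mor C" "Cod C x = Cod C k"
  shows "h \<cdot> x \<in> N \<longleftrightarrow> h' \<cdot> x \<in> N"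
proof -
  have *: "h' \<cdot> x \<in> N" if h: "is_kernel C N h k" "is_kernel C N h' k" "h \<cdot> x \<in> N" for h h'
  proof -
    obtain z where "z \<in> Mor C" "Cod C z = Dom C k" "k \<cdot> z = x"
      using kernel_factor[OF h(1) assms(3)] assms(4) h(3) is_kernelD(3)[OF h(1)] by auto
    then show ?thesis
      using null_reassoc[OF is_kernelD(4)[OF h(2)], of z] is_kernelD[OF h(2)] by simp
  qed
  show ?thesis using *[OF assms(1,2)] *[OF assms(2,1)] by blast
qed

lemma is_cokernel_null_iff:
  assumes "is_cokernel C N h k" "is_cokernel C N h' k" "x \<in> Mor C" "Dom C x = Dom C k"
  shows "x \<cdot> h \<in> N \<longleftrightarrow> x \<cdot> h' \<in> N"
  using homological_category.is_kernel_null_iff[OF op, of h k h' x] assms by simp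

text \<open>A cokernel is a cokernel of its chosen kernel; any other kernel differs from that one by
  an isomorphism, which changes no nullity.\<close>

lemma is_cokernel_of_kernel:
  assumes "is_kernel C N q k" "cokernel_mor C N q"
  shows "is_cokernel C N k q"
proof (rule is_cokernel_cong[OF is_cokernel_ker[OF assms(2)]])
  note [simp] = is_kernelD[OF assms(1)]
  obtain t where [simp]: "t \<in> Mor C" "iso C t" "Dom C t = Dom C (ker C N q)" "Cod C t = Dom C k" and t: "k \<cdot> t = ker C N q"
    using is_kernel_unique[OF is_kernel_ker assms(1)] by auto
  fix x assume [simp]: "x \<in> Mor C" "Dom C x = Cod C (ker C N q)"
  have "x \<cdot> ker C N q = (x \<cdot> k) \<cdot> t" by (simp add: t)
  then show "x \<cdot> ker C N q \<in> N \<longleftrightarrow> x \<cdot> k \<in> N"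
    by (simp del: assoc)
qed (use is_kernelD[OF assms(1)] in simp_all)

lemma is_kernel_of_cokernel:
  assumes "is_cokernel C N q k" "kernel_mor C N q"
  shows "is_kernel C N k q"
  using homological_category.is_cokernel_of_kernel[OF op, of q k] assms by simp

section \<open>Pullbacks of kernels and pushouts of cokernels\<close>

lemma is_pullback_sym: "is_pullback C i j p q \<Longrightarrow> is_pullback C j i q p"
  unfolding is_pullback_def by (metis (full_types))

lemma is_pushout_sym: "is_pushout C i j p q \<Longrightarrow> is_pushout C j i q p"
  using homological_category.is_pullback_sym[OF op, of i j p q] by simp

lemma is_pullbackD:
  assumes "is_pullback C i j p q"
  shows "i \<in> Mor C" "j \<in> Mor C" "p \<in> Mor C" "q \<in> Mor C" "Cod C i = Cod C j"
    "Cod C p = Dom C i" "Cod C q = Dom C j" "Dom C p = Dom C q" "i \<cdot> p = j \<cdot> q"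
  using assms by (simp_all add: is_pullback_def)

lemma is_pushoutD:
  assumes "is_pushout C i j p q"
  shows "i \<in> Mor C" "j \<in> Mor C" "p \<in> Mor C" "q \<in> Mor C" "Dom C i = Dom C j"
    "Dom C p = Cod C i" "Dom C q = Cod C j" "Cod C p = Cod C q" "p \<cdot> i = q \<cdot> j"
  using assms by (simp_all add: is_pushout_def)

lemma pullback_ex1:
  "\<lbrakk>is_pullback C i j p q; x \<in> Mor C; y \<in> Mor C; Dom C x = Dom C y; Cod C x = Dom C i; Cod C y = Dom C j;
     i \<cdot> x = j \<cdot> y\<rbrakk> \<Longrightarrow> \<exists>!z. z \<in> hom C (Dom C x) (Dom C p) \<and> p \<cdot> z = x \<and> q \<cdot> z = y"
  unfolding is_pullback_def by blast

text \<open>Factoring through the inverse image of \<open>j\<close> along \<open>i\<close> means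
  that \<open>h\<close> kills the composite with \<open>i\<close>. This turns the pullback
  \<open>M\<close> and the pushout \<open>N\<close> of a square into a kernel and a cokernel, to
  which the subquotient lemmas apply.\<close>

lemma pullback_kernel:
  assumes "is_pullback C i j p q" "is_kernel C N h j"
  shows "is_kernel C N (h \<cdot> i) p"
proof (rule is_kernelI)
  note [simp] = is_pullbackD[OF assms(1)] is_kernelD[OF assms(2)]
  show "monic C p"
  proof (rule monicI)
    fix x y assume [simp]: "x \<in> Mor C" "y \<in> Mor C" "Cod C x = Dom C p" "Cod C y = Dom C p" "Dom C x = Dom C y"
      and e: "p \<cdot> x = p \<cdot> y"
    have "j \<cdot> (q \<cdot> x) = i \<cdot> p \<cdot> x" using reassoc[of i p "j \<cdot> q" x] by simp
    also have "\<dots> = j \<cdot> (q \<cdot> y)" using reassoc[of i p "j \<cdot> q" y] e by simp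
    finally have "q \<cdot> x = q \<cdot> y"
      using monicD[OF is_kernel_monic[OF assms(2)], of "q \<cdot> x" "q \<cdot> y"] by simp
    moreover have "\<exists>!z. z \<in> hom C (Dom C (p \<cdot> x)) (Dom C p) \<and> p \<cdot> z = p \<cdot> x \<and> q \<cdot> z = q \<cdot> x"
      by (rule pullback_ex1[OF assms(1)]) (simp_all add: reassoc[OF is_pullbackD(9)[OF assms(1)]])
    moreover have "x \<in> hom C (Dom C (p \<cdot> x)) (Dom C p)" "y \<in> hom C (Dom C (p \<cdot> x)) (Dom C p)"
      by (simp_all add: hom_def)
    ultimately show "x = y" using e by metis
  qed simp
  have "(h \<cdot> j) \<cdot> q \<in> N" by (rule null_comp(2)) simp_all
  then show "(h \<cdot> i) \<cdot> p \<in> N" by simp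
  fix x assume [simp]: "x \<in> Mor C" "Cod C x = Dom C (h \<cdot> i)" and n: "(h \<cdot> i) \<cdot> x \<in> N"
  obtain y where [simp]: "y \<in> Mor C" "Dom C y = Dom C x" "Cod C y = Dom C j" and e: "j \<cdot> y = i \<cdot> x"
    using kernel_factor[OF assms(2), of "i \<cdot> x"] n by auto
  have "\<exists>!z. z \<in> hom C (Dom C x) (Dom C p) \<and> p \<cdot> z = x \<and> q \<cdot> z = y"
    by (rule pullback_ex1[OF assms(1)]) (simp_all add: e)
  then show "\<exists>z\<in>Mor C. Cod C z = Dom C p \<and> p \<cdot> z = x"
    by (auto simp: hom_def)
qed (use is_pullbackD[OF assms(1)] is_kernelD[OF assms(2)] in simp_all)

lemma pushout_cokernel:
  assumes "is_pushout C i j p q" "is_cokernel C N h j"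
  shows "is_cokernel C N (i \<cdot> h) p"
  using homological_category.pullback_kernel[OF op, of i j p q h] assms by simp

text \<open>The kernel of \<open>h \<cdot> i\<close> serves as the pullback. Without a pullback the
  choice in \<open>sq_pb\<close> would be meaningless.\<close>

lemma pullback_exists:
  assumes "is_kernel C N h j" "i \<in> Mor C" "Cod C i = Cod C j"
  shows "\<exists>p q. is_pullback C i j p q"
proof -
  note [simp] = is_kernelD[OF assms(1)] assms(2,3)
  define p where "p = ker C N (h \<cdot> i)"
  have p: "is_kernel C N (h \<cdot> i) p" unfolding p_def by (rule is_kernel_ker) simp
  note [simp] = is_kernelD[OF p]
  obtain q where [simp]: "q \<in> Mor C" "Dom C q = Dom C p" "Cod C q = Dom C j" and q: "j \<cdot> q = i \<cdot> p"
    using kernel_factor[OF assms(1), of "i \<cdot> p"] is_kernelD(4)[OF p] by auto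
  have "is_pullback C i j p q"
    unfolding is_pullback_def
  proof (intro conjI ballI impI)
    fix x y assume "x \<in> Mor C" "y \<in> Mor C" "Dom C x = Dom C y \<and> Cod C x = Dom C i \<and> Cod C y = Dom C j \<and> i \<cdot> x = j \<cdot> y"
    then have [simp]: "x \<in> Mor C" "y \<in> Mor C" "Dom C x = Dom C y" "Cod C x = Dom C i" "Cod C y = Dom C j"
      and e: "i \<cdot> x = j \<cdot> y" by simp_all
    have "(h \<cdot> i) \<cdot> x \<in> N" by (simp add: e)
    then obtain z where [simp]: "z \<in> Mor C" "Dom C z = Dom C y" "Cod C z = Dom C p" and z: "p \<cdot> z = x"
      using kernel_factor[OF p, of x] by auto
    have "j \<cdot> q \<cdot> z = j \<cdot> y"
      by (simp add: reassoc[OF q] z e)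
    then have "q \<cdot> z = y" using monicD[OF is_kernel_monic[OF assms(1)], of "q \<cdot> z" y] by simp
    moreover have "z' = z" if "z' \<in> Mor C" "Dom C z' = Dom C y" "Cod C z' = Dom C p" "p \<cdot> z' = x" for z'
      by (rule monicD[OF is_kernel_monic[OF p]]) (simp_all add: that z)
    ultimately show "\<exists>!z. z \<in> hom C (Dom C x) (Dom C p) \<and> p \<cdot> z = x \<and> q \<cdot> z = y"
      using z by (intro ex1I[of _ z]) (auto simp: hom_def)
  qed (simp_all add: q)
  then show ?thesis by blast
qed

text \<open>
  The Lambek morphism lives on the middle object \<open>I\<close> of the exact morphism \<open>i \<cdot> e\<close>: \<open>l\<close> and \<open>r\<close> are a
  subobject and a quotient of \<open>I\<close>.
\<close>

lemma Lambek_middle: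
  assumes i: "kernel_mor C N i" and e: "cokernel_mor C N e" and [simp]: "Dom C i = Cod C e"
    and [simp]: "f \<in> Mor C" "g \<in> Mor C" "f' \<in> Mor C" "g' \<in> Mor C"
      "Cod C f = Dom C e" "Dom C g = Dom C e" "Cod C f' = Cod C i" "Dom C g' = Cod C i"
    and gf: "g \<cdot> f \<in> N" and gf': "g' \<cdot> f' \<in> N"
    and l: "is_kernel C N (coker C N f' \<cdot> i) l" and [simp]: "d \<in> Mor C" "Cod C d = Dom C l" and d: "l \<cdot> d = e \<cdot> f"
    and r: "is_cokernel C N (e \<cdot> ker C N g) r" and [simp]: "w \<in> Mor C" "Dom C w = Cod C r" and w: "w \<cdot> r = g' \<cdot> i"
  shows "\<exists>L\<in>Mor C. Dom C L = Cod C (coker C N d) \<and> Cod C L = Dom C (ker C N w) \<and>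
      r \<cdot> l = ker C N w \<cdot> L \<cdot> coker C N d"
    and "\<lbrakk>is_kernel C N (coker C N f) (ker C N g); is_kernel C N (coker C N f') (ker C N g');
      L \<in> Mor C; Dom C L = Cod C (coker C N d); Cod C L = Dom C (ker C N w);
      r \<cdot> l = ker C N w \<cdot> L \<cdot> coker C N d\<rbrakk> \<Longrightarrow> iso C L"
proof -
  note [simp] = i e kernel_mor_Mor[OF i] cokernel_mor_Mor[OF e]
  note [simp] = is_kernelD(2,3)[OF l] is_cokernelD(2,3)[OF r]
  have kl [simp]: "kernel_mor C N l" and kr [simp]: "cokernel_mor C N r"
    using l r by (auto simp: kernel_mor_def cokernel_mor_def)
  \<comment> \<open>Nullity of the rows gives the factorization: \<open>f\<close> lifts to
    \<open>ker g\<close>, which \<open>r \<cdot> e\<close> kills, so \<open>r \<cdot> l\<close>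
    descends to \<open>Coker d\<close>; and \<open>g'\<close> factors through
    \<open>coker f'\<close>, which kills \<open>i \<cdot> l\<close>, so the result lands in
    \<open>Ker w\<close>.\<close>
  obtain z where [simp]: "z \<in> Mor C" "Dom C z = Dom C f" "Cod C z = Dom C (ker C N g)" and z: "ker C N g \<cdot> z = f"
    using kernel_factor[OF is_kernel_ker, of g f] gf by auto
  have "(r \<cdot> (e \<cdot> ker C N g)) \<cdot> z \<in> N"
    by (rule null_comp(2)[OF is_cokernelD(4)[OF r]]) simp_all
  then have "(r \<cdot> l) \<cdot> d \<in> N"
    by (simp add: d z)
  then obtain y where [simp]: "y \<in> Mor C" "Dom C y = Cod C (coker C N d)" "Cod C y = Cod C r" and y: "y \<cdot> coker C N d = r \<cdot> l"
    using cokernel_factor[OF is_cokernel_coker, of d "r \<cdot> l"] by auto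
  obtain z' where [simp]: "z' \<in> Mor C" "Cod C z' = Cod C g'" "Dom C z' = Cod C (coker C N f')" and z': "z' \<cdot> coker C N f' = g'"
    using cokernel_factor[OF is_cokernel_coker, of f' g'] gf' by auto
  have "z' \<cdot> (coker C N f' \<cdot> i) \<cdot> l \<in> N"
    by (rule null_comp(1)[OF is_kernelD(4)[OF l]]) simp_all
  then have "(w \<cdot> y) \<cdot> coker C N d \<in> N"
    by (simp add: y reassoc[OF w] reassoc[OF z'])
  then have "w \<cdot> y \<in> N" by (simp del: assoc)
  then obtain M where "M \<in> Mor C" "Dom C M = Dom C y" "Cod C M = Dom C (ker C N w)" "ker C N w \<cdot> M = y"
    using kernel_factor[OF is_kernel_ker, of w y] by auto
  then show "\<exists>L\<in>Mor C. Dom C L = Cod C (coker C N d) \<and> Cod C L = Dom C (ker C N w) \<and>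
      r \<cdot> l = ker C N w \<cdot> L \<cdot> coker C N d"
    using y by (intro bexI[of _ M]) (auto simp: reassoc)
  assume ex: "is_kernel C N (coker C N f) (ker C N g)" "is_kernel C N (coker C N f') (ker C N g')"
    and [simp]: "L \<in> Mor C" "Dom C L = Cod C (coker C N d)" "Cod C L = Dom C (ker C N w)"
    and L: "r \<cdot> l = ker C N w \<cdot> L \<cdot> coker C N d"
  \<comment> \<open>Exactness of the lower row: \<open>coker f'\<close> and \<open>g'\<close> have a
    common kernel, so \<open>l\<close> is a kernel of
    \<open>g' \<cdot> i = w \<cdot> r\<close>.\<close>
  have l': "is_kernel C N (w \<cdot> r) l"
    unfolding w
  proof (rule is_kernel_cong[OF l])
    fix x assume "x \<in> Mor C" "Cod C x = Dom C (coker C N f' \<cdot> i)"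
    then show "(coker C N f' \<cdot> i) \<cdot> x \<in> N \<longleftrightarrow> (g' \<cdot> i) \<cdot> x \<in> N"
      using is_kernel_null_iff[OF ex(2) is_kernel_ker, of "i \<cdot> x"] by simp
  qed simp_all
  have cf: "is_cokernel C N (ker C N g) (coker C N f)"
    by (rule is_cokernel_of_kernel[OF ex(1)]) simp
  \<comment> \<open>Exactness of the upper row, dually, makes \<open>r\<close> a cokernel of
    \<open>e \<cdot> f = l \<cdot> d\<close>. Now \<open>subquotient_both\<close> applies, and
    \<open>L\<close> is the product of the comparisons with the chosen cokernel and kernel.\<close>
  have r': "is_cokernel C N (l \<cdot> d) r"
    unfolding d
  proof (rule is_cokernel_cong[OF r])
    fix x assume "x \<in> Mor C" "Dom C x = Cod C (e \<cdot> ker C N g)"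
    then show "x \<cdot> e \<cdot> ker C N g \<in> N \<longleftrightarrow> x \<cdot> e \<cdot> f \<in> N"
      using is_cokernel_null_iff[OF cf is_cokernel_coker, of "x \<cdot> e"] by simp
  qed simp_all
  obtain p j where j: "r \<cdot> l = j \<cdot> p" "is_cokernel C N d p" "is_kernel C N w j" "Dom C j = Cod C p"
    by (rule subquotient_both[OF kl kr r' _ _ l']) (simp, simp, simp, simp, blast)
  note [simp] = is_cokernelD[OF j(2)] is_kernelD[OF j(3)] j(4)
  obtain t where [simp]: "t \<in> Mor C" "iso C t" "Cod C t = Cod C p" "Dom C t = Cod C (coker C N d)" and t: "t \<cdot> coker C N d = p"
    using is_cokernel_unique[OF j(2) is_cokernel_coker] by auto
  obtain s where [simp]: "s \<in> Mor C" "iso C s" "Dom C s = Dom C j" "Cod C s = Dom C (ker C N w)" and s: "ker C N w \<cdot> s = j"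
    using is_kernel_unique[OF j(3) is_kernel_ker] by auto
  have "ker C N w \<cdot> L \<cdot> coker C N d = ker C N w \<cdot> s \<cdot> t \<cdot> coker C N d"
    using L j(1) by (simp add: reassoc[OF s] t)
  then have "L \<cdot> coker C N d = (s \<cdot> t) \<cdot> coker C N d"
    using monicD[of "ker C N w" "L \<cdot> coker C N d" "(s \<cdot> t) \<cdot> coker C N d"] by simp
  then have "L = s \<cdot> t"
    by (rule epicD[rotated]) simp_all
  then show "iso C L" by simp
qed

end

subsection \<open>Squares and Lambek morphisms\<close>

text \<open>Reversing all arrows turns a square by a half turn. Horizontal arrows stay horizontal,
  so the members of the pairs \<open>sq_pb\<close> and \<open>sq_po\<close> correspond in the same
  order.\<close>

definition flip :: "'m square \<Rightarrow> 'm square" where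
  "flip S = Square (bottom_of S) (right_of S) (left_of S) (top_of S)"

lemma flip_sel [simp]:
  "top_of (flip S) = bottom_of S" "left_of (flip S) = right_of S"
  "right_of (flip S) = left_of S" "bottom_of (flip S) = top_of S"
  by (simp_all add: flip_def)

lemma flip_Square [simp]: "flip (Square t l r b) = Square b r l t"
  by (simp add: flip_def)

lemma flip_flip [simp]: "flip (flip S) = S"
  by (cases S) simp

text \<open>These are equalities of chosen morphisms: both sides apply \<open>SOME\<close> to the
  same predicate.\<close>

lemma op_sq [simp]:
  "sq_l (op C) N S = sq_r C N (flip S)" "sq_r (op C) N S = sq_l C N (flip S)"
  "sq_lv (op C) N S = sq_rv C N (flip S)" "sq_rv (op C) N S = sq_lv C N (flip S)"
  by (simp_all add: sq_l_def sq_r_def sq_lv_def sq_rv_def sq_pb_def sq_po_def)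

definition comm_square :: "('o, 'm) cat \<Rightarrow> 'm square \<Rightarrow> bool" where
  "comm_square C S \<longleftrightarrow> top_of S \<in> Mor C \<and> left_of S \<in> Mor C \<and> right_of S \<in> Mor C \<and> bottom_of S \<in> Mor C \<and>
     Dom C (left_of S) = Dom C (top_of S) \<and> Dom C (right_of S) = Cod C (top_of S) \<and>
     Dom C (bottom_of S) = Cod C (left_of S) \<and> Cod C (bottom_of S) = Cod C (right_of S) \<and>
     right_of S \<cdot>\<^bsub>C\<^esub> top_of S = bottom_of S \<cdot>\<^bsub>C\<^esub> left_of S"

lemma op_comm_square [simp]: "comm_square (op C) S = comm_square C (flip S)"
  by (auto simp: comm_square_def)

context homological_category
begin

lemma is_cokernel_iso_shift:
  assumes "is_cokernel C N f q" "iso C t" "Dom C t = Cod C f"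
  shows "is_cokernel C N (t \<cdot> f) (q \<cdot> inverse_mor C t)"
proof -
  note [simp] = is_cokernelD[OF assms(1)] is_cokernel_epic[OF assms(1)] assms(2,3) iso_Mor[OF assms(2)]
  show ?thesis
  proof (rule is_cokernelI)
    fix x assume [simp]: "x \<in> Mor C" "Dom C x = Cod C (t \<cdot> f)" and n: "x \<cdot> t \<cdot> f \<in> N"
    obtain z where [simp]: "z \<in> Mor C" "Dom C z = Cod C q" and z: "z \<cdot> q = x \<cdot> t"
      using cokernel_factor[OF assms(1), of "x \<cdot> t"] n by auto
    show "\<exists>z\<in>Mor C. Dom C z = Cod C (q \<cdot> inverse_mor C t) \<and> z \<cdot> q \<cdot> inverse_mor C t = x"
      by (rule bexI[of _ z]) (simp_all add: reassoc[OF z])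
  qed simp_all
qed

lemma comm_squareD:
  assumes "comm_square C S"
  shows "top_of S \<in> Mor C" "left_of S \<in> Mor C" "right_of S \<in> Mor C" "bottom_of S \<in> Mor C"
    "Dom C (left_of S) = Dom C (top_of S)" "Dom C (right_of S) = Cod C (top_of S)"
    "Dom C (bottom_of S) = Cod C (left_of S)" "Cod C (bottom_of S) = Cod C (right_of S)"
    "right_of S \<cdot> top_of S = bottom_of S \<cdot> left_of S"
  using assms by (auto simp: comm_square_def)

lemma sq_pullback:
  assumes "comm_square C S"
  shows "is_pullback C (im C N (right_of S)) (im C N (bottom_of S)) (sq_l C N S) (sq_lv C N S)"
proof -
  note [simp] = comm_squareD[OF assms]
  have "\<exists>x. case x of (p, q) \<Rightarrow> is_pullback C (im C N (right_of S)) (im C N (bottom_of S)) p q"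
    using pullback_exists[OF is_kernel_im, of "bottom_of S" "im C N (right_of S)"] by simp
  then have "case sq_pb C N S of (p, q) \<Rightarrow> is_pullback C (im C N (right_of S)) (im C N (bottom_of S)) p q"
    unfolding sq_pb_def by (rule someI_ex)
  then show ?thesis
    by (simp add: sq_l_def sq_lv_def split: prod.splits)
qed

lemma sq_pushout:
  assumes "comm_square C S"
  shows "is_pushout C (coim C N (left_of S)) (coim C N (top_of S)) (sq_r C N S) (sq_rv C N S)"
  using homological_category.sq_pullback[OF op, of "flip S"] assms by simp

lemma sq_lam:
  assumes "comm_square C S"
  shows "sq_lam C N S \<in> Mor C" "Dom C (sq_lam C N S) = Dom C (top_of S)"
    "Cod C (sq_lam C N S) = Dom C (sq_l C N S)"
    "sq_l C N S \<cdot> sq_lam C N S = bar C N (right_of S) \<cdot> coim C N (right_of S) \<cdot> top_of S"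
    "sq_lv C N S \<cdot> sq_lam C N S = bar C N (bottom_of S) \<cdot> coim C N (bottom_of S) \<cdot> left_of S"
proof -
  note [simp] = comm_squareD[OF assms]
  define x y where "x = bar C N (right_of S) \<cdot> coim C N (right_of S) \<cdot> top_of S"
    and "y = bar C N (bottom_of S) \<cdot> coim C N (bottom_of S) \<cdot> left_of S"
  have "im C N (right_of S) \<cdot> x = (im C N (right_of S) \<cdot> bar C N (right_of S) \<cdot> coim C N (right_of S)) \<cdot> top_of S"
    unfolding x_def by (simp del: bar(4))
  moreover have "im C N (bottom_of S) \<cdot> y = (im C N (bottom_of S) \<cdot> bar C N (bottom_of S) \<cdot> coim C N (bottom_of S)) \<cdot> left_of S"
    unfolding y_def by (simp del: bar(4))
  ultimately have "\<exists>!z. z \<in> hom C (Dom C x) (Dom C (sq_l C N S)) \<and> sq_l C N S \<cdot> z = x \<and> sq_lv C N S \<cdot> z = y"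
    by (intro pullback_ex1[OF sq_pullback[OF assms]]) (simp_all add: x_def y_def)
  from theI'[OF this] show "sq_lam C N S \<in> Mor C" "Dom C (sq_lam C N S) = Dom C (top_of S)"
    "Cod C (sq_lam C N S) = Dom C (sq_l C N S)"
    "sq_l C N S \<cdot> sq_lam C N S = bar C N (right_of S) \<cdot> coim C N (right_of S) \<cdot> top_of S"
    "sq_lv C N S \<cdot> sq_lam C N S = bar C N (bottom_of S) \<cdot> coim C N (bottom_of S) \<cdot> left_of S"
    by (simp_all add: sq_lam_def x_def y_def hom_def)
qed

text \<open>In the opposite category the composite that defines \<open>bar\<close> is bracketed the
  other way, so the equality passes through the characterization of \<open>bar\<close> and not
  through its definition.\<close>

lemma op_bar:
  assumes [simp]: "f \<in> Mor C" shows "bar (op C) N f = bar C N f"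
  by (rule homological_category.bar_eq[OF op]) simp_all

lemma op_sq_rho:
  assumes "comm_square C S"
  shows "sq_rho C N S = sq_lam (op C) N (flip S)"
proof -
  note [simp] = comm_squareD[OF assms]
  show ?thesis by (simp add: sq_rho_def sq_lam_def op_bar)
qed

lemma sq_rho:
  assumes "comm_square C S"
  shows "sq_rho C N S \<in> Mor C" "Dom C (sq_rho C N S) = Cod C (sq_r C N S)"
    "Cod C (sq_rho C N S) = Cod C (bottom_of S)"
    "sq_rho C N S \<cdot> sq_r C N S = bottom_of S \<cdot> im C N (left_of S) \<cdot> bar C N (left_of S)"
    "sq_rho C N S \<cdot> sq_rv C N S = right_of S \<cdot> im C N (top_of S) \<cdot> bar C N (top_of S)"
proof -
  note [simp] = comm_squareD[OF assms] op_sq_rho[OF assms]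
  show "sq_rho C N S \<in> Mor C" "Dom C (sq_rho C N S) = Cod C (sq_r C N S)"
    "Cod C (sq_rho C N S) = Cod C (bottom_of S)"
    "sq_rho C N S \<cdot> sq_r C N S = bottom_of S \<cdot> im C N (left_of S) \<cdot> bar C N (left_of S)"
    "sq_rho C N S \<cdot> sq_rv C N S = right_of S \<cdot> im C N (top_of S) \<cdot> bar C N (top_of S)"
    using homological_category.sq_lam[OF op, of "flip S"] assms by (simp_all add: op_bar)
qed

lemma exact_morD: "exact_mor C N f \<Longrightarrow> f \<in> Mor C" "exact_mor C N f \<Longrightarrow> iso C (bar C N f)"
  by (auto simp: exact_mor_def)

text \<open>Common core of the horizontal and the vertical case, with the squares replaced by the
  data they supply. The middle object is taken to be \<open>Im b\<close>; since \<open>r\<close>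
  starts at \<open>Coim b\<close>, it is precomposed with the inverse of
  \<open>bar b\<close>.\<close>

lemma Lambek_exists:
  fixes b d l r w
  defines "P \<equiv> \<lambda>L. L \<in> hom C (Cod C (coker C N d)) (Dom C (ker C N w)) \<and>
     r \<cdot> inverse_mor C (bar C N b) \<cdot> l = ker C N w \<cdot> L \<cdot> coker C N d"
  assumes b: "exact_mor C N b"
    and [simp]: "f \<in> Mor C" "g \<in> Mor C" "f' \<in> Mor C" "g' \<in> Mor C"
      "Cod C f = Dom C b" "Dom C g = Dom C b" "Cod C f' = Cod C b" "Dom C g' = Cod C b"
    and null: "g \<cdot> f \<in> N" "g' \<cdot> f' \<in> N"
    and l: "is_pullback C (im C N b) (im C N f') l lv"
    and [simp]: "d \<in> Mor C" "Cod C d = Dom C l" and d: "l \<cdot> d = bar C N b \<cdot> coim C N b \<cdot> f"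
    and r: "is_pushout C (coim C N b) (coim C N g) r rv"
    and [simp]: "w \<in> Mor C" "Dom C w = Cod C r" and w: "w \<cdot> r = g' \<cdot> im C N b \<cdot> bar C N b"
  shows "P (THE L. P L)"
    and "\<lbrakk>is_kernel C N (coker C N f) (ker C N g); is_kernel C N (coker C N f') (ker C N g')\<rbrakk> \<Longrightarrow> iso C (THE L. P L)"
proof -
  note [simp] = exact_morD[OF b] is_pullbackD(3,4,6)[OF l] is_pushoutD(3,4,6)[OF r]
  let ?r = "r \<cdot> inverse_mor C (bar C N b)" and ?e = "bar C N b \<cdot> coim C N b"
  have lk: "is_kernel C N (coker C N f' \<cdot> im C N b) l"
    by (rule pullback_kernel[OF l is_kernel_im]) simp
  have "is_cokernel C N (coim C N b \<cdot> ker C N g) r"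
    by (rule pushout_cokernel[OF r is_cokernel_coim]) simp
  then have "is_cokernel C N (bar C N b \<cdot> coim C N b \<cdot> ker C N g) ?r"
    by (rule is_cokernel_iso_shift) simp_all
  then have rk: "is_cokernel C N (?e \<cdot> ker C N g) ?r" by simp
  have w': "w \<cdot> ?r = g' \<cdot> im C N b"
    by (simp add: reassoc[OF w])
  note m = Lambek_middle[of "im C N b" ?e f g f' g' l d ?r w]
  have u: "L = M" if "P L" "P M" for L M
  proof -
    have t [simp]: "L \<in> Mor C" "Dom C L = Cod C (coker C N d)" "Cod C L = Dom C (ker C N w)"
     "M \<in> Mor C" "Dom C M = Cod C (coker C N d)" "Cod C M = Dom C (ker C N w)"
     and e: "ker C N w \<cdot> L \<cdot> coker C N d = ker C N w \<cdot> M \<cdot> coker C N d"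
      using that by (auto simp: P_def hom_def)
    have "L \<cdot> coker C N d = M \<cdot> coker C N d"
      by (rule monicD[OF _ e]) simp_all
    then show ?thesis by (rule epicD[rotated]) simp_all
  qed
  have "\<exists>L. P L"
    using m(1) lk rk w' d null by (auto simp: P_def hom_def)
  then show P: "P (THE L. P L)" using u by (metis theI)
  show "iso C (THE L. P L)" if "is_kernel C N (coker C N f) (ker C N g)" "is_kernel C N (coker C N f') (ker C N g')"
    by (rule m(2)) (use that P lk rk w' d null in \<open>simp_all add: P_def hom_def\<close>)
qed

lemma Lambek:
  assumes S: "comm_square C S" and T: "comm_square C T" and ST: "left_of T = right_of S"
    and b: "exact_mor C N (right_of S)"
    and null: "top_of T \<cdot> top_of S \<in> N" "bottom_of T \<cdot> bottom_of S \<in> N"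
  shows "Lambek C N S T \<in> Mor C" "Dom C (Lambek C N S T) = Cod C (coker C N (sq_lam C N S))"
    "Cod C (Lambek C N S T) = Dom C (ker C N (sq_rho C N T))"
    "ker C N (sq_rho C N T) \<cdot> Lambek C N S T \<cdot> coker C N (sq_lam C N S) =
       sq_r C N T \<cdot> inverse_mor C (bar C N (right_of S)) \<cdot> sq_l C N S"
    "\<lbrakk>is_kernel C N (coker C N (top_of S)) (ker C N (top_of T));
      is_kernel C N (coker C N (bottom_of S)) (ker C N (bottom_of T))\<rbrakk> \<Longrightarrow> iso C (Lambek C N S T)"
proof -
  note [simp] = comm_squareD(1-8)[OF S] comm_squareD(1-8)[OF T] sq_lam(1-4)[OF S] sq_rho(1-4)[OF T]
  have [simp]: "Dom C (top_of T) = Cod C (top_of S)"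
    using comm_squareD(5,6)[OF T] comm_squareD(6)[OF S] ST by simp
  have [simp]: "Dom C (bottom_of T) = Cod C (right_of S)"
    using comm_squareD[OF T] ST by simp
  have po: "is_pushout C (coim C N (right_of S)) (coim C N (top_of T)) (sq_r C N T) (sq_rv C N T)"
    using sq_pushout[OF T] ST by simp
  note e = Lambek_exists[OF b _ _ _ _ _ _ _ _ null sq_pullback[OF S] _ _ _ po, of "sq_lam C N S" "sq_rho C N T"]
  show "Lambek C N S T \<in> Mor C" "Dom C (Lambek C N S T) = Cod C (coker C N (sq_lam C N S))"
    "Cod C (Lambek C N S T) = Dom C (ker C N (sq_rho C N T))"
    "ker C N (sq_rho C N T) \<cdot> Lambek C N S T \<cdot> coker C N (sq_lam C N S) =
       sq_r C N T \<cdot> inverse_mor C (bar C N (right_of S)) \<cdot> sq_l C N S"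
    using e(1) ST by (simp_all add: Lambek_def Im_sq_def Ker_sq_def hom_def)
  show "\<lbrakk>is_kernel C N (coker C N (top_of S)) (ker C N (top_of T));
      is_kernel C N (coker C N (bottom_of S)) (ker C N (bottom_of T))\<rbrakk> \<Longrightarrow> iso C (Lambek C N S T)"
    using e(2) ST by (simp add: Lambek_def Im_sq_def Ker_sq_def)
qed

text \<open>Transposing exchanges the two projections and the two coprojections, so symmetry of
  pullbacks and pushouts reduces this to the same core.\<close>

lemma Lambek_vert:
  assumes S: "comm_square C S" and T: "comm_square C T" and ST: "top_of T = bottom_of S"
    and b: "exact_mor C N (bottom_of S)"
    and null: "left_of T \<cdot> left_of S \<in> N" "right_of T \<cdot> right_of S \<in> N"
  shows "Lambek_vert C N S T \<in> Mor C" "Dom C (Lambek_vert C N S T) = Cod C (coker C N (sq_lam C N S))"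
    "Cod C (Lambek_vert C N S T) = Dom C (ker C N (sq_rho C N T))"
    "ker C N (sq_rho C N T) \<cdot> Lambek_vert C N S T \<cdot> coker C N (sq_lam C N S) =
       sq_rv C N T \<cdot> inverse_mor C (bar C N (bottom_of S)) \<cdot> sq_lv C N S"
    "\<lbrakk>is_kernel C N (coker C N (left_of S)) (ker C N (left_of T));
      is_kernel C N (coker C N (right_of S)) (ker C N (right_of T))\<rbrakk> \<Longrightarrow> iso C (Lambek_vert C N S T)"
proof -
  note [simp] = comm_squareD(1-8)[OF S] comm_squareD(1-8)[OF T] sq_lam(1-3,5)[OF S] sq_rho(1-3,5)[OF T]
    is_pullbackD(3-8)[OF sq_pullback[OF S]] is_pushoutD(3-8)[OF sq_pushout[OF T]]
  have [simp]: "Dom C (left_of T) = Cod C (left_of S)"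
    using comm_squareD[OF T] comm_squareD[OF S] ST by simp
  have [simp]: "Dom C (right_of T) = Cod C (right_of S)"
    using comm_squareD[OF T] comm_squareD[OF S] ST by simp
  have po: "is_pushout C (coim C N (bottom_of S)) (coim C N (left_of T)) (sq_rv C N T) (sq_r C N T)"
    using is_pushout_sym[OF sq_pushout[OF T]] ST by simp
  note e = Lambek_exists[OF b _ _ _ _ _ _ _ _ null is_pullback_sym[OF sq_pullback[OF S]] _ _ _ po, of "sq_lam C N S" "sq_rho C N T"]
  show "Lambek_vert C N S T \<in> Mor C" "Dom C (Lambek_vert C N S T) = Cod C (coker C N (sq_lam C N S))"
    "Cod C (Lambek_vert C N S T) = Dom C (ker C N (sq_rho C N T))"
    "ker C N (sq_rho C N T) \<cdot> Lambek_vert C N S T \<cdot> coker C N (sq_lam C N S) =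
       sq_rv C N T \<cdot> inverse_mor C (bar C N (bottom_of S)) \<cdot> sq_lv C N S"
    using e(1) ST by (simp_all add: Lambek_vert_def Im_sq_def Ker_sq_def hom_def)
  show "\<lbrakk>is_kernel C N (coker C N (left_of S)) (ker C N (left_of T));
      is_kernel C N (coker C N (right_of S)) (ker C N (right_of T))\<rbrakk> \<Longrightarrow> iso C (Lambek_vert C N S T)"
    using e(2) ST by (simp add: Lambek_vert_def Im_sq_def Ker_sq_def)
qed

end

subsection \<open>Kernels of the verticals of a ladder\<close>

context homological_category
begin

lemma colift [simp]:
  assumes "is_cokernel C N h q" "y \<in> Mor C" "Dom C y = Cod C h" "y \<cdot> h \<in> N"
  shows "colift C q y \<in> Mor C" "Dom C (colift C q y) = Cod C q" "Cod C (colift C q y) = Cod C y"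
    "colift C q y \<cdot> q = y"
proof -
  obtain z where z: "z \<in> Mor C" "Cod C z = Cod C y" "Dom C z = Cod C q" "z \<cdot> q = y"
    using cokernel_factor[OF assms] by blast
  moreover have "colift C q y = z" by (rule colift_eq) (use z is_cokernel_epic[OF assms(1)] in auto)
  ultimately show "colift C q y \<in> Mor C" "Dom C (colift C q y) = Cod C q" "Cod C (colift C q y) = Cod C y"
    "colift C q y \<cdot> q = y" by simp_all
qed

lemma lift [simp]:
  assumes "is_kernel C N h k" "y \<in> Mor C" "Cod C y = Dom C h" "h \<cdot> y \<in> N"
  shows "lift C k y \<in> Mor C" "Cod C (lift C k y) = Dom C k" "Dom C (lift C k y) = Dom C y"
    "k \<cdot> lift C k y = y"
  using homological_category.colift[OF op, of h k y] assms by simp_all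

lemma is_kernel_iso_shift:
  assumes "is_kernel C N f k" "iso C t" "Cod C t = Dom C f"
  shows "is_kernel C N (f \<cdot> t) (inverse_mor C t \<cdot> k)"
  using homological_category.is_cokernel_iso_shift[OF op, of f k t] assms by simp

lemma cokernel_mor_exact: "cokernel_mor C N q \<Longrightarrow> exact_mor C N q"
  using exact_morI[of "Ident C (Cod C q)" q] by (simp add: cokernel_mor_Mor)

lemma kernel_mor_exact: "kernel_mor C N q \<Longrightarrow> exact_mor C N q"
  using exact_morI[of q "Ident C (Dom C q)"] by (simp add: kernel_mor_Mor)

text \<open>A null \<open>h\<close> lets the identity factor through \<open>k\<close>. In the square
  \<open>S2\<close> this shows that the pullback projection is invertible.\<close>

lemma null_kernel_iso:
  assumes "is_kernel C N h k" "h \<in> N"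
  shows "iso C k"
proof -
  note [simp] = is_kernelD[OF assms(1)] assms(2)
  obtain z where [simp]: "z \<in> Mor C" "Dom C z = Dom C h" "Cod C z = Dom C k" and z: "k \<cdot> z = Ident C (Dom C h)"
    using kernel_factor[OF assms(1), of "Ident C (Dom C h)"] by auto
  have "k \<cdot> z \<cdot> k = k \<cdot> Ident C (Dom C k)"
    by (simp add: reassoc[OF z])
  then have "z \<cdot> k = Ident C (Dom C k)"
    by (rule monicD[OF is_kernel_monic[OF assms(1)]]) simp_all
  then show ?thesis using isoI(1)[of k z] z by simp
qed

text \<open>\<open>S0_iso\<close> and \<open>S2_iso\<close> have this shape, with \<open>s\<close>
  identifying the pullback of the square with the expected kernel and \<open>x\<close> the morphism
  \<open>sq_lam\<close>.\<close>

lemma colift_coker_iso: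
  assumes "iso C s" "x \<in> Mor C" "Cod C x = Dom C s" "y = s \<cdot> x"
  shows "iso C (colift C (coker C N x) (coker C N y \<cdot> s))"
    "colift C (coker C N x) (coker C N y \<cdot> s) \<in> Mor C"
    "Dom C (colift C (coker C N x) (coker C N y \<cdot> s)) = Cod C (coker C N x)"
    "Cod C (colift C (coker C N x) (coker C N y \<cdot> s)) = Cod C (coker C N y)"
    "colift C (coker C N x) (coker C N y \<cdot> s) \<cdot> coker C N x = coker C N y \<cdot> s"
proof -
  note [simp] = assms(1-3) iso_Mor[OF assms(1)]
  have y [simp]: "y \<in> Mor C" "Cod C y = Cod C s" using assms(4) by simp_all
  have "is_cokernel C N (inverse_mor C s \<cdot> y) (coker C N y \<cdot> inverse_mor C (inverse_mor C s))"
    by (rule is_cokernel_iso_shift) (simp_all add: is_cokernel_coker)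
  then have "is_cokernel C N x (coker C N y \<cdot> s)" unfolding assms(4) by simp
  then obtain u where u: "u \<in> Mor C" "iso C u" "Cod C u = Cod C (coker C N y \<cdot> s)" "Dom C u = Cod C (coker C N x)"
    "u \<cdot> coker C N x = coker C N y \<cdot> s"
    using is_cokernel_unique[of x "coker C N y \<cdot> s" "coker C N x"] is_cokernel_coker[of x] by auto
  moreover have "colift C (coker C N x) (coker C N y \<cdot> s) = u"
    by (rule colift_eq) (use u in simp_all)
  ultimately show "iso C (colift C (coker C N x) (coker C N y \<cdot> s))"
    "colift C (coker C N x) (coker C N y \<cdot> s) \<in> Mor C"
    "Dom C (colift C (coker C N x) (coker C N y \<cdot> s)) = Cod C (coker C N x)"
    "Cod C (colift C (coker C N x) (coker C N y \<cdot> s)) = Cod C (coker C N y)"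
    "colift C (coker C N x) (coker C N y \<cdot> s) \<cdot> coker C N x = coker C N y \<cdot> s" by simp_all
qed

end

locale ladder = homological_category +
  fixes f g f' g' a b c :: 'm
  assumes diagram: "ladder_diagram C N (Ladder f g f' g' a b c)"
begin

abbreviation D where "D \<equiv> Ladder f g f' g' a b c"

lemma diagram_simps [simp]:
  "f \<in> Mor C" "g \<in> Mor C" "f' \<in> Mor C" "g' \<in> Mor C" "a \<in> Mor C" "b \<in> Mor C" "c \<in> Mor C"
  "Dom C g = Cod C f" "Dom C g' = Cod C f'" "Dom C a = Dom C f" "Cod C a = Dom C f'"
  "Dom C b = Cod C f" "Cod C b = Cod C f'" "Dom C c = Cod C g" "Cod C c = Cod C g'"
  "g \<cdot> f \<in> N" "g' \<cdot> f' \<in> N"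
  and bf: "b \<cdot> f = f' \<cdot> a" and cg: "c \<cdot> g = g' \<cdot> b"
  using diagram by (simp_all add: ladder_diagram_def)

lemma flat [simp]:
  "flat C N f g \<in> Mor C" "Dom C (flat C N f g) = Cod C (coker C N f)" "Cod C (flat C N f g) = Cod C g"
  "flat C N f g \<cdot> coker C N f = g"
  using colift[OF is_cokernel_coker[of f], of g] by (simp_all add: flat_def)

lemma flat' [simp]:
  "flat C N f' g' \<in> Mor C" "Dom C (flat C N f' g') = Cod C (coker C N f')" "Cod C (flat C N f' g') = Cod C g'"
  "flat C N f' g' \<cdot> coker C N f' = g'"
  using colift[OF is_cokernel_coker[of f'], of g'] by (simp_all add: flat_def)

lemma check_b [simp]:
  "check_b C N D \<in> Mor C" "Dom C (check_b C N D) = Cod C (coker C N f)"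
  "Cod C (check_b C N D) = Cod C (coker C N f')"
  and check_b_coker: "check_b C N D \<cdot> coker C N f = coker C N f' \<cdot> b"
proof -
  have "(coker C N f' \<cdot> b) \<cdot> f \<in> N" by (simp add: bf)
  from colift[OF is_cokernel_coker[of f] _ _ this]
  show "check_b C N D \<in> Mor C" "Dom C (check_b C N D) = Cod C (coker C N f)"
    "Cod C (check_b C N D) = Cod C (coker C N f')" "check_b C N D \<cdot> coker C N f = coker C N f' \<cdot> b"
    by (simp_all add: check_b_def)
qed

lemma xi [simp]:
  "xi C N D \<in> Mor C" "Dom C (xi C N D) = Dom C (ker C N b)"
  "Cod C (xi C N D) = Dom C (ker C N (check_b C N D))"
  and ker_xi: "ker C N (check_b C N D) \<cdot> xi C N D = coker C N f \<cdot> ker C N b"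
proof -
  have "check_b C N D \<cdot> (coker C N f \<cdot> ker C N b) \<in> N" by (simp add: reassoc[OF check_b_coker])
  from lift[OF is_kernel_ker[of "check_b C N D"] _ _ this]
  show "xi C N D \<in> Mor C" "Dom C (xi C N D) = Dom C (ker C N b)"
    "Cod C (xi C N D) = Dom C (ker C N (check_b C N D))"
    "ker C N (check_b C N D) \<cdot> xi C N D = coker C N f \<cdot> ker C N b"
    by (simp_all add: xi_def)
qed

lemma flat_check_b: "flat C N f' g' \<cdot> check_b C N D = c \<cdot> flat C N f g"
proof (rule epicD[of "coker C N f"])
  show "(flat C N f' g' \<cdot> check_b C N D) \<cdot> coker C N f = (c \<cdot> flat C N f g) \<cdot> coker C N f"
    by (simp add: check_b_coker reassoc[OF flat'(4)] cg)
qed simp_all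

lemma eta [simp]:
  "eta C N D \<in> Mor C" "Dom C (eta C N D) = Dom C (ker C N (check_b C N D))"
  "Cod C (eta C N D) = Dom C (ker C N c)"
  and ker_eta: "ker C N c \<cdot> eta C N D = flat C N f g \<cdot> ker C N (check_b C N D)"
proof -
  have "c \<cdot> (flat C N f g \<cdot> ker C N (check_b C N D)) \<in> N"
    by (simp add: reassoc[OF flat_check_b[symmetric]])
  from lift[OF is_kernel_ker[of c] _ _ this]
  show "eta C N D \<in> Mor C" "Dom C (eta C N D) = Dom C (ker C N (check_b C N D))"
    "Cod C (eta C N D) = Dom C (ker C N c)"
    "ker C N c \<cdot> eta C N D = flat C N f g \<cdot> ker C N (check_b C N D)"
    by (simp_all add: eta_def)
qed

lemma hat_f [simp]:
  "hat_f C N D \<in> Mor C" "Dom C (hat_f C N D) = Dom C (ker C N a)"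
  "Cod C (hat_f C N D) = Dom C (ker C N b)"
  and ker_hat_f: "ker C N b \<cdot> hat_f C N D = f \<cdot> ker C N a"
proof -
  have "b \<cdot> (f \<cdot> ker C N a) \<in> N" by (simp add: reassoc[OF bf])
  from lift[OF is_kernel_ker[of b] _ _ this]
  show "hat_f C N D \<in> Mor C" "Dom C (hat_f C N D) = Dom C (ker C N a)"
    "Cod C (hat_f C N D) = Dom C (ker C N b)" "ker C N b \<cdot> hat_f C N D = f \<cdot> ker C N a"
    by (simp_all add: hat_f_def)
qed

lemma hat_g [simp]:
  "hat_g C N D \<in> Mor C" "Dom C (hat_g C N D) = Dom C (ker C N b)"
  "Cod C (hat_g C N D) = Dom C (ker C N c)"
  and ker_hat_g: "ker C N c \<cdot> hat_g C N D = g \<cdot> ker C N b"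
proof -
  have "c \<cdot> (g \<cdot> ker C N b) \<in> N" by (simp add: reassoc[OF cg])
  from lift[OF is_kernel_ker[of c] _ _ this]
  show "hat_g C N D \<in> Mor C" "Dom C (hat_g C N D) = Dom C (ker C N b)"
    "Cod C (hat_g C N D) = Dom C (ker C N c)" "ker C N c \<cdot> hat_g C N D = g \<cdot> ker C N b"
    by (simp_all add: hat_g_def)
qed

lemma eta_xi: "eta C N D \<cdot> xi C N D = hat_g C N D"
proof (rule monicD[of "ker C N c"])
  show "ker C N c \<cdot> (eta C N D \<cdot> xi C N D) = ker C N c \<cdot> hat_g C N D"
    by (simp add: reassoc[OF ker_eta] ker_xi reassoc[OF flat(4)] ker_hat_g)
qed simp_all

text \<open>\<open>xi\<close> followed by the kernel \<open>ker check_b\<close> is this composite,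
  so both kill the same morphisms. Thus \<open>Ker xi\<close> is the meet of \<open>Ker b\<close>
  with \<open>Im f\<close>.\<close>

lemma is_kernel_xi: "is_kernel C N (coker C N f \<cdot> ker C N b) (ker C N (xi C N D))"
  using is_kernel_comp[OF is_kernel_ker, of "xi C N D" "ker C N (check_b C N D)"] by (simp add: ker_xi)

lemma lam [simp]:
  "lam C N D \<in> Mor C" "Dom C (lam C N D) = Dom C (ker C N a)"
  "Cod C (lam C N D) = Dom C (ker C N (xi C N D))"
  "ker C N (xi C N D) \<cdot> lam C N D = hat_f C N D"
proof -
  have "(coker C N f \<cdot> ker C N b) \<cdot> hat_f C N D \<in> N" by (simp add: ker_hat_f)
  from lift[OF is_kernel_xi _ _ this]
  show "lam C N D \<in> Mor C" "Dom C (lam C N D) = Dom C (ker C N a)"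
    "Cod C (lam C N D) = Dom C (ker C N (xi C N D))"
    "ker C N (xi C N D) \<cdot> lam C N D = hat_f C N D" by (simp_all add: lam_def)
qed

lemma mu [simp]:
  "mu C N D \<in> Mor C" "Dom C (mu C N D) = Dom C (ker C N (xi C N D))"
  "Cod C (mu C N D) = Dom C (ker C N (eta C N D \<cdot> xi C N D))"
  "ker C N (eta C N D \<cdot> xi C N D) \<cdot> mu C N D = ker C N (xi C N D)"
  using lift[OF is_kernel_ker[of "eta C N D \<cdot> xi C N D"], of "ker C N (xi C N D)"]
  by (simp_all add: mu_def)

lemma v_mor [simp]:
  "v_mor C N D \<in> Mor C" "Dom C (v_mor C N D) = Dom C (ker C N (eta C N D \<cdot> xi C N D))"
  "Cod C (v_mor C N D) = Dom C (ker C N (eta C N D))"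
  "ker C N (eta C N D) \<cdot> v_mor C N D = xi C N D \<cdot> ker C N (eta C N D \<cdot> xi C N D)"
proof -
  have "(eta C N D \<cdot> xi C N D) \<cdot> ker C N (eta C N D \<cdot> xi C N D) \<in> N" by (rule ker) simp
  then have "eta C N D \<cdot> (xi C N D \<cdot> ker C N (eta C N D \<cdot> xi C N D)) \<in> N" by simp
  from lift[OF is_kernel_ker[of "eta C N D"] _ _ this]
  show "v_mor C N D \<in> Mor C" "Dom C (v_mor C N D) = Dom C (ker C N (eta C N D \<cdot> xi C N D))"
    "Cod C (v_mor C N D) = Dom C (ker C N (eta C N D))"
    "ker C N (eta C N D) \<cdot> v_mor C N D = xi C N D \<cdot> ker C N (eta C N D \<cdot> xi C N D)"
    by (simp_all add: v_mor_def)
qed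

text \<open>\<open>v\<close> followed by the kernel \<open>ker eta\<close> is \<open>xi\<close>
  restricted to \<open>Ker (eta \<cdot> xi)\<close>, so \<open>v\<close> and that restriction kill
  the same morphisms; what the restriction kills is exactly \<open>Ker xi\<close>.\<close>

lemma is_kernel_v_mor: "is_kernel C N (v_mor C N D) (mu C N D)"
proof (rule is_kernelI)
  have "kernel_mor C N (mu C N D)"
    by (rule kernel_mor_cancel[of "ker C N (eta C N D \<cdot> xi C N D)"]) simp_all
  then show "monic C (mu C N D)" by simp
  have iff: "v_mor C N D \<cdot> x \<in> N \<longleftrightarrow> xi C N D \<cdot> ker C N (eta C N D \<cdot> xi C N D) \<cdot> x \<in> N"
    if [simp]: "x \<in> Mor C" "Cod C x = Dom C (v_mor C N D)" for x
  proof -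
    have "xi C N D \<cdot> ker C N (eta C N D \<cdot> xi C N D) \<cdot> x = ker C N (eta C N D) \<cdot> v_mor C N D \<cdot> x"
      by (simp add: reassoc[OF v_mor(4)])
    then show ?thesis
      by (simp only:) (rule kernel_mor_null[symmetric], simp_all)
  qed
  show "v_mor C N D \<cdot> mu C N D \<in> N" by (simp add: iff)
  fix x assume x [simp]: "x \<in> Mor C" "Cod C x = Dom C (v_mor C N D)" and n: "v_mor C N D \<cdot> x \<in> N"
  then obtain z where [simp]: "z \<in> Mor C" "Dom C z = Dom C x" "Cod C z = Dom C (ker C N (xi C N D))"
    and z: "ker C N (xi C N D) \<cdot> z = ker C N (eta C N D \<cdot> xi C N D) \<cdot> x"
    using kernel_factor[OF is_kernel_ker, of "xi C N D" "ker C N (eta C N D \<cdot> xi C N D) \<cdot> x"] iff[OF x] by auto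
  have "ker C N (eta C N D \<cdot> xi C N D) \<cdot> mu C N D \<cdot> z = ker C N (eta C N D \<cdot> xi C N D) \<cdot> x"
    by (simp add: reassoc[OF mu(4)] z)
  then have "mu C N D \<cdot> z = x"
    by (rule monicD[rotated]) simp_all
  then show "\<exists>z\<in>Mor C. Cod C z = Dom C (mu C N D) \<and> mu C N D \<cdot> z = x"
    by (intro bexI[of _ z]) simp_all
qed simp_all

lemma kappa [simp]:
  "kappa C N D \<in> Mor C" "Dom C (kappa C N D) = Cod C (coker C N (mu C N D \<cdot> lam C N D))"
  "Cod C (kappa C N D) = Dom C (ker C N (eta C N D))"
  and kappa_coker: "kappa C N D \<cdot> coker C N (mu C N D \<cdot> lam C N D) = v_mor C N D"
proof -
  have "v_mor C N D \<cdot> (mu C N D \<cdot> lam C N D) \<in> N" using is_kernelD(4)[OF is_kernel_v_mor] by simp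
  from colift[OF is_cokernel_coker[of "mu C N D \<cdot> lam C N D"] _ _ this]
  show "kappa C N D \<in> Mor C" "Dom C (kappa C N D) = Cod C (coker C N (mu C N D \<cdot> lam C N D))"
    "Cod C (kappa C N D) = Dom C (ker C N (eta C N D))"
    "kappa C N D \<cdot> coker C N (mu C N D \<cdot> lam C N D) = v_mor C N D" by (simp_all add: kappa_def)
qed

lemma p_mor [simp]:
  "p_mor C N D \<in> Mor C" "Dom C (p_mor C N D) = Cod C (coker C N (lam C N D))"
  "Cod C (p_mor C N D) = Cod C (coker C N (mu C N D \<cdot> lam C N D))"
  "p_mor C N D \<cdot> coker C N (lam C N D) = coker C N (mu C N D \<cdot> lam C N D) \<cdot> mu C N D"
proof -
  have "(coker C N (mu C N D \<cdot> lam C N D) \<cdot> mu C N D) \<cdot> lam C N D \<in> N"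
    using coker(3)[of "mu C N D \<cdot> lam C N D"] by simp
  from colift[OF is_cokernel_coker[of "lam C N D"] _ _ this]
  show "p_mor C N D \<in> Mor C" "Dom C (p_mor C N D) = Cod C (coker C N (lam C N D))"
    "Cod C (p_mor C N D) = Cod C (coker C N (mu C N D \<cdot> lam C N D))"
    "p_mor C N D \<cdot> coker C N (lam C N D) = coker C N (mu C N D \<cdot> lam C N D) \<cdot> mu C N D"
    by (simp_all add: p_mor_def)
qed

lemma is_kernel_p_mor: "is_kernel C N (kappa C N D) (p_mor C N D)"
proof -
  let ?q = "coker C N (mu C N D \<cdot> lam C N D)"
  have km: "kernel_mor C N (mu C N D)" using is_kernel_v_mor by (auto simp: kernel_mor_def)
  \<comment> \<open>The morphism \<open>v\<close> is \<open>kappa\<close> after the projection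
    \<open>?q\<close>. So \<open>mu\<close> and \<open>?q\<close> are a kernel and a cokernel linked
    on both sides, by \<open>lam\<close> and by \<open>kappa\<close>.\<close>
  have kk: "is_kernel C N (kappa C N D \<cdot> ?q) (mu C N D)" by (simp add: kappa_coker is_kernel_v_mor)
  obtain p i where pi: "?q \<cdot> mu C N D = i \<cdot> p" "is_cokernel C N (lam C N D) p" "is_kernel C N (kappa C N D) i" "Dom C i = Cod C p"
    by (rule subquotient_both[OF km _ is_cokernel_coker _ _ kk]) (simp, simp, simp, simp, simp, simp, blast)
  note [simp] = is_cokernelD[OF pi(2)] is_kernelD[OF pi(3)] pi(4)
  obtain t where [simp]: "t \<in> Mor C" "iso C t" "Cod C t = Cod C p" "Dom C t = Cod C (coker C N (lam C N D))"
    and t: "t \<cdot> coker C N (lam C N D) = p"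
    using is_cokernel_unique[OF pi(2) is_cokernel_coker] by auto
  have "p_mor C N D \<cdot> coker C N (lam C N D) = (i \<cdot> t) \<cdot> coker C N (lam C N D)"
    by (simp add: t pi(1))
  then have "p_mor C N D = i \<cdot> t"
    by (rule epicD[rotated]) simp_all
  then show ?thesis using is_kernel_comp_iso[OF pi(3), of t] by simp
qed

end

subsection \<open>Exactness of the sequence\<close>

context homological_category
begin

lemma exact_at_iff:
  "exact_at C N f g \<longleftrightarrow> f \<in> Mor C \<and> g \<in> Mor C \<and> Cod C f = Dom C g \<and> is_kernel C N g (im C N f)"
proof -
  have "same_sub C (im C N f) (ker C N g) \<longleftrightarrow> is_kernel C N g (im C N f)"
    if [simp]: "f \<in> Mor C" "g \<in> Mor C" "Cod C f = Dom C g"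
  proof
    assume "same_sub C (im C N f) (ker C N g)"
    then obtain t where "iso C t" "Cod C t = Dom C (ker C N g)" "im C N f = ker C N g \<cdot> t"
      by (auto simp: same_sub_def hom_def)
    then show "is_kernel C N g (im C N f)" using is_kernel_comp_iso[OF is_kernel_ker, of g t] by simp
  next
    assume k: "is_kernel C N g (im C N f)"
    obtain t where "t \<in> Mor C" "iso C t" "Dom C t = Dom C (im C N f)" "Cod C t = Dom C (ker C N g)"
      "ker C N g \<cdot> t = im C N f"
      using is_kernel_unique[OF k is_kernel_ker] by auto
    then show "same_sub C (im C N f) (ker C N g)"
      by (auto simp: same_sub_def hom_def)
  qed
  then show ?thesis unfolding exact_at_def by blast
qed

text \<open>Exactness in terms of arbitrary representatives: a cokernel \<open>q\<close> of
  \<open>f\<close> and a common kernel \<open>k\<close> of \<open>q\<close> and \<open>g\<close>.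
  This form survives passage to the opposite category, whereas \<open>im\<close> and
  \<open>ker\<close> are one-sided.\<close>

lemma exact_atI:
  assumes "is_cokernel C N f q" "is_kernel C N q k" "is_kernel C N g k"
  shows "exact_at C N f g"
proof -
  note [simp] = is_cokernelD[OF assms(1)]
  obtain t where "iso C t" "Cod C t = Dom C k" "k \<cdot> t = im C N f"
    using is_kernel_unique[OF is_kernel_im is_kernel_coker_cong[OF assms(1,2)]] by auto
  then have "is_kernel C N g (im C N f)"
    using is_kernel_comp_iso[OF assms(3), of t] by simp
  then show ?thesis
    using is_kernelD[OF assms(2)] is_kernelD[OF assms(3)] by (simp add: exact_at_iff)
qed

lemma exact_atE:
  assumes "exact_at C N f g"
  obtains q k where "is_cokernel C N f q" "is_kernel C N q k" "is_kernel C N g k"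
  using assms is_cokernel_coker[of f] is_kernel_im[of f] unfolding exact_at_iff by blast

lemma exact_at_iso:
  assumes "exact_at C N f g" "iso C r" "iso C s" "iso C t" "Cod C r = Dom C f" "Dom C s = Cod C f" "Dom C t = Cod C g"
  shows "exact_at C N (s \<cdot> f \<cdot> r) (t \<cdot> g \<cdot> inverse_mor C s)"
proof -
  obtain q k where qk: "is_cokernel C N f q" "is_kernel C N q k" "is_kernel C N g k"
    by (rule exact_atE[OF assms(1)])
  note [simp] = assms(2-) assms(2-4)[THEN iso_Mor] is_cokernelD[OF qk(1)] is_kernelD[OF qk(2)] is_kernelD[OF qk(3)]
  have [simp]: "Dom C g = Cod C f" "Dom C q = Cod C f" using assms(1) is_cokernelD[OF qk(1)] by (auto simp: exact_at_iff)
  show ?thesis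
  proof (rule exact_atI)
    show "is_cokernel C N (s \<cdot> f \<cdot> r) (q \<cdot> inverse_mor C s)"
      by (rule is_cokernel_iso_shift, rule is_cokernel_comp[OF qk(1)]) simp_all
    have "is_kernel C N (q \<cdot> inverse_mor C s) (inverse_mor C (inverse_mor C s) \<cdot> k)"
      by (rule is_kernel_iso_shift[OF qk(2)]) simp_all
    then show "is_kernel C N (q \<cdot> inverse_mor C s) (s \<cdot> k)" by simp
    have "is_kernel C N (g \<cdot> inverse_mor C s) (inverse_mor C (inverse_mor C s) \<cdot> k)"
      by (rule is_kernel_iso_shift[OF qk(3)]) simp_all
    then have "is_kernel C N (g \<cdot> inverse_mor C s) (s \<cdot> k)" by simp
    then show "is_kernel C N (t \<cdot> g \<cdot> inverse_mor C s) (s \<cdot> k)" by (rule is_kernel_comp) simp_all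
  qed
qed

lemma exact_mor_iso:
  assumes "exact_mor C N f" "iso C s" "iso C t" "Cod C s = Dom C f" "Dom C t = Cod C f"
  shows "exact_mor C N (t \<cdot> f \<cdot> s)"
proof -
  obtain i q where iq: "kernel_mor C N i" "cokernel_mor C N q" "Dom C i = Cod C q" "f = i \<cdot> q"
    by (rule exact_morE[OF assms(1)])
  note [simp] = assms(2-5) assms(2,3)[THEN iso_Mor] iq(1-3) iq(1)[THEN kernel_mor_Mor] iq(2)[THEN cokernel_mor_Mor]
  have "exact_mor C N ((t \<cdot> i) \<cdot> (q \<cdot> s))"
    using assms(4,5) by (intro exact_morI) (simp_all add: iq(4))
  then show ?thesis
    using assms(4,5) by (simp add: iq(4))
qed

end

context ladder
begin

lemma comm_squares [simp]:
  "comm_square C (sq_S D)" "comm_square C (sq_T D)" "comm_square C (sq_S0 C N D)"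
  "comm_square C (sq_S1 C N D)" "comm_square C (sq_S2 C N D)"
  by (simp_all add: comm_square_def sq_S_def sq_T_def sq_S0_def sq_S1_def sq_S2_def
      bf cg ker_hat_f check_b_coker ker_xi)

lemma square_sel [simp]:
  "top_of (sq_S D) = f" "left_of (sq_S D) = a" "right_of (sq_S D) = b" "bottom_of (sq_S D) = f'"
  "top_of (sq_T D) = g" "left_of (sq_T D) = b" "right_of (sq_T D) = c" "bottom_of (sq_T D) = g'"
  "top_of (sq_S0 C N D) = hat_f C N D" "left_of (sq_S0 C N D) = ker C N a"
  "right_of (sq_S0 C N D) = ker C N b" "bottom_of (sq_S0 C N D) = f"
  "top_of (sq_S1 C N D) = coker C N f" "left_of (sq_S1 C N D) = b"
  "right_of (sq_S1 C N D) = check_b C N D" "bottom_of (sq_S1 C N D) = coker C N f'"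
  "top_of (sq_S2 C N D) = xi C N D" "left_of (sq_S2 C N D) = ker C N b"
  "right_of (sq_S2 C N D) = ker C N (check_b C N D)" "bottom_of (sq_S2 C N D) = coker C N f"
  by (simp_all add: sq_S_def sq_T_def sq_S0_def sq_S1_def sq_S2_def)

text \<open>The pullback of \<open>im (ker b)\<close> and \<open>im f\<close> is a kernel of
  \<open>coker f \<cdot> im (ker b)\<close>. Identifying \<open>ker b\<close> with its image by
  \<open>t\<close> turns it into \<open>ker xi\<close>; the resulting \<open>s\<close> carries
  \<open>sq_lam\<close> to \<open>lam\<close>, as both have the same composite into the domain of
  \<open>b\<close>.\<close>

lemma S0_iso [simp]:
  "iso C (S0_iso C N D)" "S0_iso C N D \<in> Mor C"
  "Dom C (S0_iso C N D) = Cod C (coker C N (sq_lam C N (sq_S0 C N D)))"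
  "Cod C (S0_iso C N D) = Cod C (coker C N (lam C N D))"
proof -
  let ?l = "sq_l C N (sq_S0 C N D)" and ?d = "sq_lam C N (sq_S0 C N D)" and ?i = "im C N (ker C N b)"
  have pb: "is_pullback C ?i (im C N f) ?l (sq_lv C N (sq_S0 C N D))"
    using sq_pullback[of "sq_S0 C N D"] by simp
  note [simp] = is_pullbackD(3,6)[OF pb] sq_lam(1-3)[of "sq_S0 C N D", simplified]
  have d: "?l \<cdot> ?d = bar C N (ker C N b) \<cdot> coim C N (ker C N b) \<cdot> hat_f C N D"
    using sq_lam(4)[of "sq_S0 C N D"] by simp
  have l: "is_kernel C N (coker C N f \<cdot> ?i) ?l"
    by (rule pullback_kernel[OF pb is_kernel_im]) simp
  obtain t where [simp]: "t \<in> Mor C" "iso C t" "Dom C t = Dom C ?i" "Cod C t = Dom C (ker C N b)"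
    and t: "ker C N b \<cdot> t = ?i"
    using is_kernel_unique[OF is_kernel_im is_kernel_coker, of "ker C N b"] by auto
  have "is_kernel C N ((coker C N f \<cdot> ?i) \<cdot> inverse_mor C t) (inverse_mor C (inverse_mor C t) \<cdot> ?l)"
    by (rule is_kernel_iso_shift[OF l]) simp_all
  moreover have "?i \<cdot> inverse_mor C t = ker C N b"
    by (subst t[symmetric]) simp
  ultimately have tl: "is_kernel C N (coker C N f \<cdot> ker C N b) (t \<cdot> ?l)"
    by simp
  obtain s where [simp]: "s \<in> Mor C" "iso C s" "Dom C s = Dom C ?l" "Cod C s = Dom C (ker C N (xi C N D))"
    and s: "ker C N (xi C N D) \<cdot> s = t \<cdot> ?l"
    using is_kernel_unique[OF tl is_kernel_xi] by auto
  have "(ker C N b \<cdot> ker C N (xi C N D)) \<cdot> s = ?i \<cdot> ?l"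
    by (simp add: s reassoc[OF t])
  then have w: "lift C (ker C N b \<cdot> ker C N (xi C N D)) (?i \<cdot> ?l) = s"
    by (intro lift_eq) simp_all
  have "(ker C N b \<cdot> ker C N (xi C N D)) \<cdot> (s \<cdot> ?d) = ?i \<cdot> (?l \<cdot> ?d)"
    by (simp add: reassoc[OF s] reassoc[OF t] del: sq_lam(4))
  also have "\<dots> = (?i \<cdot> bar C N (ker C N b) \<cdot> coim C N (ker C N b)) \<cdot> hat_f C N D"
    unfolding d by (simp del: bar(4))
  also have "\<dots> = (ker C N b \<cdot> ker C N (xi C N D)) \<cdot> lam C N D"
    by simp
  finally have "s \<cdot> ?d = lam C N D"
    by (rule monicD[rotated]) simp_all
  then show "iso C (S0_iso C N D)" "S0_iso C N D \<in> Mor C"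
    "Dom C (S0_iso C N D) = Cod C (coker C N (sq_lam C N (sq_S0 C N D)))"
    "Cod C (S0_iso C N D) = Cod C (coker C N (lam C N D))"
    using colift_coker_iso[of s ?d "lam C N D"] by (simp_all add: S0_iso_def w)
qed

text \<open>The isomorphism \<open>s\<close> is exported together with its equations, because the
  computation of \<open>beta\<close> needs its action and not only its existence.\<close>

lemma S2_iso:
  obtains s where "s \<in> Mor C" "iso C s" "Dom C s = Dom C (sq_l C N (sq_S2 C N D))"
    "Cod C s = Dom C (ker C N (check_b C N D))"
    "ker C N (check_b C N D) \<cdot> s = im C N (ker C N (check_b C N D)) \<cdot> sq_l C N (sq_S2 C N D)"
    "iso C (S2_iso C N D)" "S2_iso C N D \<in> Mor C"
    "Dom C (S2_iso C N D) = Cod C (coker C N (sq_lam C N (sq_S2 C N D)))"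
    "Cod C (S2_iso C N D) = Cod C (coker C N (xi C N D))"
    "S2_iso C N D \<cdot> coker C N (sq_lam C N (sq_S2 C N D)) = coker C N (xi C N D) \<cdot> s"
proof -
  let ?k = "ker C N (check_b C N D)"
  let ?l = "sq_l C N (sq_S2 C N D)" and ?d = "sq_lam C N (sq_S2 C N D)" and ?i = "im C N ?k"
  have pb: "is_pullback C ?i (im C N (coker C N f)) ?l (sq_lv C N (sq_S2 C N D))"
    using sq_pullback[of "sq_S2 C N D"] by simp
  note [simp] = is_pullbackD(3,6)[OF pb] sq_lam(1-3)[of "sq_S2 C N D", simplified]
  have d: "?l \<cdot> ?d = bar C N ?k \<cdot> coim C N ?k \<cdot> xi C N D"
    using sq_lam(4)[of "sq_S2 C N D"] by simp
  have "is_kernel C N (coker C N (coker C N f) \<cdot> ?i) ?l"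
    by (rule pullback_kernel[OF pb is_kernel_im]) simp
  \<comment> \<open>Cokernels reflect null morphisms, so \<open>coker (coker f)\<close> is itself
    null. The pullback along \<open>im (coker f)\<close> therefore cuts out nothing, and
    \<open>?l\<close> is an isomorphism.\<close>
  moreover have "coker C N (coker C N f) \<cdot> coker C N f \<in> N" by (rule coker) simp
  then have "coker C N (coker C N f) \<in> N" by (simp del: coker(3))
  ultimately have [simp]: "iso C ?l"
    by (elim null_kernel_iso) simp
  obtain t where [simp]: "t \<in> Mor C" "iso C t" "Dom C t = Dom C ?i" "Cod C t = Dom C ?k"
    and t: "?k \<cdot> t = ?i"
    using is_kernel_unique[OF is_kernel_im is_kernel_coker, of ?k] by auto
  define s where "s = t \<cdot> ?l"
  have s [simp]: "s \<in> Mor C" "iso C s" "Dom C s = Dom C ?l" "Cod C s = Dom C ?k" and ks: "?k \<cdot> s = ?i \<cdot> ?l"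
    by (simp_all add: s_def reassoc[OF t])
  have w: "lift C ?k (?i \<cdot> ?l) = s"
    by (intro lift_eq) (simp_all add: ks)
  have "?k \<cdot> (s \<cdot> ?d) = ?i \<cdot> (?l \<cdot> ?d)"
    by (simp add: reassoc[OF ks])
  also have "\<dots> = (?i \<cdot> bar C N ?k \<cdot> coim C N ?k) \<cdot> xi C N D"
    unfolding d by (simp del: bar(4))
  also have "\<dots> = ?k \<cdot> xi C N D"
    by simp
  finally have "s \<cdot> ?d = xi C N D"
    by (rule monicD[rotated]) simp_all
  then show thesis
    using colift_coker_iso[of s ?d "xi C N D"] s ks by (intro that[of s]) (simp_all add: S2_iso_def w)
qed

lemma nomura_p1:
  assumes "exact_mor C N f"
  shows "is_kernel C N (kappa C N D) (p1 C N D)"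
proof -
  note L = Lambek_vert[of "sq_S0 C N D" "sq_S D"]
  \<comment> \<open>Both columns, \<open>ker a\<close> before \<open>a\<close> and
    \<open>ker b\<close> before \<open>b\<close>, are exact because a kernel is its own image;
    exactness of the common side \<open>f\<close> is the hypothesis.\<close>
  have [simp]: "iso C (Lambek_vert C N (sq_S0 C N D) (sq_S D))"
    by (rule L(5)) (simp_all add: assms is_kernel_coker is_kernel_ker)
  note [simp] = L(1-3)[simplified, OF assms]
  have "is_kernel C N (kappa C N D) (p_mor C N D \<cdot> S0_iso C N D \<cdot> inverse_mor C (Lambek_vert C N (sq_S0 C N D) (sq_S D)))"
    by (rule is_kernel_comp_iso[OF is_kernel_p_mor]) simp_all
  then show ?thesis by (simp add: p1_def)
qed

text \<open>The image of \<open>kappa\<close> is the part \<open>Im xi \<and> Ker eta\<close> of \<open>Ker eta\<close>.\<close>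

lemma kappa_exact:
  assumes "exact_mor C N (coker C N f \<cdot> ker C N b)"
  shows "exact_at C N (kappa C N D) (coker C N (xi C N D) \<cdot> ker C N (eta C N D))"
    and "exact_mor C N (kappa C N D)"
proof -
  let ?k = "ker C N (check_b C N D)"
  obtain i0 q where 0: "kernel_mor C N i0" "cokernel_mor C N q" "Dom C i0 = Cod C q" "coker C N f \<cdot> ker C N b = i0 \<cdot> q"
    by (rule exact_morE[OF assms])
  note [simp] = 0(1-3) 0(1)[THEN kernel_mor_Mor] 0(2)[THEN cokernel_mor_Mor]
  have q [simp]: "Dom C q = Dom C (ker C N b)" and [simp]: "Cod C i0 = Cod C (coker C N f)"
    using arg_cong[OF 0(4), of "Dom C"] arg_cong[OF 0(4), of "Cod C"] by simp_all
  \<comment> \<open>The kernel part \<open>i0\<close> of \<open>coker f \<cdot> ker b\<close> lies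
    in \<open>Ker check_b\<close>, as one sees after the cokernel \<open>q\<close>. Hence
    \<open>xi\<close> itself splits as the kernel \<open>i\<close> after \<open>q\<close>.\<close>
  have "(check_b C N D \<cdot> i0) \<cdot> q \<in> N"
    by (simp add: 0(4)[symmetric] reassoc[OF check_b_coker])
  then have "check_b C N D \<cdot> i0 \<in> N" by (simp del: assoc)
  then obtain i where [simp]: "i \<in> Mor C" "Dom C i = Dom C i0" "Cod C i = Dom C ?k" and i: "?k \<cdot> i = i0"
    using kernel_factor[OF is_kernel_ker, of "check_b C N D" i0] by auto
  have [simp]: "kernel_mor C N i"
    by (rule kernel_mor_cancel[of ?k]) (simp_all add: i)
  have xi: "xi C N D = i \<cdot> q"
    by (rule monicD[of ?k]) (simp_all add: ker_xi 0(4) reassoc[OF i])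
  let ?l = "ker C N (eta C N D \<cdot> xi C N D)"
  have l: "is_kernel C N ((eta C N D \<cdot> i) \<cdot> q) ?l"
    using is_kernel_ker[of "eta C N D \<cdot> xi C N D"] by (simp add: xi)
  \<comment> \<open>\<open>j\<close> is the kernel of \<open>eta\<close> restricted to
    \<open>Im xi\<close>, and \<open>Ker (eta \<cdot> xi)\<close> maps onto it by the cokernel
    \<open>p\<close>. Below, \<open>j\<close> is embedded in \<open>Ker eta\<close> as
    \<open>m\<close>, so that \<open>v = m \<cdot> p\<close> and \<open>kappa\<close> is
    \<open>m\<close> after the morphism induced by \<open>p\<close>.\<close>
  obtain p j where j: "q \<cdot> ?l = j \<cdot> p" "is_kernel C N (eta C N D \<cdot> i) j" "cokernel_mor C N p" "Dom C j = Cod C p" "Dom C p = Dom C ?l"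
    by (rule subquotient_right[OF _ l]) (simp, simp, simp, blast)
  have kj [simp]: "kernel_mor C N j" using j(2) by (auto simp: kernel_mor_def)
  note [simp] = is_kernelD(2,3)[OF j(2)] j(3-5) j(3)[THEN cokernel_mor_Mor]
  have "eta C N D \<cdot> i \<cdot> j \<in> N" using is_kernelD(4)[OF j(2)] by simp
  then obtain m where [simp]: "m \<in> Mor C" "Dom C m = Dom C j" "Cod C m = Dom C (ker C N (eta C N D))"
    and m: "ker C N (eta C N D) \<cdot> m = i \<cdot> j"
    using kernel_factor[OF is_kernel_ker, of "eta C N D" "i \<cdot> j"] by auto
  have km [simp]: "kernel_mor C N m"
    by (rule kernel_mor_cancel[of "ker C N (eta C N D)"]) (simp_all add: m)
  have "ker C N (eta C N D) \<cdot> (m \<cdot> p) = ker C N (eta C N D) \<cdot> v_mor C N D"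
    by (simp add: reassoc[OF m] j(1)[symmetric] xi)
  then have v: "m \<cdot> p = v_mor C N D"
    by (rule monicD[rotated]) simp_all
  have "m \<cdot> p \<cdot> mu C N D \<cdot> lam C N D \<in> N"
    using null_reassoc[OF is_kernelD(4)[OF is_kernel_v_mor], of "lam C N D"] by (simp add: reassoc[OF v])
  then have "p \<cdot> mu C N D \<cdot> lam C N D \<in> N" by simp
  then obtain p' where [simp]: "p' \<in> Mor C" "Cod C p' = Cod C p" "Dom C p' = Cod C (coker C N (mu C N D \<cdot> lam C N D))"
    and p': "p' \<cdot> coker C N (mu C N D \<cdot> lam C N D) = p"
    using cokernel_factor[OF is_cokernel_coker, of "mu C N D \<cdot> lam C N D" p] by auto
  have [simp]: "cokernel_mor C N p'"
    by (rule cokernel_mor_cancel[of _ "coker C N (mu C N D \<cdot> lam C N D)"]) (simp_all add: p')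
  have "kappa C N D \<cdot> coker C N (mu C N D \<cdot> lam C N D) = (m \<cdot> p') \<cdot> coker C N (mu C N D \<cdot> lam C N D)"
    by (simp add: p' v kappa_coker)
  then have kappa: "kappa C N D = m \<cdot> p'"
    by (rule epicD[rotated]) simp_all
  show "exact_mor C N (kappa C N D)"
    unfolding kappa by (rule exact_morI) simp_all
  \<comment> \<open>A cokernel before \<open>i\<close> does not change its cokernel, so
    \<open>i\<close> is a kernel of \<open>coker xi\<close>. What
    \<open>coker xi \<cdot> ker eta\<close> kills therefore lies in \<open>Im xi\<close> and is
    killed by \<open>eta\<close>, and so it lifts along \<open>m\<close>.\<close>
  have ci: "is_cokernel C N (xi C N D) (coker C N i)"
    unfolding xi by (rule is_cokernel_comp[OF is_cokernel_coker]) simp_all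
  have ki: "is_kernel C N (coker C N (xi C N D)) i"
    by (rule is_kernel_coker_cong[OF ci is_kernel_coker]) simp
  show "exact_at C N (kappa C N D) (coker C N (xi C N D) \<cdot> ker C N (eta C N D))"
  proof (rule exact_atI)
    show "is_cokernel C N (kappa C N D) (coker C N m)"
      unfolding kappa by (rule is_cokernel_comp[OF is_cokernel_coker]) simp_all
    show "is_kernel C N (coker C N m) m" by (rule is_kernel_coker) simp
    show "is_kernel C N (coker C N (xi C N D) \<cdot> ker C N (eta C N D)) m"
    proof (rule is_kernelI)
      show "(coker C N (xi C N D) \<cdot> ker C N (eta C N D)) \<cdot> m \<in> N"
        using null_reassoc[OF is_kernelD(4)[OF ki], of j] by (simp add: m)
      fix x assume [simp]: "x \<in> Mor C" "Cod C x = Dom C (coker C N (xi C N D) \<cdot> ker C N (eta C N D))"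
        and n: "(coker C N (xi C N D) \<cdot> ker C N (eta C N D)) \<cdot> x \<in> N"
      obtain y where [simp]: "y \<in> Mor C" "Dom C y = Dom C x" "Cod C y = Dom C i" and y: "i \<cdot> y = ker C N (eta C N D) \<cdot> x"
        using kernel_factor[OF ki, of "ker C N (eta C N D) \<cdot> x"] n by auto
      have "(eta C N D \<cdot> i) \<cdot> y \<in> N" by (simp add: y)
      then obtain z where [simp]: "z \<in> Mor C" "Dom C z = Dom C x" "Cod C z = Dom C j" and z: "j \<cdot> z = y"
        using kernel_factor[OF j(2), of y] by auto
      have "ker C N (eta C N D) \<cdot> m \<cdot> z = ker C N (eta C N D) \<cdot> x"
        by (simp add: reassoc[OF m] z y)
      then have "m \<cdot> z = x" by (rule monicD[rotated]) simp_all
      then show "\<exists>z\<in>Mor C. Cod C z = Dom C m \<and> m \<cdot> z = x"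
        by (intro bexI[of _ z]) simp_all
    qed simp_all
  qed
qed

end

section \<open>Left and right homology of a null sequence\<close>

context homological_category
begin

lemma homology_iso:
  assumes [simp]: "f \<in> Mor C" "g \<in> Mor C" "Dom C g = Cod C f" "g \<cdot> f \<in> N"
  shows "homology_iso C N f g \<in> Mor C" "Dom C (homology_iso C N f g) = Cod C (homology_proj C N f g)"
    "Cod C (homology_iso C N f g) = Dom C (ker C N (flat C N f g))"
    "iso C (homology_iso C N f g)"
    "ker C N (flat C N f g) \<cdot> homology_iso C N f g \<cdot> homology_proj C N f g = coker C N f \<cdot> ker C N g"
proof -
  have s [simp]: "sharp C N f g \<in> Mor C" "Dom C (sharp C N f g) = Dom C f" "Cod C (sharp C N f g) = Dom C (ker C N g)"
    "ker C N g \<cdot> sharp C N f g = f"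
    using lift[OF is_kernel_ker[of g], of f] by (simp_all add: sharp_def)
  have t [simp]: "flat C N f g \<in> Mor C" "Dom C (flat C N f g) = Cod C (coker C N f)" "Cod C (flat C N f g) = Cod C g"
    "flat C N f g \<cdot> coker C N f = g"
    using colift[OF is_cokernel_coker[of f], of g] by (simp_all add: flat_def)
  have [simp]: "homology_proj C N f g \<in> Mor C" "Dom C (homology_proj C N f g) = Dom C (ker C N g)"
    "epic C (homology_proj C N f g)"
    by (simp_all add: homology_proj_def)
  \<comment> \<open>With \<open>sharp f g\<close> and \<open>flat f g\<close> as the two links, one
    factorization of \<open>coker f \<cdot> ker g\<close> exhibits both forms of the homology at
    once.\<close>
  obtain p i where pi: "coker C N f \<cdot> ker C N g = i \<cdot> p" "is_cokernel C N (sharp C N f g) p" "is_kernel C N (flat C N f g) i" "Dom C i = Cod C p"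
    by (rule subquotient_both[of "ker C N g" "coker C N f" "sharp C N f g" "flat C N f g"])
      (simp_all add: is_kernel_ker is_cokernel_coker)
  note [simp] = is_cokernelD[OF pi(2)] is_kernelD[OF pi(3)] pi(4)
  obtain v where [simp]: "v \<in> Mor C" "iso C v" "Cod C v = Cod C p" "Dom C v = Cod C (homology_proj C N f g)"
    and v: "v \<cdot> homology_proj C N f g = p"
    using is_cokernel_unique[OF pi(2) is_cokernel_coker] by (auto simp: homology_proj_def)
  obtain u where [simp]: "u \<in> Mor C" "iso C u" "Dom C u = Dom C i" "Cod C u = Dom C (ker C N (flat C N f g))"
    and u: "ker C N (flat C N f g) \<cdot> u = i"
    using is_kernel_unique[OF pi(3) is_kernel_ker] by auto
  have e: "ker C N (flat C N f g) \<cdot> (u \<cdot> v) \<cdot> homology_proj C N f g = coker C N f \<cdot> ker C N g"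
    by (simp add: reassoc[OF u] v pi(1))
  have "homology_iso C N f g = u \<cdot> v"
    unfolding homology_iso_def
  proof (rule the_equality)
    show "u \<cdot> v \<in> hom C (homology C N f g) (Dom C (ker C N (flat C N f g))) \<and>
      ker C N (flat C N f g) \<cdot> (u \<cdot> v) \<cdot> homology_proj C N f g = coker C N f \<cdot> ker C N g"
      using e by (simp add: hom_def homology_def)
    fix m assume "m \<in> hom C (homology C N f g) (Dom C (ker C N (flat C N f g))) \<and>
      ker C N (flat C N f g) \<cdot> m \<cdot> homology_proj C N f g = coker C N f \<cdot> ker C N g"
    then have [simp]: "m \<in> Mor C" "Dom C m = Cod C (homology_proj C N f g)" "Cod C m = Dom C (ker C N (flat C N f g))"
      and m: "ker C N (flat C N f g) \<cdot> m \<cdot> homology_proj C N f g = ker C N (flat C N f g) \<cdot> (u \<cdot> v) \<cdot> homology_proj C N f g"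
      using e by (simp_all add: hom_def homology_def)
    have "m \<cdot> homology_proj C N f g = (u \<cdot> v) \<cdot> homology_proj C N f g"
      by (rule monicD[OF _ m]) simp_all
    then show "m = u \<cdot> v" by (rule epicD[rotated]) simp_all
  qed
  then show "homology_iso C N f g \<in> Mor C" "Dom C (homology_iso C N f g) = Cod C (homology_proj C N f g)"
    "Cod C (homology_iso C N f g) = Dom C (ker C N (flat C N f g))"
    "iso C (homology_iso C N f g)"
    "ker C N (flat C N f g) \<cdot> homology_iso C N f g \<cdot> homology_proj C N f g = coker C N f \<cdot> ker C N g"
    using e by simp_all
qed

end

section \<open>The connecting morphism \<open>beta\<close>\<close>

context ladder
begin

text \<open>\<open>t\<close> is the composite of the two Lambek isomorphisms with the identification
  of \<open>S2\<close>. The last clause is the bridge to \<open>\<Lambda>\<close>: on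
  \<open>Ker check_b\<close> the morphism becomes the evident one, through \<open>Coim g\<close>
  into the pushout of \<open>T\<close>. It is stated after \<open>ker \<rho>\<close> because a
  Lambek morphism is characterized only between a kernel and a cokernel.\<close>

lemma beta:
  assumes b: "exact_mor C N b"
  obtains t where "t \<in> Mor C" "iso C t" "Dom C t = Cod C (coker C N (xi C N D))"
    "Cod C t = Dom C (Lambek C N (sq_S D) (sq_T D))"
    "beta C N D = t \<cdot> coker C N (xi C N D) \<cdot> ker C N (eta C N D)"
    "\<And>z. \<lbrakk>z \<in> Mor C; Dom C z = Cod C (coker C N f); Cod C z = Cod C (coim C N g); z \<cdot> coker C N f = coim C N g\<rbrakk> \<Longrightarrow>
      ker C N (sq_rho C N (sq_T D)) \<cdot> Lambek C N (sq_S D) (sq_T D) \<cdot> t \<cdot> coker C N (xi C N D) =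
      sq_rv C N (sq_T D) \<cdot> z \<cdot> ker C N (check_b C N D)"
proof -
  note b' [simp] = exact_morD(2)[OF b] iso_Mor[OF exact_morD(2)[OF b]]
  have cf: "exact_mor C N (coker C N f)" by (rule cokernel_mor_exact) simp
  note [simp] = exact_morD(2)[OF cf] iso_Mor[OF exact_morD(2)[OF cf]]
  let ?k = "ker C N (check_b C N D)"
  define J where "J = S2_iso C N D"
  define L where "L = Lambek C N (sq_S D) (sq_S1 C N D)"
  define M where "M = Lambek_vert C N (sq_S2 C N D) (sq_S1 C N D)"
  define \<Lambda> where "\<Lambda> = Lambek C N (sq_S D) (sq_T D)"
  define lS where "lS = sq_l C N (sq_S D)"
  define dS where "dS = coker C N (sq_lam C N (sq_S D))"
  define d2 where "d2 = coker C N (sq_lam C N (sq_S2 C N D))"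
  define \<rho>1 where "\<rho>1 = ker C N (sq_rho C N (sq_S1 C N D))"
  define \<rho>T where "\<rho>T = ker C N (sq_rho C N (sq_T D))"
  define rT where "rT = sq_r C N (sq_T D)"
  define rvT where "rvT = sq_rv C N (sq_T D)"
  define r1 where "r1 = sq_r C N (sq_S1 C N D)"
  define rv1 where "rv1 = sq_rv C N (sq_S1 C N D)"
  define l2 where "l2 = sq_l C N (sq_S2 C N D)"
  define lv2 where "lv2 = sq_lv C N (sq_S2 C N D)"
  have pS: "is_pullback C (im C N b) (im C N f') lS (sq_lv C N (sq_S D))"
    using sq_pullback[of "sq_S D"] by (simp add: lS_def)
  have p2: "is_pullback C (im C N ?k) (im C N (coker C N f)) l2 lv2"
    using sq_pullback[of "sq_S2 C N D"] by (simp add: l2_def lv2_def)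
  have oT: "is_pushout C (coim C N b) (coim C N g) rT rvT"
    using sq_pushout[of "sq_T D"] by (simp add: rT_def rvT_def)
  have o1: "is_pushout C (coim C N b) (coim C N (coker C N f)) r1 rv1"
    using sq_pushout[of "sq_S1 C N D"] by (simp add: r1_def rv1_def)
  note [simp] = is_pullbackD(3,6)[OF pS] is_pullbackD(3,4,6,7,8)[OF p2] is_pushoutD(3,4,6,7,8)[OF oT] is_pushoutD(3,4,6,7,8)[OF o1]
  note [simp] = sq_lam(1-3)[of "sq_S D", simplified, folded lS_def] sq_lam(1-3)[of "sq_S2 C N D", simplified, folded l2_def]
    sq_rho(1-3)[of "sq_S1 C N D", simplified, folded r1_def] sq_rho(1-3)[of "sq_T D", simplified, folded rT_def]
  have ds [simp]: "dS \<in> Mor C" "Dom C dS = Dom C lS" "epic C dS" "d2 \<in> Mor C" "Dom C d2 = Dom C l2" "epic C d2"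
    "\<rho>1 \<in> Mor C" "Cod C \<rho>1 = Cod C rv1" "monic C \<rho>1" "\<rho>T \<in> Mor C" "Cod C \<rho>T = Cod C rvT" "monic C \<rho>T"
    by (simp_all add: dS_def d2_def \<rho>1_def \<rho>T_def)
  note Le = Lambek[of "sq_S D" "sq_S1 C N D"] and Me = Lambek_vert[of "sq_S2 C N D" "sq_S1 C N D"]
    and \<Lambda>e = Lambek[of "sq_S D" "sq_T D"]
  have L [simp]: "L \<in> Mor C" "iso C L" "Dom C L = Cod C dS" "Cod C L = Dom C \<rho>1"
    and Le: "\<rho>1 \<cdot> L \<cdot> dS = r1 \<cdot> inverse_mor C (bar C N b) \<cdot> lS"
    using Le(1-4) Le(5) b by (simp_all add: L_def dS_def \<rho>1_def r1_def lS_def is_kernel_ker)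
  have M [simp]: "M \<in> Mor C" "iso C M" "Dom C M = Cod C d2" "Cod C M = Dom C \<rho>1"
    and Me: "\<rho>1 \<cdot> M \<cdot> d2 = rv1 \<cdot> inverse_mor C (bar C N (coker C N f)) \<cdot> lv2"
    using Me(1-4) Me(5) cf
    by (simp_all add: M_def d2_def \<rho>1_def rv1_def lv2_def is_kernel_coker)
  have \<Lambda> [simp]: "\<Lambda> \<in> Mor C" "Dom C \<Lambda> = Cod C dS" "Cod C \<Lambda> = Dom C \<rho>T"
    and \<Lambda>e: "\<rho>T \<cdot> \<Lambda> \<cdot> dS = rT \<cdot> inverse_mor C (bar C N b) \<cdot> lS"
    using \<Lambda>e(1-4) b by (simp_all add: \<Lambda>_def dS_def \<rho>T_def rT_def lS_def)
  obtain s where s [simp]: "s \<in> Mor C" "iso C s" "Dom C s = Dom C l2" "Cod C s = Dom C ?k"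
    and ks: "?k \<cdot> s = im C N ?k \<cdot> l2"
    and J [simp]: "J \<in> Mor C" "iso C J" "Dom C J = Cod C d2" "Cod C J = Cod C (coker C N (xi C N D))"
    and Jd: "J \<cdot> d2 = coker C N (xi C N D) \<cdot> s"
    unfolding l2_def J_def d2_def by (rule S2_iso)
  define t where "t = inverse_mor C L \<cdot> M \<cdot> inverse_mor C J"
  have t [simp]: "t \<in> Mor C" "iso C t" "Dom C t = Cod C (coker C N (xi C N D))" "Cod C t = Cod C dS"
    by (simp_all add: t_def)
  have beta: "beta C N D = t \<cdot> coker C N (xi C N D) \<cdot> ker C N (eta C N D)"
    by (simp add: beta_def t_def L_def[symmetric] M_def[symmetric] J_def[symmetric])
  text \<open>\<open>x\<close> is the inverse image of \<open>Im f'\<close> along \<open>b\<close>; it maps onto \<open>Ker check_b\<close>.\<close>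
  define x where "x = ker C N (coker C N f' \<cdot> b)"
  have x: "is_kernel C N (check_b C N D \<cdot> coker C N f) x"
    unfolding x_def check_b_coker by (rule is_kernel_ker) simp
  have [simp]: "x \<in> Mor C" "Cod C x = Cod C f" using is_kernelD[OF x] by simp_all
  \<comment> \<open>Applied to \<open>coker f\<close> and \<open>check_b\<close>,
    \<open>subquotient_right\<close> makes \<open>coker f \<cdot> x\<close> a cokernel followed by a
    kernel of \<open>check_b\<close>. Hence its lift \<open>q\<close> to the chosen kernel is epic
    and may be cancelled at the end.\<close>
  obtain p i where pi: "coker C N f \<cdot> x = i \<cdot> p" "is_kernel C N (check_b C N D) i" "cokernel_mor C N p" "Dom C i = Cod C p" "Dom C p = Dom C x"
    by (rule subquotient_right[OF _ x]) (simp, simp, simp, blast)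
  note [simp] = is_kernelD(2,3)[OF pi(2)] pi(3-5) pi(3)[THEN cokernel_mor_Mor]
  obtain w where [simp]: "w \<in> Mor C" "iso C w" "Dom C w = Dom C i" "Cod C w = Dom C ?k" and w: "?k \<cdot> w = i"
    using is_kernel_unique[OF pi(2) is_kernel_ker] by auto
  define q where "q = w \<cdot> p"
  have q [simp]: "q \<in> Mor C" "epic C q" "Dom C q = Dom C x" "Cod C q = Dom C ?k" and kq: "?k \<cdot> q = coker C N f \<cdot> x"
    by (simp_all add: q_def pi(1) reassoc[OF w])
  have bb: "im C N b \<cdot> bar C N b \<cdot> coim C N b \<cdot> x = b \<cdot> x"
    using assoc[of x "bar C N b \<cdot> coim C N b" "im C N b"] by simp
  \<comment> \<open>\<open>lS\<close> is the meet of \<open>Im b\<close> and \<open>Im f'\<close>,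
    and \<open>coker f'\<close> kills \<open>b \<cdot> x\<close>; this lets the restriction of
    \<open>b\<close> to \<open>x\<close> factor through \<open>lS\<close>, giving
    \<open>y\<close>.\<close>
  have "is_kernel C N (coker C N f' \<cdot> im C N b) lS"
    by (rule pullback_kernel[OF pS is_kernel_im]) simp
  moreover have "(coker C N f' \<cdot> im C N b) \<cdot> (bar C N b \<cdot> coim C N b \<cdot> x) \<in> N"
    using is_kernelD(4)[OF x] by (simp add: bb reassoc[OF check_b_coker])
  ultimately obtain y where [simp]: "y \<in> Mor C" "Dom C y = Dom C x" "Cod C y = Dom C lS"
    and y: "lS \<cdot> y = bar C N b \<cdot> coim C N b \<cdot> x"
    using kernel_factor[of "coker C N f' \<cdot> im C N b" lS "bar C N b \<cdot> coim C N b \<cdot> x"] by auto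
  have "im C N (coker C N f) \<cdot> lv2 \<cdot> inverse_mor C s \<cdot> q = im C N ?k \<cdot> l2 \<cdot> inverse_mor C s \<cdot> q"
    by (simp add: reassoc[OF is_pullbackD(9)[OF p2]])
  also have "\<dots> = ?k \<cdot> q"
    by (simp add: reassoc[OF ks[symmetric]])
  also have "\<dots> = im C N (coker C N f) \<cdot> bar C N (coker C N f) \<cdot> coim C N (coker C N f) \<cdot> x"
    using assoc[of x "bar C N (coker C N f) \<cdot> coim C N (coker C N f)" "im C N (coker C N f)"] by (simp add: kq)
  finally have lv: "lv2 \<cdot> inverse_mor C s \<cdot> q = bar C N (coker C N f) \<cdot> coim C N (coker C N f) \<cdot> x"
    by (rule monicD[rotated]) simp_all
  \<comment> \<open>Both Lambek morphisms into \<open>Ker S1\<close> are evaluated on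
    \<open>x\<close>. One arrives from \<open>Coim (coker f)\<close> and the other from
    \<open>Coim b\<close>, and the pushout equation of \<open>S1\<close> identifies them.\<close>
  have "\<rho>1 \<cdot> M \<cdot> inverse_mor C J \<cdot> coker C N (xi C N D) \<cdot> q = \<rho>1 \<cdot> M \<cdot> inverse_mor C J \<cdot> (coker C N (xi C N D) \<cdot> s) \<cdot> inverse_mor C s \<cdot> q"
    by simp
  also have "\<dots> = (\<rho>1 \<cdot> M \<cdot> d2) \<cdot> inverse_mor C s \<cdot> q"
    unfolding Jd[symmetric] by simp
  also have "\<dots> = rv1 \<cdot> coim C N (coker C N f) \<cdot> x"
    unfolding Me by (simp add: lv)
  also have "\<dots> = r1 \<cdot> coim C N b \<cdot> x"
    by (simp add: reassoc[OF is_pushoutD(9)[OF o1]])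
  also have "\<dots> = (r1 \<cdot> inverse_mor C (bar C N b) \<cdot> lS) \<cdot> y"
    by (simp add: y)
  also have "\<dots> = \<rho>1 \<cdot> L \<cdot> dS \<cdot> y"
    unfolding Le[symmetric] by simp
  finally have "M \<cdot> inverse_mor C J \<cdot> coker C N (xi C N D) \<cdot> q = L \<cdot> dS \<cdot> y"
    by (rule monicD[rotated]) simp_all
  then have tq: "t \<cdot> coker C N (xi C N D) \<cdot> q = dS \<cdot> y"
    by (simp add: t_def)
  have "\<rho>T \<cdot> \<Lambda> \<cdot> t \<cdot> coker C N (xi C N D) = rvT \<cdot> z \<cdot> ?k"
    if [simp]: "z \<in> Mor C" "Dom C z = Cod C (coker C N f)" "Cod C z = Cod C (coim C N g)" and z: "z \<cdot> coker C N f = coim C N g" for z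
  proof (rule epicD[OF q(2)])
    \<comment> \<open>The isomorphism \<open>bar b\<close> cancels against its inverse, and the
      pushout equation of \<open>T\<close> exchanges \<open>Coim b\<close> for
      \<open>Coim g\<close>, which \<open>z\<close> reaches from \<open>Coker f\<close>.\<close>
    have "(\<rho>T \<cdot> \<Lambda> \<cdot> t \<cdot> coker C N (xi C N D)) \<cdot> q = (\<rho>T \<cdot> \<Lambda> \<cdot> dS) \<cdot> y"
      by (simp add: tq)
    also have "\<dots> = rT \<cdot> coim C N b \<cdot> x"
      unfolding \<Lambda>e by (simp add: y)
    also have "\<dots> = rvT \<cdot> coim C N g \<cdot> x"
      by (simp add: reassoc[OF is_pushoutD(9)[OF oT]])
    also have "\<dots> = (rvT \<cdot> z \<cdot> ?k) \<cdot> q"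
      by (simp add: kq reassoc[OF z])
    finally show "(\<rho>T \<cdot> \<Lambda> \<cdot> t \<cdot> coker C N (xi C N D)) \<cdot> q = (rvT \<cdot> z \<cdot> ?k) \<cdot> q" .
  qed simp_all
  with t beta show thesis
    using \<Lambda> by (intro that[of t]) (simp_all add: \<Lambda>_def \<rho>T_def rvT_def)
qed

end

context homological_category
begin

lemma iso_mono_kernels:
  assumes "monic C i" "monic C j" "Cod C i = Cod C j"
    "\<exists>s\<in>Mor C. Cod C s = Dom C j \<and> j \<cdot> s = i" "\<exists>t\<in>Mor C. Cod C t = Dom C i \<and> i \<cdot> t = j"
  shows "iso C (lift C j i)" "lift C j i \<in> Mor C" "Dom C (lift C j i) = Dom C i" "Cod C (lift C j i) = Dom C j"
proof -
  obtain s t where st: "s\<in>Mor C" "Cod C s = Dom C j" "j \<cdot> s = i" "t\<in>Mor C" "Cod C t = Dom C i" "i \<cdot> t = j"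
    using assms(4,5) by blast
  have "lift C j i = s" "iso C s"
    by (rule iso_lift[OF assms(1,2) st(3,6,1,2,4,5)])+
  moreover have "Dom C s = Dom C i"
    using comp(2)[of s j] st(1,2) monic_Mor[OF assms(2)] unfolding st(3) by simp
  ultimately show "iso C (lift C j i)" "lift C j i \<in> Mor C" "Dom C (lift C j i) = Dom C i" "Cod C (lift C j i) = Dom C j"
    using st by simp_all
qed

lemma iso_epi_cokernels:
  assumes "epic C p" "epic C q" "Dom C p = Dom C q"
    "\<exists>s\<in>Mor C. Dom C s = Cod C q \<and> s \<cdot> q = p" "\<exists>t\<in>Mor C. Dom C t = Cod C p \<and> t \<cdot> p = q"
  shows "iso C (colift C q p)" "colift C q p \<in> Mor C" "Cod C (colift C q p) = Cod C p" "Dom C (colift C q p) = Cod C q"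
  using homological_category.iso_mono_kernels[OF op, of p q] assms by simp_all

lemma sharp:
  assumes [simp]: "f \<in> Mor C" "g \<in> Mor C" "Dom C g = Cod C f" "g \<cdot> f \<in> N"
  shows "sharp C N f g \<in> Mor C" "Dom C (sharp C N f g) = Dom C f" "Cod C (sharp C N f g) = Dom C (ker C N g)"
    "ker C N g \<cdot> sharp C N f g = f"
  using lift[OF is_kernel_ker[of g], of f] by (simp_all add: sharp_def)

end

section \<open>Exactness at \<open>Im S\<close> and exactness of the Lambek morphism\<close>

context ladder
begin

lemma Lambda_exact:
  assumes b: "exact_mor C N b" and g: "exact_mor C N g" and eta: "exact_mor C N (eta C N D)"
  shows "exact_at C N (beta C N D) (Lambek C N (sq_S D) (sq_T D))"
    and "exact_mor C N (Lambek C N (sq_S D) (sq_T D))"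
proof -
  define \<Lambda> where "\<Lambda> = Lambek C N (sq_S D) (sq_T D)"
  define \<rho> where "\<rho> = sq_rho C N (sq_T D)"
  define rv where "rv = sq_rv C N (sq_T D)"
  let ?k = "ker C N (check_b C N D)"
  obtain t where t [simp]: "t \<in> Mor C" "iso C t" "Dom C t = Cod C (coker C N (xi C N D))" "Cod C t = Dom C \<Lambda>"
    and beta: "beta C N D = t \<cdot> coker C N (xi C N D) \<cdot> ker C N (eta C N D)"
    and tz: "\<And>z. \<lbrakk>z \<in> Mor C; Dom C z = Cod C (coker C N f); Cod C z = Cod C (coim C N g); z \<cdot> coker C N f = coim C N g\<rbrakk> \<Longrightarrow>
      ker C N \<rho> \<cdot> \<Lambda> \<cdot> t \<cdot> coker C N (xi C N D) = rv \<cdot> z \<cdot> ?k"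
    unfolding \<Lambda>_def \<rho>_def rv_def by (fact beta[OF b])
  have po: "is_pushout C (coim C N b) (coim C N g) (sq_r C N (sq_T D)) rv"
    using sq_pushout[of "sq_T D"] by (simp add: rv_def)
  note [simp] = is_pushoutD(4,7)[OF po]
  have \<rho> [simp]: "\<rho> \<in> Mor C" "Dom C \<rho> = Cod C rv"
    using sq_rho(1,2)[of "sq_T D"] is_pushoutD(8)[OF po] by (simp_all add: \<rho>_def)
  have \<Lambda> [simp]: "\<Lambda> \<in> Mor C" "Cod C \<Lambda> = Dom C (ker C N \<rho>)"
    using Lambek(1,3)[of "sq_S D" "sq_T D"] b by (simp_all add: \<Lambda>_def \<rho>_def)
  note [simp] = exact_morD(2)[OF g] iso_Mor[OF exact_morD(2)[OF g]]
  \<comment> \<open>Exactness of \<open>g\<close> makes \<open>m\<close> a kernel, so subobjects of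
    \<open>Coim g\<close> can be compared after embedding them in the codomain of
    \<open>g\<close>.\<close>
  define m where "m = im C N g \<cdot> bar C N g"
  have m [simp]: "m \<in> Mor C" "kernel_mor C N m" "Dom C m = Cod C (coim C N g)" "Cod C m = Cod C g"
    and mg: "m \<cdot> coim C N g = g"
    by (simp_all add: m_def)
  have "m \<cdot> (coim C N g \<cdot> f) \<in> N" by (simp add: reassoc[OF mg])
  then have "coim C N g \<cdot> f \<in> N" by simp
  then obtain z where [simp]: "z \<in> Mor C" "Dom C z = Cod C (coker C N f)" "Cod C z = Cod C (coim C N g)"
    and z: "z \<cdot> coker C N f = coim C N g"
    using cokernel_factor[OF is_cokernel_coker, of f "coim C N g"] by auto
  have "(m \<cdot> z) \<cdot> coker C N f = flat C N f g \<cdot> coker C N f"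
    by (simp add: z mg)
  then have mz: "m \<cdot> z = flat C N f g"
    by (rule epicD[rotated]) simp_all
  obtain i q where iq: "kernel_mor C N i" "cokernel_mor C N q" "Dom C i = Cod C q" "eta C N D = i \<cdot> q"
    by (rule exact_morE[OF eta])
  note [simp] = iq(1-3) iq(1)[THEN kernel_mor_Mor] iq(2)[THEN cokernel_mor_Mor]
  have [simp]: "Dom C q = Dom C ?k" "Cod C i = Dom C (ker C N c)"
    using arg_cong[OF iq(4), of "Dom C"] arg_cong[OF iq(4), of "Cod C"] by simp_all
  have mzk: "m \<cdot> z \<cdot> ?k = ker C N c \<cdot> i \<cdot> q"
    by (simp add: reassoc[OF mz] ker_eta[symmetric] iq(4))
  \<comment> \<open>\<open>ker c \<cdot> i \<cdot> q\<close> factors through \<open>m\<close>.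
    Cancelling the cokernel \<open>q\<close> shows that the image of \<open>eta\<close> does so as
    well, and \<open>i'\<close> embeds it in \<open>Coim g\<close>.\<close>
  have "(coker C N m \<cdot> ker C N c \<cdot> i) \<cdot> q \<in> N"
    by (simp add: mzk[symmetric])
  then have "coker C N m \<cdot> (ker C N c \<cdot> i) \<in> N"
    by (simp del: assoc)
  then obtain i' where [simp]: "i' \<in> Mor C" "Dom C i' = Dom C i" "Cod C i' = Dom C m" and i': "m \<cdot> i' = ker C N c \<cdot> i"
    using kernel_factor[OF is_kernel_coker[OF m(2)], of "ker C N c \<cdot> i"] by auto
  have ki [simp]: "kernel_mor C N i'"
    by (rule kernel_mor_cancel[of m]) (simp_all add: i')
  have "m \<cdot> z \<cdot> ?k = m \<cdot> i' \<cdot> q"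
    by (simp add: mzk reassoc[OF i'])
  then have j: "z \<cdot> ?k = i' \<cdot> q"
    by (rule monicD[rotated]) simp_all
  \<comment> \<open>The coprojection \<open>rv\<close> divides \<open>Coim g\<close> by the image of
    \<open>Ker b\<close>. This map factors through the kernel \<open>i'\<close>, which is the
    situation of \<open>subquotient_left\<close>.\<close>
  have "is_cokernel C N (coim C N g \<cdot> ker C N b) rv"
    by (rule pushout_cokernel[OF is_pushout_sym[OF po] is_cokernel_coim]) simp
  also have "coim C N g \<cdot> ker C N b = i' \<cdot> q \<cdot> xi C N D"
    by (simp add: z[symmetric] ker_xi[symmetric] reassoc[OF j])
  finally have rv: "is_cokernel C N (i' \<cdot> q \<cdot> xi C N D) rv" .
  obtain \<pi> \<iota> where pi: "rv \<cdot> i' = \<iota> \<cdot> \<pi>" "is_cokernel C N (q \<cdot> xi C N D) \<pi>" "kernel_mor C N \<iota>" "Dom C \<iota> = Cod C \<pi>" "Cod C \<iota> = Cod C rv"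
    by (rule subquotient_left[OF ki rv]) (simp, simp, blast)
  have cpi: "cokernel_mor C N \<pi>" using pi(2) by (auto simp: cokernel_mor_def)
  note [simp] = is_cokernelD(2,3)[OF pi(2)] pi(3-5) kernel_mor_Mor[OF pi(3)] cpi
  have rvk: "ker C N \<rho> \<cdot> \<Lambda> \<cdot> t \<cdot> coker C N (xi C N D) = \<iota> \<cdot> \<pi> \<cdot> q"
    by (subst tz[of z]) (simp_all add: z j reassoc[OF pi(1)])
  \<comment> \<open>By \<open>rvk\<close>, \<open>\<iota> \<cdot> \<pi> \<cdot> q\<close> passes
    through \<open>ker \<rho>\<close>. The cokernel \<open>\<pi> \<cdot> q\<close> cancels for
    nullity, so \<open>\<iota>\<close> itself lifts to \<open>Ker \<rho>\<close>, again as a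
    kernel.\<close>
  have "(\<rho> \<cdot> \<iota>) \<cdot> (\<pi> \<cdot> q) \<in> N"
    by (simp add: rvk[symmetric])
  then have "\<rho> \<cdot> \<iota> \<in> N" by (simp del: assoc)
  then obtain \<iota>' where [simp]: "\<iota>' \<in> Mor C" "Dom C \<iota>' = Dom C \<iota>" "Cod C \<iota>' = Dom C (ker C N \<rho>)" and i2: "ker C N \<rho> \<cdot> \<iota>' = \<iota>"
    using kernel_factor[OF is_kernel_ker, of \<rho> \<iota>] by auto
  have [simp]: "kernel_mor C N \<iota>'"
    by (rule kernel_mor_cancel[of "ker C N \<rho>"]) (simp_all add: i2)
  have "(\<pi> \<cdot> q) \<cdot> xi C N D \<in> N" using is_cokernelD(4)[OF pi(2)] by simp
  then obtain \<sigma> where [simp]: "\<sigma> \<in> Mor C" "Cod C \<sigma> = Cod C \<pi>" "Dom C \<sigma> = Cod C (coker C N (xi C N D))"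
    and \<sigma>: "\<sigma> \<cdot> coker C N (xi C N D) = \<pi> \<cdot> q"
    using cokernel_factor[OF is_cokernel_coker, of "xi C N D" "\<pi> \<cdot> q"] by auto
  have c\<sigma> [simp]: "cokernel_mor C N \<sigma>"
    by (rule cokernel_mor_cancel[of _ "coker C N (xi C N D)"]) (simp_all add: \<sigma>)
  have "ker C N \<rho> \<cdot> \<Lambda> \<cdot> t \<cdot> coker C N (xi C N D) = ker C N \<rho> \<cdot> \<iota>' \<cdot> \<sigma> \<cdot> coker C N (xi C N D)"
    by (simp add: rvk reassoc[OF i2] \<sigma>)
  then have "\<Lambda> \<cdot> t \<cdot> coker C N (xi C N D) = \<iota>' \<cdot> \<sigma> \<cdot> coker C N (xi C N D)"
    by (rule monicD[rotated]) simp_all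
  then have "(\<Lambda> \<cdot> t) \<cdot> coker C N (xi C N D) = (\<iota>' \<cdot> \<sigma>) \<cdot> coker C N (xi C N D)"
    by simp
  then have \<Lambda>t: "\<Lambda> \<cdot> t = \<iota>' \<cdot> \<sigma>"
    by (rule epicD[rotated]) simp_all
  have "exact_mor C N (\<Lambda> \<cdot> t)"
    unfolding \<Lambda>t by (rule exact_morI) simp_all
  from exact_mor_iso[OF this, of "inverse_mor C t" "Ident C (Cod C \<Lambda>)"]
  show "exact_mor C N (Lambek C N (sq_S D) (sq_T D))"
    by (simp add: \<Lambda>_def[symmetric])
  \<comment> \<open>Because \<open>i\<close> reflects null morphisms, \<open>q\<close> has the same
    kernel as \<open>eta\<close>; being a cokernel, it is then a cokernel of
    \<open>ker eta\<close>.\<close>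
  have "is_kernel C N q (ker C N (eta C N D))"
    using is_kernel_ker[of "eta C N D"] by (rule is_kernel_cong) (simp_all add: iq(4))
  then have q: "is_cokernel C N (ker C N (eta C N D)) q"
    by (rule is_cokernel_of_kernel) simp
  \<comment> \<open>An isomorphism theorem for quotients of \<open>Ker check_b\<close>: dividing by
    \<open>Im xi\<close> and then by \<open>Ker eta\<close> agrees with dividing by
    \<open>Ker eta\<close>, which gives \<open>q\<close>, and then by the image of
    \<open>q \<cdot> xi\<close>, which gives \<open>\<pi>\<close>.\<close>
  have c: "is_cokernel C N (coker C N (xi C N D) \<cdot> ker C N (eta C N D)) \<sigma>"
  proof (rule is_cokernelI)
    show "\<sigma> \<cdot> coker C N (xi C N D) \<cdot> ker C N (eta C N D) \<in> N"
      using is_cokernelD(4)[OF q] by (simp add: reassoc[OF \<sigma>])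
    fix y assume [simp]: "y \<in> Mor C" "Dom C y = Cod C (coker C N (xi C N D) \<cdot> ker C N (eta C N D))"
      and n: "y \<cdot> coker C N (xi C N D) \<cdot> ker C N (eta C N D) \<in> N"
    obtain u where [simp]: "u \<in> Mor C" "Cod C u = Cod C y" "Dom C u = Cod C q" and u: "u \<cdot> q = y \<cdot> coker C N (xi C N D)"
      using cokernel_factor[OF q, of "y \<cdot> coker C N (xi C N D)"] n by auto
    have "u \<cdot> q \<cdot> xi C N D \<in> N" by (simp add: reassoc[OF u])
    then obtain v where [simp]: "v \<in> Mor C" "Cod C v = Cod C y" "Dom C v = Cod C \<pi>" and v: "v \<cdot> \<pi> = u"
      using cokernel_factor[OF pi(2), of u] by auto
    have "(v \<cdot> \<sigma>) \<cdot> coker C N (xi C N D) = y \<cdot> coker C N (xi C N D)"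
      by (simp add: \<sigma> reassoc[OF v] u)
    then have "v \<cdot> \<sigma> = y" by (rule epicD[rotated]) simp_all
    then show "\<exists>v\<in>Mor C. Dom C v = Cod C \<sigma> \<and> v \<cdot> \<sigma> = y"
      by (intro bexI[of _ v]) simp_all
  qed simp_all
  have k: "is_kernel C N (\<Lambda> \<cdot> t) (ker C N \<sigma>)"
    unfolding \<Lambda>t by (rule is_kernel_comp[OF is_kernel_ker]) simp_all
  have "exact_at C N (coker C N (xi C N D) \<cdot> ker C N (eta C N D)) (\<Lambda> \<cdot> t)"
    by (rule exact_atI[OF c _ k], rule is_kernel_ker) simp
  from exact_at_iso[OF this, of "Ident C (Dom C (ker C N (eta C N D)))" t "Ident C (Cod C \<Lambda>)"]
  show "exact_at C N (beta C N D) (Lambek C N (sq_S D) (sq_T D))"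
    by (simp add: \<Lambda>_def[symmetric] beta)
qed

section \<open>The induced map on homology and its kernel\<close>

lemma hat_b [simp]:
  "hat_b C N D \<in> Mor C" "Dom C (hat_b C N D) = Dom C (ker C N g)"
  "Cod C (hat_b C N D) = Dom C (ker C N g')"
  and ker_hat_b: "ker C N g' \<cdot> hat_b C N D = b \<cdot> ker C N g"
proof -
  have "g' \<cdot> (b \<cdot> ker C N g) \<in> N" by (simp add: reassoc[OF cg[symmetric]])
  from lift[OF is_kernel_ker[of g'] _ _ this]
  show "hat_b C N D \<in> Mor C" "Dom C (hat_b C N D) = Dom C (ker C N g)"
    "Cod C (hat_b C N D) = Dom C (ker C N g')" "ker C N g' \<cdot> hat_b C N D = b \<cdot> ker C N g"
    by (simp_all add: hat_b_def)
qed

lemma sharps [simp]: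
  "sharp C N f g \<in> Mor C" "Dom C (sharp C N f g) = Dom C f" "Cod C (sharp C N f g) = Dom C (ker C N g)"
  "ker C N g \<cdot> sharp C N f g = f"
  "sharp C N f' g' \<in> Mor C" "Dom C (sharp C N f' g') = Dom C f'" "Cod C (sharp C N f' g') = Dom C (ker C N g')"
  "ker C N g' \<cdot> sharp C N f' g' = f'"
  using sharp[of f g] sharp[of f' g'] by simp_all

lemma homology_projs [simp]:
  "homology_proj C N f g \<in> Mor C" "Dom C (homology_proj C N f g) = Dom C (ker C N g)"
  "cokernel_mor C N (homology_proj C N f g)"
  "homology_proj C N f' g' \<in> Mor C" "Dom C (homology_proj C N f' g') = Dom C (ker C N g')"
  "cokernel_mor C N (homology_proj C N f' g')"
  by (simp_all add: homology_proj_def)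

lemma hat_b_sharp: "hat_b C N D \<cdot> sharp C N f g = sharp C N f' g' \<cdot> a"
  by (rule monicD[of "ker C N g'"]) (simp_all add: reassoc[OF ker_hat_b] reassoc[OF sharps(8)] bf)

lemma hom_map [simp]:
  "hom_map C N D \<in> Mor C" "Dom C (hom_map C N D) = Cod C (homology_proj C N f g)"
  "Cod C (hom_map C N D) = Cod C (homology_proj C N f' g')"
  and hom_map_proj: "hom_map C N D \<cdot> homology_proj C N f g = homology_proj C N f' g' \<cdot> hat_b C N D"
proof -
  have "homology_proj C N f' g' \<cdot> sharp C N f' g' \<in> N" by (simp add: homology_proj_def)
  then have n: "(homology_proj C N f' g' \<cdot> hat_b C N D) \<cdot> sharp C N f g \<in> N"
    using null_reassoc[of "homology_proj C N f' g'" "sharp C N f' g'" a] by (simp add: hat_b_sharp)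
  have c: "is_cokernel C N (sharp C N f g) (homology_proj C N f g)"
    unfolding homology_proj_def by (rule is_cokernel_coker) simp
  from colift[OF c _ _ n]
  show "hom_map C N D \<in> Mor C" "Dom C (hom_map C N D) = Cod C (homology_proj C N f g)"
    "Cod C (hom_map C N D) = Cod C (homology_proj C N f' g')"
    "hom_map C N D \<cdot> homology_proj C N f g = homology_proj C N f' g' \<cdot> hat_b C N D"
    by (simp_all add: hom_map_def)
qed

text \<open>Seen in \<open>Coker f\<close>, both subobjects consist of what is killed by
  \<open>check_b\<close> and by \<open>flat f g\<close>, so each factors through the other.\<close>

lemma ker_h_iso [simp]:
  "iso C (ker_h_iso C N D)" "ker_h_iso C N D \<in> Mor C"
  "Dom C (ker_h_iso C N D) = Dom C (ker C N (hom_map C N D))"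
  "Cod C (ker_h_iso C N D) = Dom C (ker C N (eta C N D))"
proof -
  let ?h = "hom_map C N D"
  define m where "m = homology_iso C N f g"
  define m' where "m' = homology_iso C N f' g'"
  define \<phi> where "\<phi> = ker C N (flat C N f g)"
  define \<phi>' where "\<phi>' = ker C N (flat C N f' g')"
  have \<phi> [simp]: "\<phi> \<in> Mor C" "kernel_mor C N \<phi>" "Cod C \<phi> = Cod C (coker C N f)"
    "\<phi>' \<in> Mor C" "kernel_mor C N \<phi>'" "Cod C \<phi>' = Cod C (coker C N f')"
    by (simp_all add: \<phi>_def \<phi>'_def)
  have m [simp]: "m \<in> Mor C" "iso C m" "Dom C m = Cod C (homology_proj C N f g)" "Cod C m = Dom C \<phi>"
    "m' \<in> Mor C" "iso C m'" "Dom C m' = Cod C (homology_proj C N f' g')" "Cod C m' = Dom C \<phi>'"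
    and \<phi>m: "\<phi> \<cdot> m \<cdot> homology_proj C N f g = coker C N f \<cdot> ker C N g"
    and \<phi>m': "\<phi>' \<cdot> m' \<cdot> homology_proj C N f' g' = coker C N f' \<cdot> ker C N g'"
    using homology_iso[of f g] homology_iso[of f' g'] by (simp_all add: \<phi>_def \<phi>'_def m_def m'_def)
  \<comment> \<open>The homology isomorphisms carry \<open>?h\<close>, defined through
    \<open>hat_b\<close>, to the restriction of \<open>check_b\<close>. Since
    \<open>\<phi>' \<cdot> m'\<close> is a kernel, \<open>Ker ?h\<close> can then be computed with
    \<open>check_b\<close>.\<close>
  have "(\<phi>' \<cdot> m' \<cdot> ?h) \<cdot> homology_proj C N f g = (\<phi>' \<cdot> m' \<cdot> homology_proj C N f' g') \<cdot> hat_b C N D"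
    by (simp add: hom_map_proj)
  also have "\<dots> = check_b C N D \<cdot> coker C N f \<cdot> ker C N g"
    unfolding \<phi>m' by (simp add: ker_hat_b reassoc[OF check_b_coker])
  also have "\<dots> = (check_b C N D \<cdot> \<phi> \<cdot> m) \<cdot> homology_proj C N f g"
    by (simp add: \<phi>m)
  finally have h: "\<phi>' \<cdot> m' \<cdot> ?h = check_b C N D \<cdot> \<phi> \<cdot> m"
    by (rule epicD[rotated]) simp_all
  have "is_kernel C N ((\<phi>' \<cdot> m') \<cdot> ?h) (ker C N ?h)"
    by (rule is_kernel_comp[OF is_kernel_ker]) simp_all
  then have kh: "is_kernel C N (check_b C N D \<cdot> \<phi> \<cdot> m) (ker C N ?h)"
    by (simp add: h)
  define i where "i = \<phi> \<cdot> m \<cdot> ker C N ?h"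
  define j where "j = ker C N (check_b C N D) \<cdot> ker C N (eta C N D)"
  have ij [simp]: "i \<in> Mor C" "j \<in> Mor C" "monic C i" "monic C j" "Dom C i = Dom C (ker C N ?h)" "Dom C j = Dom C (ker C N (eta C N D))"
    "Cod C i = Cod C (coker C N f)" "Cod C j = Cod C (coker C N f)"
    by (simp_all add: i_def j_def)
  have "\<exists>s\<in>Mor C. Cod C s = Dom C j \<and> j \<cdot> s = i"
  proof -
    have "check_b C N D \<cdot> i \<in> N"
      using is_kernelD(4)[OF kh] by (simp add: i_def)
    then obtain y where [simp]: "y \<in> Mor C" "Dom C y = Dom C i" "Cod C y = Dom C (ker C N (check_b C N D))"
      and y: "ker C N (check_b C N D) \<cdot> y = i"
      using kernel_factor[OF is_kernel_ker, of "check_b C N D" i] by auto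
    have [simp]: "flat C N f g \<cdot> \<phi> \<in> N" by (simp add: \<phi>_def)
    have "ker C N c \<cdot> (eta C N D \<cdot> y) = flat C N f g \<cdot> \<phi> \<cdot> m \<cdot> ker C N ?h"
      by (simp add: reassoc[OF ker_eta] y) (simp add: i_def)
    also have "\<dots> \<in> N" by simp
    finally have "eta C N D \<cdot> y \<in> N" by simp
    then obtain s where [simp]: "s \<in> Mor C" "Dom C s = Dom C i" "Cod C s = Dom C (ker C N (eta C N D))"
      and s: "ker C N (eta C N D) \<cdot> s = y"
      using kernel_factor[OF is_kernel_ker, of "eta C N D" y] by auto
    show ?thesis by (rule bexI[of _ s]) (simp_all add: j_def s y)
  qed
  moreover have "\<exists>t\<in>Mor C. Cod C t = Dom C i \<and> i \<cdot> t = j"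
  proof -
    have "flat C N f g \<cdot> j \<in> N"
      by (simp add: j_def reassoc[OF ker_eta[symmetric]])
    then obtain y where [simp]: "y \<in> Mor C" "Dom C y = Dom C j" "Cod C y = Dom C \<phi>" and y: "\<phi> \<cdot> y = j"
      using kernel_factor[OF is_kernel_ker, of "flat C N f g" j] by (auto simp: \<phi>_def)
    have "(check_b C N D \<cdot> \<phi> \<cdot> m) \<cdot> (inverse_mor C m \<cdot> y) \<in> N"
      by (simp add: y) (simp add: j_def)
    then obtain t where [simp]: "t \<in> Mor C" "Dom C t = Dom C j" "Cod C t = Dom C (ker C N ?h)"
      and t: "ker C N ?h \<cdot> t = inverse_mor C m \<cdot> y"
      using kernel_factor[OF kh, of "inverse_mor C m \<cdot> y"] by auto
    show ?thesis by (rule bexI[of _ t]) (simp_all add: i_def t y)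
  qed
  ultimately have "iso C (lift C j i)" "lift C j i \<in> Mor C" "Dom C (lift C j i) = Dom C (ker C N ?h)"
    "Cod C (lift C j i) = Dom C (ker C N (eta C N D))"
    using iso_mono_kernels[of i j] by simp_all
  then show "iso C (ker_h_iso C N D)" "ker_h_iso C N D \<in> Mor C"
    "Dom C (ker_h_iso C N D) = Dom C (ker C N (hom_map C N D))"
    "Cod C (ker_h_iso C N D) = Dom C (ker C N (eta C N D))"
    by (simp_all add: ker_h_iso_def i_def[unfolded \<phi>_def m_def] j_def)
qed

end

subsection \<open>Duality\<close>

lemma op_flat [simp]: "flat (op C) N f g = sharp C N g f" "sharp (op C) N f g = flat C N g f"
  by (simp_all add: flat_def sharp_def)

text \<open>In the opposite category the rows and the verticals are both read backwards, so the
  primed row comes first and \<open>c\<close> comes before \<open>a\<close>. The constants are built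
  from \<open>lift\<close>, \<open>colift\<close>, \<open>ker\<close> and \<open>coker\<close>, all
  of which dualize on the nose.\<close>

lemma op_ladder_mor [simp]:
  fixes f g f' g' a b c :: 'm
  defines "D \<equiv> Ladder f g f' g' a b c" and "E \<equiv> Ladder g' f' g f c b a"
  shows "hat_b (op C) N E = check_b C N D" "check_b (op C) N E = hat_b C N D"
    "xi (op C) N E = xi' C N D" "eta (op C) N E = eta' C N D"
    "hat_f (op C) N E = check_g' C N D" "hat_g (op C) N E = check_f' C N D"
    "lam (op C) N E = lam' C N D" "mu (op C) N E = mu' C N D" "v_mor (op C) N E = u_mor C N D"
    "kappa (op C) N E = kappa' C N D" "p_mor (op C) N E = p_mor' C N D"
proof -
  show 1: "hat_b (op C) N E = check_b C N D" "check_b (op C) N E = hat_b C N D"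
    by (simp_all add: D_def E_def hat_b_def check_b_def)
  show 2: "xi (op C) N E = xi' C N D" "eta (op C) N E = eta' C N D"
    "hat_f (op C) N E = check_g' C N D" "hat_g (op C) N E = check_f' C N D"
    using 1 by (simp_all add: D_def E_def xi_def xi'_def eta_def eta'_def hat_f_def check_g'_def hat_g_def check_f'_def)
  show 3: "lam (op C) N E = lam' C N D" "mu (op C) N E = mu' C N D" "v_mor (op C) N E = u_mor C N D"
    using 2 by (simp_all add: lam_def lam'_def mu_def mu'_def v_mor_def u_mor_def)
  show "kappa (op C) N E = kappa' C N D" "p_mor (op C) N E = p_mor' C N D"
    using 3 by (simp_all add: kappa_def kappa'_def p_mor_def p_mor'_def)
qed

lemma op_ladder_sq [simp]:
  fixes f g f' g' a b c :: 'm
  defines "D \<equiv> Ladder f g f' g' a b c" and "E \<equiv> Ladder g' f' g f c b a"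
  shows "sq_S0 (op C) N E = flip (sq_T0 C N D)"
    "sq_S1 (op C) N E = flip (sq_T1 C N D)" "sq_S2 (op C) N E = flip (sq_T2 C N D)"
  by (simp_all add: D_def E_def sq_S0_def sq_S1_def sq_S2_def sq_T0_def sq_T1_def sq_T2_def)

context homological_category
begin

lemma op_exact_mor [simp]: "exact_mor (op C) N f = exact_mor C N f"
  by (auto simp: exact_mor_def op_bar)

text \<open>\<open>im\<close> does not dualize to itself, but the witnesses do: a kernel
  \<open>k\<close> of \<open>f\<close> with cokernel \<open>q\<close> is also a kernel of
  \<open>q\<close>, so the same pair proves exactness in the original category.\<close>

lemma op_exact_at:
  assumes "exact_at (op C) N f g" shows "exact_at C N g f"
proof -
  obtain k q where kq: "is_kernel C N f k" "is_cokernel C N k q" "is_cokernel C N g q"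
    using homological_category.exact_atE[OF op assms] by auto
  then have "kernel_mor C N k" by (auto simp: kernel_mor_def)
  then show ?thesis
    by (rule exact_atI[OF kq(3) is_kernel_of_cokernel[OF kq(2)] kq(1)])
qed

lemma op_sq_lam: "comm_square C S \<Longrightarrow> sq_lam (op C) N (flip S) = sq_rho C N S"
  by (simp add: op_sq_rho)

lemma op_sq_rho': "comm_square C S \<Longrightarrow> sq_rho (op C) N (flip S) = sq_lam C N S"
  using homological_category.op_sq_rho[OF op, of "flip S"] by simp

text \<open>The equation that defines a Lambek morphism is bracketed the other way in the opposite
  category. Both candidates satisfy the same equation after reassociation, and cancelling the kernel
  and the cokernel identifies them.\<close>

lemma op_Lambek:
  assumes S: "comm_square C S" and T: "comm_square C T" and ST: "left_of T = right_of S"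
    and b: "exact_mor C N (right_of S)"
    and null: "top_of T \<cdot> top_of S \<in> N" "bottom_of T \<cdot> bottom_of S \<in> N"
  shows "Lambek (op C) N (flip T) (flip S) = Lambek C N S T"
proof -
  define L where "L = Lambek C N S T"
  define M where "M = Lambek (op C) N (flip T) (flip S)"
  note [simp] = sq_lam(1)[OF S] sq_rho(1)[OF T]
  note l = Lambek[OF S T ST b null, folded L_def]
  note m = homological_category.Lambek(1-4)[OF op, of "flip T" "flip S", folded M_def, simplified, OF T S _ _ null(2,1)]
  note [simp] = is_pullbackD(3,4,6,7,8)[OF sq_pullback[OF S]] is_pushoutD(3,4,6,7,8)[OF sq_pushout[OF T]]
    exact_morD(2)[OF b] iso_Mor[OF exact_morD(2)[OF b]] exact_morD(1)[OF b] ST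
  have M [simp]: "M \<in> Mor C" "Dom C M = Cod C (coker C N (sq_lam C N S))" "Cod C M = Dom C (ker C N (sq_rho C N T))"
    using m(1-3) b by (simp_all add: op_sq_lam[OF T] op_sq_rho'[OF S])
  note [simp] = l(1-3)
  have "(ker C N (sq_rho C N T) \<cdot> M) \<cdot> coker C N (sq_lam C N S) =
    (sq_r C N T \<cdot> inverse_mor C (bar C N (right_of S))) \<cdot> sq_l C N S"
    using m(4) b by (simp add: op_sq_lam[OF T] op_sq_rho'[OF S] op_bar del: assoc)
  then have "ker C N (sq_rho C N T) \<cdot> M \<cdot> coker C N (sq_lam C N S) =
    ker C N (sq_rho C N T) \<cdot> L \<cdot> coker C N (sq_lam C N S)"
    using l(4) by simp
  then have "M \<cdot> coker C N (sq_lam C N S) = L \<cdot> coker C N (sq_lam C N S)"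
    by (rule monicD[rotated]) simp_all
  then have "M = L"
    by (rule epicD[rotated]) simp_all
  then show ?thesis by (simp add: L_def M_def)
qed

lemma op_Lambek_vert:
  assumes S: "comm_square C S" and T: "comm_square C T" and ST: "top_of T = bottom_of S"
    and b: "exact_mor C N (bottom_of S)"
    and null: "left_of T \<cdot> left_of S \<in> N" "right_of T \<cdot> right_of S \<in> N"
  shows "Lambek_vert (op C) N (flip T) (flip S) = Lambek_vert C N S T"
proof -
  define L where "L = Lambek_vert C N S T"
  define M where "M = Lambek_vert (op C) N (flip T) (flip S)"
  note [simp] = sq_lam(1)[OF S] sq_rho(1)[OF T]
  note l = Lambek_vert[OF S T ST b null, folded L_def]
  note m = homological_category.Lambek_vert(1-4)[OF op, of "flip T" "flip S", folded M_def, simplified, OF T S _ _ null(2,1)]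
  note [simp] = is_pullbackD(3,4,6,7,8)[OF sq_pullback[OF S]] is_pushoutD(3,4,6,7,8)[OF sq_pushout[OF T]]
    exact_morD(2)[OF b] iso_Mor[OF exact_morD(2)[OF b]] exact_morD(1)[OF b] ST
  have M [simp]: "M \<in> Mor C" "Dom C M = Cod C (coker C N (sq_lam C N S))" "Cod C M = Dom C (ker C N (sq_rho C N T))"
    using m(1-3) b by (simp_all add: op_sq_lam[OF T] op_sq_rho'[OF S])
  note [simp] = l(1-3)
  have "(ker C N (sq_rho C N T) \<cdot> M) \<cdot> coker C N (sq_lam C N S) =
    (sq_rv C N T \<cdot> inverse_mor C (bar C N (bottom_of S))) \<cdot> sq_lv C N S"
    using m(4) b by (simp add: op_sq_lam[OF T] op_sq_rho'[OF S] op_bar del: assoc)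
  then have "ker C N (sq_rho C N T) \<cdot> M \<cdot> coker C N (sq_lam C N S) =
    ker C N (sq_rho C N T) \<cdot> L \<cdot> coker C N (sq_lam C N S)"
    using l(4) by simp
  then have "M \<cdot> coker C N (sq_lam C N S) = L \<cdot> coker C N (sq_lam C N S)"
    by (rule monicD[rotated]) simp_all
  then have "M = L"
    by (rule epicD[rotated]) simp_all
  then show ?thesis by (simp add: L_def M_def)
qed

lemma same_subI:
  assumes "is_kernel C N h k"
  shows "same_sub C k (ker C N h)"
proof -
  note [simp] = is_kernelD[OF assms]
  obtain t where "t \<in> Mor C" "iso C t" "Dom C t = Dom C k" "Cod C t = Dom C (ker C N h)" "ker C N h \<cdot> t = k"
    using is_kernel_unique[OF assms is_kernel_ker] by auto
  then show ?thesis unfolding same_sub_def hom_def by (intro conjI bexI[of _ t]) simp_all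
qed

lemma same_quotI:
  assumes "is_cokernel C N h k"
  shows "same_quot C k (coker C N h)"
proof -
  note [simp] = is_cokernelD[OF assms]
  obtain t where "t \<in> Mor C" "iso C t" "Cod C t = Cod C k" "Dom C t = Cod C (coker C N h)" "t \<cdot> coker C N h = k"
    using is_cokernel_unique[OF assms is_cokernel_coker] by auto
  then show ?thesis unfolding same_quot_def hom_def by (intro conjI bexI[of _ t]) simp_all
qed

end

section \<open>The reversed ladder and the dual half of the sequence\<close>

context ladder
begin

lemma op_ladder: "ladder (op C) N g' f' g f c b a"
  using op diagram bf cg by (auto simp: ladder_def ladder_axioms_def ladder_diagram_def)

lemma op_sq_S_T [simp]:
  "sq_S (Ladder g' f' g f c b a) = flip (sq_T D)" "sq_T (Ladder g' f' g f c b a) = flip (sq_S D)"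
  by (simp_all add: sq_S_def sq_T_def)

lemma kappa_beta_exact:
  assumes "exact_mor C N b" "exact_mor C N (coker C N f \<cdot> ker C N b)"
  shows "exact_at C N (kappa C N D) (beta C N D)"
proof -
  obtain t where t: "t \<in> Mor C" "iso C t" "Dom C t = Cod C (coker C N (xi C N D))"
    "beta C N D = t \<cdot> coker C N (xi C N D) \<cdot> ker C N (eta C N D)"
    by (rule beta[OF assms(1)])
  show ?thesis
    using exact_at_iso[OF kappa_exact(1)[OF assms(2)], of "Ident C (Dom C (kappa C N D))" "Ident C (Cod C (kappa C N D))" t] t
    by simp
qed

lemma dual_comm_squares [simp]:
  "comm_square C (sq_T0 C N D)" "comm_square C (sq_T1 C N D)" "comm_square C (sq_T2 C N D)"
  using ladder.comm_squares[OF op_ladder] by simp_all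

lemma dual_square_sel [simp]:
  "top_of (sq_T0 C N D) = g'" "left_of (sq_T0 C N D) = coker C N b"
  "right_of (sq_T0 C N D) = coker C N c" "bottom_of (sq_T0 C N D) = check_g' C N D"
  "top_of (sq_T1 C N D) = ker C N g" "left_of (sq_T1 C N D) = hat_b C N D"
  "right_of (sq_T1 C N D) = b" "bottom_of (sq_T1 C N D) = ker C N g'"
  "top_of (sq_T2 C N D) = ker C N g'" "left_of (sq_T2 C N D) = coker C N (hat_b C N D)"
  "right_of (sq_T2 C N D) = coker C N b" "bottom_of (sq_T2 C N D) = xi' C N D"
  by (simp_all add: sq_T0_def sq_T1_def sq_T2_def)

lemma xi' [simp]:
  "xi' C N D \<in> Mor C" "Cod C (xi' C N D) = Cod C (coker C N b)"
  "Dom C (xi' C N D) = Cod C (coker C N (hat_b C N D))"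
  using ladder.xi[OF op_ladder] by simp_all

lemma eta' [simp]:
  "eta' C N D \<in> Mor C" "Cod C (eta' C N D) = Cod C (coker C N (hat_b C N D))"
  "Dom C (eta' C N D) = Cod C (coker C N a)"
  and coker_eta': "eta' C N D \<cdot> coker C N a = coker C N (hat_b C N D) \<cdot> sharp C N f' g'"
  using ladder.eta[OF op_ladder] ladder.ker_eta[OF op_ladder] by simp_all

lemma check_f' [simp]:
  "check_f' C N D \<in> Mor C" "Cod C (check_f' C N D) = Cod C (coker C N b)"
  "Dom C (check_f' C N D) = Cod C (coker C N a)"
  and xi'_eta': "xi' C N D \<cdot> eta' C N D = check_f' C N D"
  using ladder.hat_g[OF op_ladder] ladder.eta_xi[OF op_ladder] by simp_all

lemma check_g' [simp]:
  "check_g' C N D \<in> Mor C" "Cod C (check_g' C N D) = Cod C (coker C N c)"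
  "Dom C (check_g' C N D) = Cod C (coker C N b)"
  using ladder.hat_f[OF op_ladder] by simp_all

lemma lam' [simp]:
  "lam' C N D \<in> Mor C" "Cod C (lam' C N D) = Cod C (coker C N c)"
  "Dom C (lam' C N D) = Cod C (coker C N (xi' C N D))"
  "lam' C N D \<cdot> coker C N (xi' C N D) = check_g' C N D"
  using ladder.lam[OF op_ladder] by simp_all

lemma mu' [simp]:
  "mu' C N D \<in> Mor C" "Cod C (mu' C N D) = Cod C (coker C N (xi' C N D))"
  "Dom C (mu' C N D) = Cod C (coker C N (xi' C N D \<cdot> eta' C N D))"
  "mu' C N D \<cdot> coker C N (xi' C N D \<cdot> eta' C N D) = coker C N (xi' C N D)"
  using ladder.mu[OF op_ladder] by simp_all

lemma kappa' [simp]: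
  "kappa' C N D \<in> Mor C" "Cod C (kappa' C N D) = Dom C (ker C N (lam' C N D \<cdot> mu' C N D))"
  "Dom C (kappa' C N D) = Cod C (coker C N (eta' C N D))"
  using ladder.kappa[OF op_ladder] by simp_all

lemma p_mor' [simp]:
  "p_mor' C N D \<in> Mor C" "Cod C (p_mor' C N D) = Dom C (ker C N (lam' C N D))"
  "Dom C (p_mor' C N D) = Dom C (ker C N (lam' C N D \<cdot> mu' C N D))"
  using ladder.p_mor[OF op_ladder] by simp_all

lemma op_T0_iso: "S0_iso (op C) N (Ladder g' f' g f c b a) = T0_iso C N D"
  by (simp add: S0_iso_def T0_iso_def op_sq_lam)

lemma op_T2_iso: "S2_iso (op C) N (Ladder g' f' g f c b a) = T2_iso C N D"
  by (simp add: S2_iso_def T2_iso_def op_sq_lam)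

lemma T0_iso [simp]:
  "iso C (T0_iso C N D)" "T0_iso C N D \<in> Mor C"
  "Cod C (T0_iso C N D) = Dom C (ker C N (sq_rho C N (sq_T0 C N D)))"
  "Dom C (T0_iso C N D) = Dom C (ker C N (lam' C N D))"
  using ladder.S0_iso[OF op_ladder] by (simp_all add: op_T0_iso op_sq_lam)

lemma T2_iso [simp]:
  "iso C (T2_iso C N D)" "T2_iso C N D \<in> Mor C"
  "Cod C (T2_iso C N D) = Dom C (ker C N (sq_rho C N (sq_T2 C N D)))"
  "Dom C (T2_iso C N D) = Dom C (ker C N (xi' C N D))"
  by (rule ladder.S2_iso[OF op_ladder], simp add: op_T2_iso op_sq_lam)+

lemma op_p1:
  assumes g': "exact_mor C N g'"
  shows "p1 (op C) N (Ladder g' f' g f c b a) = p1' C N D"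
proof -
  note L = Lambek_vert[of "sq_T D" "sq_T0 C N D"]
  have [simp]: "iso C (Lambek_vert C N (sq_T D) (sq_T0 C N D))"
    by (rule L(5)) (simp_all add: g' is_kernel_ker)
  have [simp]: "Lambek_vert (op C) N (flip (sq_T0 C N D)) (flip (sq_T D)) = Lambek_vert C N (sq_T D) (sq_T0 C N D)"
    by (rule op_Lambek_vert) (simp_all add: g')
  note [simp] = L(1-3)[simplified, OF g']
  show ?thesis by (simp add: p1_def p1'_def op_T0_iso)
qed

text \<open>After the factors have been dualized, the two composites differ in bracketing; the
  domains and codomains that justify reassociation come from the Lambek lemmas, which need
  \<open>b\<close> exact.\<close>

lemma op_beta:
  assumes b: "exact_mor C N b"
  shows "beta (op C) N (Ladder g' f' g f c b a) = beta' C N D"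
proof -
  note L = Lambek[of "sq_T1 C N D" "sq_T D"] and M = Lambek_vert[of "sq_T1 C N D" "sq_T2 C N D"]
  have g: "exact_mor C N (ker C N g')" by (rule kernel_mor_exact) simp
  have [simp]: "iso C (Lambek C N (sq_T1 C N D) (sq_T D))"
    by (rule L(5)) (simp_all add: b is_kernel_coker)
  have [simp]: "Lambek (op C) N (flip (sq_T D)) (flip (sq_T1 C N D)) = Lambek C N (sq_T1 C N D) (sq_T D)"
    by (rule op_Lambek) (simp_all add: b)
  have [simp]: "Lambek_vert (op C) N (flip (sq_T2 C N D)) (flip (sq_T1 C N D)) = Lambek_vert C N (sq_T1 C N D) (sq_T2 C N D)"
    by (rule op_Lambek_vert) (simp_all add: g)
  note [simp] = L(1-3)[simplified, OF b] M(1-3)[simplified, OF g]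
  show ?thesis by (simp add: beta_def beta'_def op_T2_iso)
qed

lemma op_Lambda:
  assumes b: "exact_mor C N b"
  shows "Lambek (op C) N (flip (sq_T D)) (flip (sq_S D)) = Lambek C N (sq_S D) (sq_T D)"
  by (rule op_Lambek) (simp_all add: b)

text \<open>This is not the dual of \<open>ker_h_iso\<close>: dualizing \<open>hom_map\<close> gives
  the map induced by \<open>check_b\<close> on right homologies. For quotients of
  \<open>Ker g'\<close> the left form is the convenient one, and the two quotients are compared
  directly, each being universal for killing \<open>hat_b\<close> and
  \<open>sharp f' g'\<close>.\<close>

lemma coker_h_iso [simp]:
  "iso C (coker_h_iso C N D)" "coker_h_iso C N D \<in> Mor C"
  "Cod C (coker_h_iso C N D) = Cod C (coker C N (hom_map C N D))"
  "Dom C (coker_h_iso C N D) = Cod C (coker C N (eta' C N D))"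
proof -
  define h where "h = hom_map C N D"
  define \<pi> where "\<pi> = homology_proj C N f g"
  define \<pi>' where "\<pi>' = homology_proj C N f' g'"
  have [simp]: "\<pi> \<in> Mor C" "Dom C \<pi> = Dom C (ker C N g)" "cokernel_mor C N \<pi>"
    "\<pi>' \<in> Mor C" "Dom C \<pi>' = Dom C (ker C N g')" "cokernel_mor C N \<pi>'"
    "h \<in> Mor C" "Dom C h = Cod C \<pi>" "Cod C h = Cod C \<pi>'" and h: "h \<cdot> \<pi> = \<pi>' \<cdot> hat_b C N D"
    by (simp_all add: h_def \<pi>_def \<pi>'_def hom_map_proj)
  have pi': "is_cokernel C N (sharp C N f' g') \<pi>'"
    unfolding \<pi>'_def homology_proj_def by (rule is_cokernel_coker) simp
  note [simp] = is_cokernelD(4)[OF pi']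
  define p where "p = coker C N h \<cdot> \<pi>'"
  define q where "q = coker C N (eta' C N D) \<cdot> coker C N (hat_b C N D)"
  have pq [simp]: "p \<in> Mor C" "epic C p" "Dom C p = Dom C (ker C N g')" "q \<in> Mor C" "epic C q" "Dom C q = Dom C (ker C N g')"
    "Cod C p = Cod C (coker C N h)" "Cod C q = Cod C (coker C N (eta' C N D))"
    by (simp_all add: p_def q_def)
  have "\<exists>s\<in>Mor C. Dom C s = Cod C q \<and> s \<cdot> q = p"
  proof -
    have "p \<cdot> hat_b C N D \<in> N"
      by (simp add: p_def h[symmetric])
    then obtain y where [simp]: "y \<in> Mor C" "Cod C y = Cod C p" "Dom C y = Cod C (coker C N (hat_b C N D))"
      and y: "y \<cdot> coker C N (hat_b C N D) = p"
      using cokernel_factor[OF is_cokernel_coker, of "hat_b C N D" p] by auto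
    have "(y \<cdot> eta' C N D) \<cdot> coker C N a \<in> N"
      by (simp add: coker_eta' reassoc[OF y]) (simp add: p_def)
    then have "y \<cdot> eta' C N D \<in> N" by (simp del: assoc)
    then obtain s where [simp]: "s \<in> Mor C" "Cod C s = Cod C p" "Dom C s = Cod C (coker C N (eta' C N D))"
      and s: "s \<cdot> coker C N (eta' C N D) = y"
      using cokernel_factor[OF is_cokernel_coker, of "eta' C N D" y] by auto
    show ?thesis by (rule bexI[of _ s]) (simp_all add: q_def reassoc[OF s] y)
  qed
  moreover have "\<exists>t\<in>Mor C. Dom C t = Cod C p \<and> t \<cdot> p = q"
  proof -
    have "q \<cdot> sharp C N f' g' \<in> N"
      by (simp add: q_def coker_eta'[symmetric])
    then obtain y where [simp]: "y \<in> Mor C" "Cod C y = Cod C q" "Dom C y = Cod C \<pi>'" and y: "y \<cdot> \<pi>' = q"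
      using cokernel_factor[OF pi', of q] by auto
    have "(y \<cdot> h) \<cdot> \<pi> \<in> N"
      by (simp add: h reassoc[OF y]) (simp add: q_def)
    then have "y \<cdot> h \<in> N" by (simp del: assoc)
    then obtain t where [simp]: "t \<in> Mor C" "Cod C t = Cod C q" "Dom C t = Cod C (coker C N h)" and t: "t \<cdot> coker C N h = y"
      using cokernel_factor[OF is_cokernel_coker, of h y] by auto
    show ?thesis by (rule bexI[of _ t]) (simp_all add: p_def reassoc[OF t] y)
  qed
  ultimately have "iso C (colift C q p)" "colift C q p \<in> Mor C" "Cod C (colift C q p) = Cod C (coker C N h)"
    "Dom C (colift C q p) = Cod C (coker C N (eta' C N D))"
    using iso_epi_cokernels[of p q] by simp_all
  then show "iso C (coker_h_iso C N D)" "coker_h_iso C N D \<in> Mor C"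
    "Cod C (coker_h_iso C N D) = Cod C (coker C N (hom_map C N D))"
    "Dom C (coker_h_iso C N D) = Cod C (coker C N (eta' C N D))"
    by (simp_all add: coker_h_iso_def p_def[unfolded h_def \<pi>'_def] q_def h_def)
qed

text \<open>\<open>lam' \<cdot> mu'\<close> satisfies the equation that determines
  \<open>flat check_f' check_g'\<close>, so its kernel is the right-hand homology of the cokernel
  row.\<close>

lemma homology_iso_check [simp]:
  "homology_iso C N (check_f' C N D) (check_g' C N D) \<in> Mor C"
  "iso C (homology_iso C N (check_f' C N D) (check_g' C N D))"
  "Cod C (homology_iso C N (check_f' C N D) (check_g' C N D)) = Dom C (ker C N (lam' C N D \<cdot> mu' C N D))"
proof -
  have l: "(lam' C N D \<cdot> mu' C N D) \<cdot> coker C N (check_f' C N D) = check_g' C N D"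
    using mu'(4) mu'(3) by (simp add: xi'_eta')
  have "flat C N (check_f' C N D) (check_g' C N D) = lam' C N D \<cdot> mu' C N D"
    unfolding flat_def by (rule colift_eq) (use l mu'(3) in \<open>simp_all add: xi'_eta'\<close>)
  moreover have "check_g' C N D \<cdot> check_f' C N D \<in> N"
    unfolding l[symmetric] using mu'(3) by (simp add: xi'_eta')
  ultimately show "homology_iso C N (check_f' C N D) (check_g' C N D) \<in> Mor C"
    "iso C (homology_iso C N (check_f' C N D) (check_g' C N D))"
    "Cod C (homology_iso C N (check_f' C N D) (check_g' C N D)) = Dom C (ker C N (lam' C N D \<cdot> mu' C N D))"
    using homology_iso[of "check_f' C N D" "check_g' C N D"] by simp_all
qed

section \<open>The sequence with its canonical identifications\<close>

lemma nomura_p1_kappa: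
  assumes "exact_mor C N f"
  shows "same_sub C (nomura_p1 C N D) (ker C N (nomura_kappa C N D))"
  unfolding nomura_p1_def nomura_kappa_def
  by (rule same_subI, rule is_kernel_comp[OF nomura_p1[OF assms]]) simp_all

text \<open>Duality yields the claim for \<open>Ker (lam' \<cdot> mu')\<close>; conjugating with the
  two identifications moves it to \<open>Coker h\<close> and to the left form of the
  homology.\<close>

lemma nomura_p1'_kappa':
  assumes "exact_mor C N g'"
  shows "same_quot C (nomura_p1' C N D) (coker C N (nomura_kappa' C N D))"
proof (rule same_quotI)
  let ?i = "homology_iso C N (check_f' C N D) (check_g' C N D)"
  have "is_cokernel C N (kappa' C N D) (p1' C N D)"
    using ladder.nomura_p1[OF op_ladder] assms by (simp add: op_p1)
  then have "is_cokernel C N (kappa' C N D \<cdot> inverse_mor C (coker_h_iso C N D)) (p1' C N D)"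
    by (rule is_cokernel_comp) simp_all
  then have "is_cokernel C N (inverse_mor C ?i \<cdot> kappa' C N D \<cdot> inverse_mor C (coker_h_iso C N D))
     (p1' C N D \<cdot> inverse_mor C (inverse_mor C ?i))"
    by (rule is_cokernel_iso_shift) simp_all
  then show "is_cokernel C N (nomura_kappa' C N D) (nomura_p1' C N D)"
    by (simp add: nomura_kappa'_def nomura_p1'_def)
qed

lemma nomura_at_ker_h:
  assumes "exact_mor C N b" "exact_mor C N (coker C N f \<cdot> ker C N b)"
  shows "exact_at C N (nomura_kappa C N D) (nomura_beta C N D)" "exact_mor C N (nomura_kappa C N D)"
proof -
  have e: "exact_at C N (kappa C N D) (beta C N D)" by (rule kappa_beta_exact[OF assms])
  then have [simp]: "beta C N D \<in> Mor C" "Dom C (beta C N D) = Dom C (ker C N (eta C N D))"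
    by (simp_all add: exact_at_iff)
  show "exact_at C N (nomura_kappa C N D) (nomura_beta C N D)"
    using exact_at_iso[OF e, of "Ident C (Dom C (kappa C N D))" "inverse_mor C (ker_h_iso C N D)" "Ident C (Cod C (beta C N D))"]
    by (simp add: nomura_kappa_def nomura_beta_def)
  show "exact_mor C N (nomura_kappa C N D)"
    using exact_mor_iso[OF kappa_exact(2)[OF assms(2)], of "Ident C (Dom C (kappa C N D))" "inverse_mor C (ker_h_iso C N D)"]
    by (simp add: nomura_kappa_def)
qed

lemma nomura_at_coker_h:
  assumes "exact_mor C N b" "exact_mor C N (coker C N b \<cdot> ker C N g')"
  shows "exact_at C N (nomura_beta' C N D) (nomura_kappa' C N D)" "exact_mor C N (nomura_kappa' C N D)"
proof -
  let ?i = "homology_iso C N (check_f' C N D) (check_g' C N D)"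
  have e: "exact_at C N (beta' C N D) (kappa' C N D)"
    using op_exact_at[OF ladder.kappa_beta_exact[OF op_ladder]] assms by (simp add: op_beta)
  have k: "exact_mor C N (kappa' C N D)"
    using ladder.kappa_exact(2)[OF op_ladder] assms by simp
  have [simp]: "beta' C N D \<in> Mor C" "Cod C (beta' C N D) = Cod C (coker C N (eta' C N D))"
    using e by (simp_all add: exact_at_iff)
  show "exact_at C N (nomura_beta' C N D) (nomura_kappa' C N D)"
    using exact_at_iso[OF e, of "Ident C (Dom C (beta' C N D))" "coker_h_iso C N D" "inverse_mor C ?i"]
    by (simp add: nomura_kappa'_def nomura_beta'_def)
  show "exact_mor C N (nomura_kappa' C N D)"
    using exact_mor_iso[OF k, of "inverse_mor C (coker_h_iso C N D)" "inverse_mor C ?i"]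
    by (simp add: nomura_kappa'_def)
qed

lemma nomura_at_Im:
  assumes "exact_mor C N b" "exact_mor C N g" "exact_mor C N (eta C N D)"
  shows "exact_at C N (nomura_beta C N D) (nomura_Lambda C N D)" "exact_mor C N (nomura_Lambda C N D)"
proof -
  note e = Lambda_exact[OF assms]
  obtain t where t: "t \<in> Mor C" "Dom C t = Cod C (coker C N (xi C N D))"
    "beta C N D = t \<cdot> coker C N (xi C N D) \<cdot> ker C N (eta C N D)"
    by (rule beta[OF assms(1)])
  then have [simp]: "Dom C (beta C N D) = Dom C (ker C N (eta C N D))" by simp
  have [simp]: "beta C N D \<in> Mor C" "Lambek C N (sq_S D) (sq_T D) \<in> Mor C"
    "Dom C (Lambek C N (sq_S D) (sq_T D)) = Cod C (beta C N D)"
    using e by (simp_all add: exact_at_iff)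
  show "exact_at C N (nomura_beta C N D) (nomura_Lambda C N D)"
    using exact_at_iso[OF e(1), of "ker_h_iso C N D" "Ident C (Cod C (beta C N D))" "Ident C (Cod C (Lambek C N (sq_S D) (sq_T D)))"]
    by (simp add: nomura_beta_def nomura_Lambda_def)
  show "exact_mor C N (nomura_Lambda C N D)"
    using e(2) by (simp add: nomura_Lambda_def)
qed

text \<open>For the reversed ladder the second morphism of the first row is \<open>f'\<close> and
  the role of \<open>eta\<close> is played by \<open>eta'\<close>, while the Lambek morphism is
  carried to itself. So this is \<open>Lambda_exact\<close> in the opposite category.\<close>

lemma nomura_at_Ker:
  assumes "exact_mor C N b" "exact_mor C N f'" "exact_mor C N (eta' C N D)"
  shows "exact_at C N (nomura_Lambda C N D) (nomura_beta' C N D)" "exact_mor C N (nomura_Lambda C N D)"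
proof -
  have e: "exact_at C N (Lambek C N (sq_S D) (sq_T D)) (beta' C N D)" "exact_mor C N (Lambek C N (sq_S D) (sq_T D))"
    using op_exact_at[OF ladder.Lambda_exact(1)[OF op_ladder]] ladder.Lambda_exact(2)[OF op_ladder] assms
    by (simp_all add: op_beta op_Lambda)
  obtain t where t: "t \<in> Mor C" "Cod C t = Dom C (ker C N (xi' C N D))"
    "beta' C N D = (coker C N (eta' C N D) \<cdot> ker C N (xi' C N D)) \<cdot> t"
    by (rule ladder.beta[OF op_ladder]) (simp_all add: op_beta assms)
  then have [simp]: "Cod C (beta' C N D) = Cod C (coker C N (eta' C N D))" by simp
  have [simp]: "beta' C N D \<in> Mor C" "Lambek C N (sq_S D) (sq_T D) \<in> Mor C"
    "Cod C (Lambek C N (sq_S D) (sq_T D)) = Dom C (beta' C N D)"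
    using e by (simp_all add: exact_at_iff)
  show "exact_at C N (nomura_Lambda C N D) (nomura_beta' C N D)"
    using exact_at_iso[OF e(1), of "Ident C (Dom C (Lambek C N (sq_S D) (sq_T D)))" "Ident C (Dom C (beta' C N D))" "coker_h_iso C N D"]
    by (simp add: nomura_beta'_def nomura_Lambda_def)
  show "exact_mor C N (nomura_Lambda C N D)"
    using e(2) by (simp add: nomura_Lambda_def)
qed

end

theorem theorem6:
  fixes C :: "('o, 'm) cat" and N :: "'m set"
    and f g f' g' a b c :: 'm and D :: "'m ladder"
  assumes homological: "homological C N"
    and D: "D = Ladder f g f' g' a b c"
    and diagram: "ladder_diagram C N D"
    and exact_b: "exact_mor C N b"
    and exact_f: "exact_mor C N f"
    and exact_g': "exact_mor C N g'"
  shows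
    "same_sub C (nomura_p1 C N D) (ker C N (nomura_kappa C N D)) \<and>
     same_quot C (nomura_p1' C N D) (coker C N (nomura_kappa' C N D)) \<and>
     (exact_mor C N (coker C N f \<cdot>\<^bsub>C\<^esub> ker C N b) \<longrightarrow>
        exact_at C N (nomura_kappa C N D) (nomura_beta C N D) \<and>
        exact_mor C N (nomura_kappa C N D)) \<and>
     (exact_mor C N (coker C N b \<cdot>\<^bsub>C\<^esub> ker C N g') \<longrightarrow>
        exact_at C N (nomura_beta' C N D) (nomura_kappa' C N D) \<and>
        exact_mor C N (nomura_kappa' C N D)) \<and>
     (exact_mor C N g \<and> exact_mor C N (eta C N D) \<longrightarrow>
        exact_at C N (nomura_beta C N D) (nomura_Lambda C N D) \<and>
        exact_mor C N (nomura_Lambda C N D)) \<and>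
     (exact_mor C N f' \<and> exact_mor C N (eta' C N D) \<longrightarrow>
        exact_at C N (nomura_Lambda C N D) (nomura_beta' C N D) \<and>
        exact_mor C N (nomura_Lambda C N D))"
proof -
  interpret ladder C N f g f' g' a b c
    using homological diagram by unfold_locales (simp_all add: D)
  show ?thesis
    unfolding D
    using nomura_p1_kappa[OF exact_f] nomura_p1'_kappa'[OF exact_g'] nomura_at_ker_h[OF exact_b]
      nomura_at_coker_h[OF exact_b] nomura_at_Im[OF exact_b] nomura_at_Ker[OF exact_b]
    by blast
qed

end
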